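(* Let $n\geq 1$. Let $\mathcal A_{\mathrm{cut}}^{(n)}$ be the set of all $A\in\mathcal R^{n\times n}$ such that $\sigma(A(z))\cap(-\infty,0]=\emptyset$ for every $z\in\mathbb C$ with $|z|\leq 1$. Then $$\mathcal A_{\mathrm{cut}}^{(n)}=\bigl\{U^{-1}\,\mathcal C(Q_1)\,\mathcal C(Q_2)\,U:\ U\in\mathrm{GL}_n(\mathcal R),\ Q_1,Q_2\in\mathcal R^{n\times n},\ \|Q_1\|_\infty<1,\ \|Q_2\|_\infty<1\bigr\}.$$
   Context: $\mathcal R$ is the ring of real-rational functions (quotients of polynomials with real coefficients) in one variable $z$ that are analytic on a neighborhood of the closed unit disk $\{|z|\le 1\}$. $\mathrm{GL}_n(\mathcal R)$ is the group of matrices in $\mathcal R^{n\times n}$ whose inverse also lies in $\mathcal R^{n\times n}$. $\sigma(X)$ is the spectrum (set of complex eigenvalues) of a square matrix $X$. For $Q\in\mathcal R^{n\times n}$, $\|Q\|_\infty=\sup_{|z|<1}\|Q(z)\|$ with $\|\cdot\|$ the Euclidean operator norm. The Cayley transform is $\mathcal C(Q)=(I_n+Q)(I_n-Q)^{-1}$. *)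

theory Defs
  imports
    "HOL-Complex_Analysis.Complex_Analysis"
    "HOL-Computational_Algebra.Computational_Algebra"
    "HOL-Computational_Algebra.Field_as_Ring"
begin

text \<open>
  A real-rational function is an element of the field of fractions of \<^typ>\<open>real poly\<close>. Its value
  at a complex point is computed from the representation in lowest terms, so that removable
  singularities of a particular representation play no role; at a genuine pole the value is the
  dummy value 0.
\<close>

definition rat_eval :: "real poly fract \<Rightarrow> complex \<Rightarrow> complex" where
  "rat_eval f z =
     poly (map_poly of_real (fst (quot_of_fract f))) z /
     poly (map_poly of_real (snd (quot_of_fract f))) z"

text \<open>
  \<^const>\<open>analytic_on\<close> already refers to an open neighbourhood of the set. The dummy value at
  poles is harmless here, because a rational function is unbounded near a pole: see
  \<open>ratH_iff\<close> below.
\<close>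

definition ratH :: "real poly fract set" where
  "ratH = {f. rat_eval f analytic_on cball 0 1}"

definition ratH_mat :: "(real poly fract ^ 'n ^ 'n) set" where
  "ratH_mat = {A. \<forall>i j. A $ i $ j \<in> ratH}"

definition GL_ratH :: "(real poly fract ^ 'n ^ 'n) set" where
  "GL_ratH = {U \<in> ratH_mat. invertible U \<and> matrix_inv U \<in> ratH_mat}"

definition mat_eval :: "real poly fract ^ 'n ^ 'n \<Rightarrow> complex \<Rightarrow> complex ^ 'n ^ 'n" where
  "mat_eval A z = map_matrix (\<lambda>f. rat_eval f z) A"

definition spectrum :: "complex ^ 'n ^ 'n \<Rightarrow> complex set" where
  "spectrum X = {\<mu>. \<exists>v. v \<noteq> 0 \<and> X *v v = \<mu> *s v}"

text \<open>
  The supremum is taken in the reals, hence is meaningful only for families that are bounded on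
  the open disc, such as those in \<^const>\<open>ratH_mat\<close>.
\<close>

definition Hinf_norm :: "real poly fract ^ 'n ^ 'n \<Rightarrow> real" where
  "Hinf_norm Q = (SUP z\<in>ball 0 1. onorm (\<lambda>v. mat_eval Q z *v v))"

text \<open>
  \<^const>\<open>matrix_inv\<close> is the inverse over the field of real-rational functions; it is a genuine
  inverse of \<open>mat 1 - Q\<close> whenever \<open>Q\<close> is in \<^const>\<open>ratH_mat\<close> and \<open>Hinf_norm Q < 1\<close>.
\<close>

definition cayley :: "real poly fract ^ 'n ^ 'n \<Rightarrow> real poly fract ^ 'n ^ 'n" where
  "cayley Q = (mat 1 + Q) ** matrix_inv (mat 1 - Q)"

text \<open>\<^term>\<open>\<real>\<^sub>\<le>\<^sub>0\<close> is the half-line of nonpositive reals in the complex plane.\<close>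

definition A_cut :: "(real poly fract ^ 'n ^ 'n) set" where
  "A_cut = {A \<in> ratH_mat. \<forall>z. cmod z \<le> 1 \<longrightarrow> spectrum (mat_eval A z) \<inter> \<real>\<^sub>\<le>\<^sub>0 = {}}"

lemma of_real_poly_map_add:
  "map_poly of_real (p + q) = (map_poly of_real p + map_poly of_real q :: complex poly)"
  by (simp add: poly_eq_iff coeff_map_poly)

lemma of_real_poly_map_mult:
  "map_poly of_real (p * q) = (map_poly of_real p * map_poly of_real q :: complex poly)"
  by (simp add: poly_eq_iff coeff_map_poly coeff_mult)

lemma rat_eval_Fract:
  assumes "poly (map_poly of_real q) z \<noteq> (0::complex)"
  shows "rat_eval (Fraction_Field.Fract p q) z =
           poly (map_poly of_real p) z / poly (map_poly of_real q) z"
proof -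
  have q0: "q \<noteq> 0"
    using assms by auto
  obtain d where d: "p = fst (normalize_quot (p, q)) * d" "q = snd (normalize_quot (p, q)) * d"
    using normalize_quotE[OF q0, of p] by metis
  have hom: "poly (map_poly of_real (a * b)) z
      = poly (map_poly of_real a) z * (poly (map_poly of_real b) z :: complex)" for a b :: "real poly"
    by (simp add: of_real_poly_map_mult)
  have "quot_of_fract (Fraction_Field.Fract p q) = normalize_quot (p, q)"
    by (metis q0 quot_of_fract_quot_to_fract quot_to_fract_def case_prod_conv snd_conv)
  moreover have "poly (map_poly of_real d) z \<noteq> (0::complex)"
    using assms hom d(2) by (metis mult_zero_right)
  ultimately show ?thesis
    unfolding rat_eval_def
    using d hom by (metis mult_divide_mult_cancel_right)
qed

lemma ratH_iff:
  "f \<in> ratH \<longleftrightarrow>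
     (\<forall>z. cmod z \<le> 1 \<longrightarrow> poly (map_poly of_real (snd (quot_of_fract f))) z \<noteq> (0::complex))"
proof -
  define P Q :: "complex poly"
    where "P = map_poly of_real (fst (quot_of_fract f))"
      and "Q = map_poly of_real (snd (quot_of_fract f))"
  have ev: "rat_eval f = (\<lambda>z. poly P z / poly Q z)"
    by (auto simp: rat_eval_def P_def Q_def)
  have Q0: "Q \<noteq> 0"
    by (auto simp: Q_def map_poly_eq_0_iff)
  have cop: "poly P z \<noteq> 0" if "poly Q z = 0" for z
  proof -
    obtain u v where uv:
      "u * fst (quot_of_fract f) + v * snd (quot_of_fract f) = 1"
      using coprime_quot_of_fract[of f] by (metis bezout_coefficients_fst_snd coprime_imp_gcd_eq_1)
    have "poly (map_poly of_real u) z * poly P z + poly (map_poly of_real v) z * poly Q z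
          = poly (map_poly of_real 1) z"
      unfolding uv[symmetric]
      by (simp add: P_def Q_def of_real_poly_map_mult of_real_poly_map_add)
    with that show ?thesis
      by auto
  qed
  have "poly Q z \<noteq> 0" if an: "rat_eval f analytic_on cball 0 1" and z: "cmod z \<le> 1" for z
  proof
    assume Qz: "poly Q z = 0"
    have "isCont (rat_eval f) z"
      using an z by (intro analytic_at_imp_isCont) (auto elim: analytic_on_subset)
    then have "((\<lambda>w. rat_eval f w * poly Q w) \<longlongrightarrow> rat_eval f z * poly Q z) (at z)"
      by (intro tendsto_intros) (auto simp: isCont_def)
    moreover have "eventually (\<lambda>w. rat_eval f w * poly Q w = poly P w) (at z)"
    proof -
      have "eventually (\<lambda>w. w \<notin> {w. poly Q w = 0}) (at z)"
        using poly_roots_finite[OF Q0] islimpt_finite islimpt_iff_eventually by blast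
      then show ?thesis
        by eventually_elim (auto simp: ev)
    qed
    ultimately have "((\<lambda>w. poly P w) \<longlongrightarrow> rat_eval f z * poly Q z) (at z)"
      by (rule Lim_transform_eventually)
    moreover have "((\<lambda>w. poly P w) \<longlongrightarrow> poly P z) (at z)"
      by (intro tendsto_intros)
    ultimately have "poly P z = rat_eval f z * poly Q z"
      using tendsto_unique[OF at_neq_bot] by blast
    with Qz cop show False
      by simp
  qed
  moreover have "rat_eval f analytic_on cball 0 1" if "\<And>z. cmod z \<le> 1 \<Longrightarrow> poly Q z \<noteq> 0"
    unfolding ev using that by (auto simp: poly_altdef intro!: analytic_intros)
  ultimately show ?thesis
    unfolding ratH_def Q_def[symmetric] by auto
qed

end

theory Submission
  imports Defs
begin

text \<open>
  For the inclusion from right to left, the real part of \<open>\<C>(Q)\<close> is positive definite whenever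
  \<open>Q\<close> is a strict contraction, and a product of two such matrices has no eigenvalue \<open>\<le> 0\<close>.

  For the converse, \<open>A = \<surd>A \<cdot> \<surd>A\<close>, where each factor has its spectrum in the right half plane and
  so is a Cayley transform of a matrix with spectrum in the unit disc. The square root is not
  rational, but writing \<open>(1 + \<surd>A)\<^sup>m = E + \<surd>A O\<close> with polynomials \<open>E\<close>, \<open>O\<close> in \<open>A\<close>, both \<open>E / O\<close> and
  \<open>A O / E\<close> tend to \<open>\<surd>A\<close>, and their product is exactly \<open>A\<close>. For large \<open>m\<close> they are Cayley transforms
  of commuting rational matrices \<open>W1\<close>, \<open>W2\<close> with spectra in the open unit disc.

  A single similarity turns \<open>W1\<close> and \<open>W2\<close> into strict contractions: both contract the weighted norm
  \<open>\<Sum>\<^sub>j\<^sub>k |W1\<^sup>j W2\<^sup>k a|\<^sup>2\<close> (\<open>j, k < K\<close>) on the unit circle, and by the matrix Fejer-Riesz theorem this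
  norm equals \<open>|Y a|\<^sup>2\<close>, up to a scalar, with \<open>Y\<close> real polynomial and invertible on the closed disc;
  the maximum principle carries the bound into the disc. The spectral factor \<open>Y\<close> is obtained by
  orthonormalising polynomials with respect to the inverse weight \<open>G\<close> (Szego polynomials). Its rows
  \<open>y\<close> are orthogonal to the shifts \<open>z\<^sup>j e\<^sub>l\<close>, which forces \<open>G y\<close> to be analytic outside the disc;
  the Gram matrix of the rows is then analytic both inside and outside, hence constant.
\<close>

text \<open>A single \<open>U\<close> has to serve both factors. This is why the two approximants
  are quotients of polynomials in the same matrix \<open>A\<close>: they commute, so one weight can
  contract both. With \<open>s\<close> the principal root of an eigenvalue,
  \<open>P = (1 + s)^m\<close> and \<open>M = (1 - s)^m\<close>, they take the values
  \<open>s (P + M) / (P - M)\<close> and \<open>s (P - M) / (P + M)\<close>. The cut keeps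
  \<open>s\<close> in the open right half plane and compactness makes \<open>M / P\<close> uniformly
  small, so both values stay in that half plane, the Cayley image of the open unit disc. At a fixed
  \<open>z\<close> a contracting similarity is easy to find; the obstacle is to choose it analytic
  in \<open>z\<close>, with real coefficients. Only its Gram matrix on the circle matters, and this
  is rational in \<open>z\<close> and \<open>cnj z\<close>. Orthonormalising against the inverse of
  the weight produces factors of the weight itself.\<close>

no_notation fps_nth (infixl "$" 75)

section \<open>Means over the unit circle\<close>

definition circ_avg :: "(complex \<Rightarrow> complex) \<Rightarrow> complex" where
  "circ_avg f = integral {0..2*pi} (\<lambda>t. f (cis t)) / (2 * of_real pi)"

lemma continuous_on_cis_compose:
  assumes "continuous_on (sphere 0 1) f"
  shows "continuous_on S (\<lambda>t. f (cis t))"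
  by (rule continuous_on_compose2[OF assms]) (auto intro!: continuous_intros)

lemma integrable_cis_compose:
  fixes f :: "complex \<Rightarrow> complex"
  assumes "continuous_on (sphere 0 1) f"
  shows "(\<lambda>t. f (cis t)) integrable_on {0..2*pi}"
  by (intro integrable_continuous_real continuous_on_cis_compose assms)

lemma circ_avg_cong:
  "(\<And>z. cmod z = 1 \<Longrightarrow> f z = g z) \<Longrightarrow> circ_avg f = circ_avg g"
  unfolding circ_avg_def by (simp cong: integral_cong)

lemma circ_avg_add:
  assumes "continuous_on (sphere 0 1) f" "continuous_on (sphere 0 1) g"
  shows "circ_avg (\<lambda>z. f z + g z) = circ_avg f + circ_avg g"
  unfolding circ_avg_def
  by (simp add: Henstock_Kurzweil_Integration.integral_add integrable_cis_compose assms add_divide_distrib)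

lemma circ_avg_mult_left: "circ_avg (\<lambda>z. c * f z) = c * circ_avg f"
  unfolding circ_avg_def by simp

lemma circ_avg_sum:
  assumes "finite A" "\<And>a. a \<in> A \<Longrightarrow> continuous_on (sphere 0 1) (f a)"
  shows "circ_avg (\<lambda>z. \<Sum>a\<in>A. f a z) = (\<Sum>a\<in>A. circ_avg (f a))"
  unfolding circ_avg_def
  by (simp add: assms integral_sum integrable_cis_compose sum_divide_distrib)

lemma circ_avg_cnj: "circ_avg (\<lambda>z. cnj (f z)) = cnj (circ_avg f)"
  unfolding circ_avg_def by (simp add: Henstock_Kurzweil_Integration.integral_cnj)

text \<open>Substitution \<open>t \<mapsto> 2 * pi - t\<close>. It turns the mean of a function of
  \<open>cnj z\<close>, the form in which coanalytic parts appear, into the mean of an analytic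
  function.\<close>

lemma circ_avg_reflect:
  assumes "continuous_on (sphere 0 1) f"
  shows "circ_avg (\<lambda>z. f (cnj z)) = circ_avg f"
proof -
  have "((\<lambda>t. f (cis t)) has_integral integral {0..2*pi} (\<lambda>t. f (cis t))) (cbox 0 (2*pi))"
    using integrable_cis_compose[OF assms] by (simp add: has_integral_integral)
  from has_integral_affinity[OF this, of "-1" "2*pi"]
  have "((\<lambda>t. f (cis (2*pi - t))) has_integral integral {0..2*pi} (\<lambda>t. f (cis t)))
      ((\<lambda>x. 2*pi - x) ` {0..2*pi})"
    by (simp add: algebra_simps)
  moreover have "(\<lambda>x. 2*pi - x) ` {0..2*pi} = {0..2*pi}"
    by (auto simp: image_iff intro!: bexI[of _ "2*pi - _"])
  moreover have "cis (2*pi - t) = cnj (cis t)" for t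
    by (auto simp: complex_eq_iff cos_diff sin_diff)
  ultimately have "integral {0..2*pi} (\<lambda>t. f (cnj (cis t))) = integral {0..2*pi} (\<lambda>t. f (cis t))"
    by (simp add: integral_unique)
  then show ?thesis
    by (simp add: circ_avg_def)
qed

lemma circ_avg_analytic:
  assumes "f analytic_on cball 0 1"
  shows "circ_avg f = f 0"
proof -
  have "f holomorphic_on cball 0 1"
    using assms analytic_imp_holomorphic by blast
  then have "((\<lambda>u. f u / (u - 0)) has_contour_integral 2 * complex_of_real pi * \<i> * f 0) (circlepath 0 1)"
    by (intro Cauchy_integral_circlepath_simple) auto
  then have "contour_integral (part_circlepath 0 1 0 (2*pi)) (\<lambda>u. f u / u) = 2 * complex_of_real pi * \<i> * f 0"
    by (simp add: contour_integral_unique circlepath_def)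
  then have "integral {0..2*pi} (\<lambda>t. \<i> * f (cis t)) = \<i> * (2 * complex_of_real pi * f 0)"
    by (subst (asm) contour_integral_part_circlepath_eq) (auto simp: mult_ac)
  then show ?thesis
    by (simp add: circ_avg_def)
qed

lemma circ_avg_of_real:
  assumes "continuous_on (sphere 0 1) f"
  shows "circ_avg (\<lambda>z. of_real (f z)) = of_real (integral {0..2*pi} (\<lambda>t. f (cis t)) / (2*pi))"
proof -
  have "(\<lambda>t. f (cis t)) integrable_on {0..2*pi}"
    by (intro integrable_continuous_real continuous_on_cis_compose assms)
  from integral_linear[OF this bounded_linear_of_real]
  have "integral {0..2*pi} (\<lambda>t. complex_of_real (f (cis t))) = of_real (integral {0..2*pi} (\<lambda>t. f (cis t)))"
    by (simp add: o_def)
  then show ?thesis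
    by (simp add: circ_avg_def)
qed

lemma circ_avg_nonneg_eq_0:
  assumes "continuous_on (sphere 0 1) f" "\<And>z. cmod z = 1 \<Longrightarrow> f z \<ge> 0"
    and "circ_avg (\<lambda>z. of_real (f z)) = 0" "cmod z = 1"
  shows "f z = 0"
proof -
  have "integral {0..2*pi} (\<lambda>t. f (cis t)) = 0"
    using assms(3) by (simp add: circ_avg_of_real assms(1))
  then have "\<forall>t\<in>{0..2*pi}. f (cis t) = 0"
    using assms(2) by (subst (asm) integral_eq_0_iff) (auto intro!: continuous_on_cis_compose assms(1))
  moreover obtain t where "z = cis t" "0 \<le> t" "t < 2*pi"
    using assms(4) by (metis Arg2pi_ge_0 Arg2pi_lt_2pi Arg2pi_eq cis_conv_exp mult.left_neutral of_real_1)
  ultimately show ?thesis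
    by auto
qed

lemma circ_avg_nonneg:
  assumes "continuous_on (sphere 0 1) f" "\<And>z. cmod z = 1 \<Longrightarrow> f z \<ge> 0"
  shows "Re (circ_avg (\<lambda>z. of_real (f z))) \<ge> 0"
proof -
  have "integral {0..2*pi} (\<lambda>t. f (cis t)) \<ge> 0"
    using assms(2) by (intro Henstock_Kurzweil_Integration.integral_nonneg integrable_continuous_real 
      continuous_on_cis_compose assms(1)) auto
  then show ?thesis
    by (simp add: circ_avg_of_real assms(1))
qed

section \<open>Splitting rational functions on the circle into analytic and coanalytic parts\<close>

lemma unit_mult_cnj: "cmod z = 1 \<Longrightarrow> z * cnj z = 1"
  by (metis complex_norm_square of_real_1 power_one)

text \<open>The difference quotient has a removable singularity at \<open>a\<close>, filled with the
  derivative. The equation holds at every \<open>z\<close>: off \<open>a\<close> it defines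
  \<open>g\<close>, and at \<open>a\<close> the factor \<open>z - a\<close> vanishes.\<close>

lemma analytic_factor:
  fixes f :: "complex \<Rightarrow> complex"
  assumes "f analytic_on S"
  obtains g where "g analytic_on S" "\<And>z. f z = f a + (z - a) * g z"
proof -
  define g where "g = (\<lambda>z. if z = a then deriv f a else (f z - f a) / (z - a))"
  have "g analytic_on S"
  proof (rule pole_theorem_analytic_0[where g = "\<lambda>z. f z - f a" and a = a])
    show "(\<lambda>z. f z - f a) analytic_on S"
      using assms by (intro analytic_intros)
    show "\<exists>d>0. \<forall>w\<in>ball z d - {a}. f w - f a = (w - a) * g w" for z
      by (rule exI[of _ 1]) (auto simp: g_def)
    have "((\<lambda>z. f z - f a) has_field_derivative D) (at a) \<longleftrightarrow> (f has_field_derivative D) (at a)" for D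
      using DERIV_add[of "\<lambda>z. f z - f a" D a UNIV "\<lambda>_. f a" 0]
        DERIV_diff[of f D a UNIV "\<lambda>_. f a" 0] by auto
    then show "g a = deriv (\<lambda>z. f z - f a) a"
      by (simp add: g_def deriv_def)
  qed simp
  then show ?thesis
    by (rule that) (auto simp: g_def)
qed

lemma analytic_on_poly: "poly p analytic_on S" for p :: "complex poly"
proof (induction p)
  case 0
  show ?case
    by (simp add: analytic_on_const)
next
  case (pCons a p)
  then show ?case
    by (auto intro!: analytic_intros)
qed

text \<open>On the unit circle, \<open>cnj z = 1 / z\<close>, so \<open>k (cnj z)\<close> below is the part of the partial fraction
  decomposition that is analytic outside the disc.\<close>

lemma rational_splitting_prod:
  fixes p :: "complex poly"
  assumes "\<And>a. a \<in># M \<Longrightarrow> cmod a \<noteq> 1"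
  shows "\<exists>f k. f analytic_on cball 0 1 \<and> k analytic_on cball 0 1 \<and> f 0 = 0 \<and>
    (\<forall>z. cmod z = 1 \<longrightarrow> poly p z / (\<Prod>a\<in>#M. z - a) = f z + k (cnj z))"
  using assms
proof (induction M)
  case empty
  \<comment> \<open>The constant term goes to \<open>k\<close>, because \<open>f\<close> has to
    vanish at 0.\<close>
  show ?case
    by (rule exI[of _ "\<lambda>z. poly p z - poly p 0"], rule exI[of _ "\<lambda>_. poly p 0"])
       (auto intro!: analytic_intros analytic_on_poly)
next
  case (add a M)
  have "\<exists>f k. f analytic_on cball 0 1 \<and> k analytic_on cball 0 1 \<and> f 0 = 0 \<and>
    (\<forall>z. cmod z = 1 \<longrightarrow> poly p z / (\<Prod>a\<in>#M. z - a) = f z + k (cnj z))"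
    by (rule add.IH) (rule add.prems, simp)
  then obtain f k where "f analytic_on cball 0 1 \<and> k analytic_on cball 0 1 \<and> f 0 = 0 \<and>
    (\<forall>z. cmod z = 1 \<longrightarrow> poly p z / (\<Prod>a\<in>#M. z - a) = f z + k (cnj z))"
    by (elim exE)
  then have fk: "f analytic_on cball 0 1" "k analytic_on cball 0 1" "f 0 = 0"
    "\<And>z. cmod z = 1 \<Longrightarrow> poly p z / (\<Prod>a\<in>#M. z - a) = f z + k (cnj z)"
    by simp_all
  have quot: "poly p z / (\<Prod>a\<in>#add_mset a M. z - a) = (f z + k (cnj z)) / (z - a)" if "cmod z = 1" for z
    unfolding fk(4)[OF that, symmetric] by simp
  note inv = unit_mult_cnj
  have za: "z - a \<noteq> 0" if "cmod z = 1" for z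
    using add.prems[of a] that by auto
  show ?case
  proof (cases "cmod a < 1")
    \<comment> \<open>A pole inside the disc belongs to the coanalytic part, since
      \<open>1 / (z - a) = cnj z / (1 - a * cnj z)\<close> on the circle. Removing
      \<open>f a / (z - a)\<close> from \<open>f z / (z - a)\<close> leaves the analytic
      \<open>g\<close>; its value at 0 is moved to the other part to keep the normalisation.\<close>
    case True
    obtain g where g: "g analytic_on cball 0 1" "\<And>z. f z = f a + (z - a) * g z"
      using analytic_factor[OF fk(1), of a] by metis
    have nz: "1 - a * w \<noteq> 0" if "cmod w \<le> 1" for w
    proof
      assume "1 - a * w = 0"
      then have "cmod a * cmod w = 1"
        by (metis eq_iff_diff_eq_0 norm_mult norm_one)
      moreover have "cmod a * cmod w \<le> cmod a"
        using that by (simp add: mult_left_le)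
      ultimately show False
        using True by linarith
    qed
    have eq: "1 / (z - a) = cnj z / (1 - a * cnj z)" if "cmod z = 1" for z
      using za[OF that] nz[of "cnj z"] inv[OF that] that by (simp add: field_simps)
    show ?thesis
    proof (rule exI[of _ "\<lambda>z. g z - g 0"], rule exI[of _ "\<lambda>w. g 0 + (f a + k w) * (w / (1 - a * w))"], intro conjI allI impI)
      show "(\<lambda>w. g 0 + (f a + k w) * (w / (1 - a * w))) analytic_on cball 0 1"
        using nz by (intro analytic_intros fk) auto
      fix z :: complex assume z: "cmod z = 1"
      have "(f z + k (cnj z)) / (z - a) = g z + (f a + k (cnj z)) * (1 / (z - a))"
        using za[OF z] by (subst g(2)) (simp add: field_simps)
      then show "poly p z / (\<Prod>a\<in>#add_mset a M. z - a) =
           g z - g 0 + (g 0 + (f a + k (cnj z)) * (cnj z / (1 - a * cnj z)))"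
        using quot[OF z] eq[OF z] by simp
    qed (auto intro!: analytic_intros g)
  next
    case False
    then have a1: "cmod a > 1"
      using add.prems[of a] by force
    have a0: "a \<noteq> 0"
      using a1 by auto
    have nz: "z - a \<noteq> 0" if "cmod z \<le> 1" for z
      using that a1 by auto
    \<comment> \<open>A pole outside is harmless for \<open>f\<close> but has to be divided out of
      \<open>k\<close>. Factoring \<open>w * k w\<close> rather than \<open>k w\<close> at
      \<open>1/a\<close> makes the remainder proportional to \<open>z\<close>, so the new analytic
      part still vanishes at 0.\<close>
    have "(\<lambda>w. w * k w) analytic_on cball 0 1"
      by (intro analytic_intros fk)
    then obtain g where g: "g analytic_on cball 0 1" "\<And>w. w * k w = 1/a * k (1/a) + (w - 1/a) * g w"
      using analytic_factor[of "\<lambda>w. w * k w" _ "1/a"] by metis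
    show ?thesis
    proof (rule exI[of _ "\<lambda>z. (f z + 1/a * k (1/a) * z) / (z - a)"], rule exI[of _ "\<lambda>w. - g w / a"], intro conjI allI impI)
      show "(\<lambda>z. (f z + 1/a * k (1/a) * z) / (z - a)) analytic_on cball 0 1"
        using nz by (intro analytic_intros fk) auto
      fix z :: complex assume z: "cmod z = 1"
      have "k (cnj z) = z * (cnj z * k (cnj z))"
        using inv[OF z] by (simp add: mult.assoc[symmetric])
      also have "\<dots> = z * (1/a * k (1/a)) + (z * cnj z - z / a) * g (cnj z)"
        by (subst g(2)) (simp add: algebra_simps)
      also have "\<dots> = z * (1/a * k (1/a)) - (z - a) * (g (cnj z) / a)"
        using a0 by (simp add: inv[OF z] field_simps)
      finally have k: "k (cnj z) = z * (1/a * k (1/a)) - (z - a) * (g (cnj z) / a)" .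
      have "(F + (x * c - t * d)) / t = (F + c * x) / t - d" if "t \<noteq> 0" for F x c t d :: complex
        using that by (simp add: field_simps)
      from this[OF za[OF z], of "f z" z "1/a * k (1/a)" "g (cnj z) / a"]
      have "(f z + k (cnj z)) / (z - a) = (f z + 1/a * k (1/a) * z) / (z - a) + (- g (cnj z) / a)"
        unfolding k by (simp only: add_uminus_conv_diff minus_divide_left[symmetric])
      then show "poly p z / (\<Prod>a\<in>#add_mset a M. z - a) = 
          (f z + 1/a * k (1/a) * z) / (z - a) + (- g (cnj z) / a)"
        using quot[OF z] by simp
    qed (use a0 in \<open>auto intro!: analytic_intros g simp: fk\<close>)
  qed
qed

lemma rational_splitting:
  fixes p q :: "complex poly"
  assumes "\<And>z. cmod z = 1 \<Longrightarrow> poly q z \<noteq> 0"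
  obtains f k where "f analytic_on cball 0 1" "k analytic_on cball 0 1" "f 0 = 0"
    "\<And>z. cmod z = 1 \<Longrightarrow> poly p z / poly q z = f z + k (cnj z)"
proof -
  have "q \<noteq> 0"
    using assms[of 1] by auto
  then obtain M where M: "q = smult (lead_coeff q) (\<Prod>x\<in>#M. [:- x, 1:])"
    using alg_closed_imp_factorization by blast
  have ev: "poly q z = lead_coeff q * (\<Prod>a\<in>#M. z - a)" for z
    by (subst M) (simp add: poly_prod_mset algebra_simps)
  have "cmod a \<noteq> 1" if "a \<in># M" for a
    using assms[of a] that unfolding ev by (auto simp: prod_mset_zero_iff)
  then have "\<exists>f k. f analytic_on cball 0 1 \<and> k analytic_on cball 0 1 \<and> f 0 = 0 \<and>
    (\<forall>z. cmod z = 1 \<longrightarrow> poly (smult (1 / lead_coeff q) p) z / (\<Prod>a\<in>#M. z - a) = f z + k (cnj z))"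
    by (rule rational_splitting_prod)
  then obtain f k where fk: "f analytic_on cball 0 1" "k analytic_on cball 0 1" "f 0 = 0"
    "\<And>z. cmod z = 1 \<Longrightarrow> poly (smult (1 / lead_coeff q) p) z / (\<Prod>a\<in>#M. z - a) = f z + k (cnj z)"
    by blast
  show ?thesis
  proof (rule that[OF fk(1-3)])
    show "poly p z / poly q z = f z + k (cnj z)" if "cmod z = 1" for z
      unfolding fk(4)[OF that, symmetric] ev by simp
  qed
qed

section \<open>Finite-dimensional linear algebra\<close>

text \<open>Elimination of one unknown. \<open>D\<close> has coefficient 1 at \<open>k\<close> and
  solves the homogeneous equations of \<open>J\<close>; its pairing \<open>t\<close> with
  \<open>k\<close> equals the value of the form at \<open>D\<close>, hence is a positive pivot.
  Adding \<open>\<tau>\<close> times \<open>D\<close> repairs equation \<open>k\<close> and leaves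
  the others alone.\<close>

lemma gram_solve:
  fixes a :: "'i \<Rightarrow> 'i \<Rightarrow> real"
  assumes "finite J"
    and "\<And>c. \<exists>j\<in>J. c j \<noteq> 0 \<Longrightarrow> (\<Sum>i\<in>J. \<Sum>j\<in>J. c i * c j * a i j) > 0"
  shows "\<exists>c. \<forall>j\<in>J. (\<Sum>i\<in>J. c i * a i j) = b j"
  using assms
proof (induction J arbitrary: b)
  case (insert k J)
  have upd: "(\<Sum>i\<in>J. (d(k := x)) i * g i) = (\<Sum>i\<in>J. d i * g i)" for d x and g :: "'i \<Rightarrow> real"
    using insert.hyps by (intro sum.cong) auto
  have pd: "(\<Sum>i\<in>J. \<Sum>j\<in>J. c i * c j * a i j) > 0" if "\<exists>j\<in>J. c j \<noteq> 0" for c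
  proof -
    define c' where "c' = c(k := 0)"
    have c'k: "c' k = 0"
      by (simp add: c'_def)
    have c': "c' i = c i" if "i \<in> J" for i
      using that insert.hyps by (auto simp: c'_def)
    have "\<exists>j\<in>insert k J. c' j \<noteq> 0"
      using that c' by auto
    from insert.prems[OF this] have "(\<Sum>i\<in>J. \<Sum>j\<in>J. c' i * c' j * a i j) > 0"
      using insert.hyps by (simp add: c'k)
    also have "(\<Sum>i\<in>J. \<Sum>j\<in>J. c' i * c' j * a i j) = (\<Sum>i\<in>J. \<Sum>j\<in>J. c i * c j * a i j)"
      by (intro sum.cong refl) (simp add: c')
    finally show ?thesis .
  qed
  obtain d where d: "\<forall>j\<in>J. (\<Sum>i\<in>J. d i * a i j) = - a k j"
    using insert.IH[OF pd, of "\<lambda>j. - a k j"] by auto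
  obtain c where c: "\<forall>j\<in>J. (\<Sum>i\<in>J. c i * a i j) = b j"
    using insert.IH[OF pd, of b] by auto
  define D where "D = d(k := 1)"
  define t where "t = (\<Sum>i\<in>insert k J. D i * a i k)"
  have D0: "(\<Sum>i\<in>insert k J. D i * a i j) = 0" if "j \<in> J" for j
  proof -
    have "(\<Sum>i\<in>J. D i * a i j) = (\<Sum>i\<in>J. d i * a i j)"
      unfolding D_def by (rule upd)
    then show ?thesis
      using d that insert.hyps by (simp add: D_def)
  qed
  have "\<exists>j\<in>insert k J. D j \<noteq> 0"
    by (auto simp: D_def)
  from insert.prems[OF this]
  have "0 < (\<Sum>j\<in>insert k J. \<Sum>i\<in>insert k J. D i * D j * a i j)"
    by (subst sum.swap)
  also have "\<dots> = (\<Sum>j\<in>insert k J. D j * (\<Sum>i\<in>insert k J. D i * a i j))"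
    by (intro sum.cong refl) (simp only: sum_distrib_left mult.left_commute mult.assoc)
  also have "\<dots> = D k * t + (\<Sum>j\<in>J. D j * (\<Sum>i\<in>insert k J. D i * a i j))"
    using insert.hyps by (subst sum.insert) (simp_all add: t_def)
  also have "\<dots> = t"
    by (simp only: D0 mult_zero_right sum.neutral_const cong: sum.cong) (simp add: D_def)
  finally have t: "t > 0" .
  define \<tau> where "\<tau> = (b k - (\<Sum>i\<in>J. c i * a i k)) / t"
  have "(\<Sum>i\<in>insert k J. ((c(k := 0)) i + \<tau> * D i) * a i j) = b j" if "j \<in> insert k J" for j
  proof -
    have "(\<Sum>i\<in>insert k J. ((c(k := 0)) i + \<tau> * D i) * a i j)
        = (\<Sum>i\<in>insert k J. (c(k := 0)) i * a i j) + \<tau> * (\<Sum>i\<in>insert k J. D i * a i j)"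
      by (simp only: distrib_right sum.distrib sum_distrib_left mult.assoc)
    also have "(\<Sum>i\<in>insert k J. (c(k := 0)) i * a i j) = (\<Sum>i\<in>J. c i * a i j)"
      using insert.hyps by (subst sum.insert) (simp_all add: upd del: fun_upd_apply, simp)
    finally have eq: "(\<Sum>i\<in>insert k J. ((c(k := 0)) i + \<tau> * D i) * a i j)
        = (\<Sum>i\<in>J. c i * a i j) + \<tau> * (\<Sum>i\<in>insert k J. D i * a i j)" .
    show ?thesis
    proof (cases "j = k")
      case True
      with eq t show ?thesis
        by (simp only: t_def[symmetric]) (simp add: \<tau>_def)
    next
      case False
      then have "j \<in> J"
        using that by simp
      with eq c show ?thesis
        unfolding D0[OF \<open>j \<in> J\<close>]
        by simp
    qed
  qed
  then show ?case
    by (intro exI[of _ "\<lambda>i. (c(k := 0)) i + \<tau> * D i"] ballI)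
qed simp

text \<open>A dimension count replaces explicit projections. As \<open>k\<close> is not in
  \<open>I\<close>, the map \<open>T\<close> never reaches \<open>axis k 1\<close>; being not
  surjective it is not injective, and a normalised kernel vector is the next member.\<close>

lemma bilinear_orthonormal_family:
  fixes \<beta> :: "real ^ 'n \<Rightarrow> real ^ 'n \<Rightarrow> real"
  assumes "bilinear \<beta>" "\<And>u v. \<beta> u v = \<beta> v u" "\<And>u. u \<noteq> 0 \<Longrightarrow> \<beta> u u > 0"
  shows "\<exists>s :: 'n \<Rightarrow> real ^ 'n. \<forall>i j. \<beta> (s i) (s j) = (if i = j then 1 else 0)"
proof -
  have "\<exists>s. \<forall>i\<in>I. \<forall>j\<in>I. \<beta> (s i) (s j) = (if i = j then 1 else 0)" if "finite I" for I :: "'n set"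
    using that
  proof (induction I)
    case (insert k I)
    then obtain s where s: "\<forall>i\<in>I. \<forall>j\<in>I. \<beta> (s i) (s j) = (if i = j then 1 else 0)"
      by blast
    define T where "T x = (\<chi> i. if i \<in> I then \<beta> x (s i) else 0)" for x
    have linT: "linear T"
      by (rule linearI)
        (auto simp: T_def vec_eq_iff bilinear_ladd[OF assms(1)] bilinear_lmul[OF assms(1)])
    have "\<not> surj T"
    proof
      assume "surj T"
      then obtain x where "axis k 1 = T x"
        by (rule surjE)
      then have "T x $ k = 1"
        by (metis axis_nth)
      then show False
        using insert.hyps by (simp add: T_def)
    qed
    then have "\<not> inj T"
      using linear_injective_imp_surjective[OF linT] by blast
    then obtain x where x: "x \<noteq> 0" "T x = 0"
      using linear_injective_0[OF linT] by blast
    have xs: "\<beta> x (s i) = 0" "\<beta> (s i) x = 0" if "i \<in> I" for i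
      using x(2) that assms(2)[of x "s i"] by (auto simp: T_def vec_eq_iff split: if_splits)
    have xx: "\<beta> x x > 0"
      using x assms(3) by blast
    define s' where "s' = s(k := x /\<^sub>R sqrt (\<beta> x x))"
    have "\<beta> (s' i) (s' j) = (if i = j then 1 else 0)" if "i \<in> insert k I" "j \<in> insert k I" for i j
    proof -
      have "inverse (sqrt (\<beta> x x)) * (inverse (sqrt (\<beta> x x)) * \<beta> x x) = 1"
        using xx by (simp add: mult.assoc[symmetric] inverse_mult_distrib[symmetric] del: inverse_mult_distrib)
      then show ?thesis
        using that s xs insert.hyps
        by (cases "i = k"; cases "j = k")
          (simp_all add: s'_def bilinear_lmul[OF assms(1)] bilinear_rmul[OF assms(1)])
    qed
    then show ?case
      by blast
  qed auto
  from this[of UNIV, OF finite] show ?thesis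
    by (metis UNIV_I)
qed

text \<open>Restricted to a subset \<open>S\<close> because evaluation of rational functions at a
  point respects sums and products only away from poles. Polynomials use \<open>S = UNIV\<close>,
  rational functions \<open>S = ratH\<close>.\<close>

lemma det_map_matrix_on:
  fixes A :: "'a::comm_ring_1 ^ 'n ^ 'n" and h :: "'a \<Rightarrow> 'b::comm_ring_1"
  assumes "1 \<in> S" "\<And>x y. x \<in> S \<Longrightarrow> y \<in> S \<Longrightarrow> x + y \<in> S" "\<And>x y. x \<in> S \<Longrightarrow> y \<in> S \<Longrightarrow> x * y \<in> S"
    "\<And>x. x \<in> S \<Longrightarrow> - x \<in> S"
    and h1: "h 1 = 1" and hadd: "\<And>x y. x \<in> S \<Longrightarrow> y \<in> S \<Longrightarrow> h (x + y) = h x + h y"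
    and hmult: "\<And>x y. x \<in> S \<Longrightarrow> y \<in> S \<Longrightarrow> h (x * y) = h x * h y"
    and A: "\<And>i j. A $ i $ j \<in> S"
  shows "det A \<in> S" "h (det A) = det (map_matrix h A)"
proof -
  have S0: "0 \<in> S"
    using assms(1,2,4) by (metis add.right_inverse)
  have h0: "h 0 = 0"
    using hadd[OF S0 S0] by simp
  have hminus: "h (- x) = - h x" if "x \<in> S" for x
    using hadd[OF that assms(4)[OF that]] h0 by (simp add: eq_neg_iff_add_eq_0 add.commute)
  have prod: "prod f I \<in> S \<and> h (prod f I) = (\<Prod>i\<in>I. h (f i))" if "\<And>i. f i \<in> S" for f and I :: "'n set"
    using assms(1,3) h1 hmult that by (induction I rule: infinite_finite_induct) auto
  have sum: "sum f I \<in> S \<and> h (sum f I) = (\<Sum>i\<in>I. h (f i))" if "\<And>i. i \<in> I \<Longrightarrow> f i \<in> S"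
    for f and I :: "('n \<Rightarrow> 'n) set"
    using that S0 h0 hadd assms(2) by (induction I rule: infinite_finite_induct) auto
  have sgn: "of_int (sign p) * x \<in> S \<and> h (of_int (sign p) * x) = of_int (sign p) * h x" if "x \<in> S"
    for p :: "'n \<Rightarrow> 'n" and x
    using that assms(4) hminus by (auto simp: sign_def)
  show "det A \<in> S" "h (det A) = det (map_matrix h A)"
  proof -
    have trm: "of_int (sign p) * (\<Prod>i\<in>UNIV. A $ i $ p i) \<in> S \<and>
        h (of_int (sign p) * (\<Prod>i\<in>UNIV. A $ i $ p i)) = of_int (sign p) * (\<Prod>i\<in>UNIV. h (A $ i $ p i))" for p
      using sgn[of "\<Prod>i\<in>UNIV. A $ i $ p i" p] prod[of "\<lambda>i. A $ i $ p i" UNIV] A by simp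
    show "det A \<in> S" "h (det A) = det (map_matrix h A)"
      unfolding det_def nth_map_matrix using sum[of "{p. p permutes UNIV}" "\<lambda>p. of_int (sign p) * (\<Prod>i\<in>UNIV. A $ i $ p i)"] trm
      by (metis (no_types, lifting), metis (no_types, lifting) sum.cong)
  qed
qed

section \<open>Real polynomials at complex points\<close>

definition cpoly :: "real poly \<Rightarrow> complex \<Rightarrow> complex" where
  "cpoly p z = poly (map_poly of_real p) z"

lemma cpoly_0 [simp]: "cpoly 0 z = 0"
  and cpoly_1 [simp]: "cpoly 1 z = 1"
  and cpoly_add [simp]: "cpoly (p + q) z = cpoly p z + cpoly q z"
  and cpoly_mult [simp]: "cpoly (p * q) z = cpoly p z * cpoly q z"
  by (simp_all add: cpoly_def of_real_poly_map_add of_real_poly_map_mult)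

lemma cpoly_pCons [simp]: "cpoly (pCons a p) z = of_real a + z * cpoly p z"
  by (simp add: cpoly_def map_poly_pCons)

lemma cpoly_smult [simp]: "cpoly (smult a p) z = of_real a * cpoly p z"
  using cpoly_mult[of "[:a:]" p z] by simp

lemma cpoly_minus [simp]: "cpoly (- p) z = - cpoly p z"
  using cpoly_smult[of "-1" p z] by simp

lemma cpoly_sum [simp]: "cpoly (sum f I) z = (\<Sum>i\<in>I. cpoly (f i) z)"
  by (induction I rule: infinite_finite_induct) auto

lemma cpoly_monom [simp]: "cpoly (monom a n) z = of_real a * z ^ n"
  by (induction n) (auto simp: monom_0 monom_Suc)

lemma cnj_cpoly: "cnj (cpoly p z) = cpoly p (cnj z)"
  by (induction p) auto

lemma cpoly_analytic: "cpoly p analytic_on S"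
  unfolding cpoly_def[abs_def] by (rule analytic_on_poly)

lemma cpoly_eq_sum:
  assumes "degree p \<le> N"
  shows "cpoly p z = (\<Sum>i\<le>N. of_real (coeff p i) * z ^ i)"
  by (subst poly_as_sum_of_monoms'[OF assms, symmetric]) simp

lemma cpoly_circle_eq_0:
  assumes "\<And>z. cmod z = 1 \<Longrightarrow> cpoly p z = 0"
  shows "p = 0"
proof (rule ccontr)
  assume "p \<noteq> 0"
  then have "map_poly of_real p \<noteq> (0 :: complex poly)"
    by (simp add: map_poly_eq_0_iff)
  then have "finite {z. poly (map_poly of_real p) z = (0::complex)}"
    by (rule poly_roots_finite)
  moreover have "sphere 0 1 \<subseteq> {z. poly (map_poly of_real p) z = (0::complex)}"
    using assms by (auto simp: cpoly_def)
  ultimately have "finite (sphere (0::complex) 1)"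
    by (rule finite_subset[rotated])
  moreover have "cis ` {0<..<1} \<subseteq> sphere 0 1"
    by auto
  ultimately have "finite (cis ` {0<..<1})"
    using finite_subset by blast
  moreover have "inj_on cis {0<..<1}"
    using cos_inj_pi pi_gt3 by (intro inj_onI) (auto simp: complex_eq_iff)
  ultimately show False
    using finite_imageD infinite_Ioo[of 0 "1::real"] by (metis zero_less_one)
qed

lemma cnj_unit_power:
  assumes "cmod z = 1" "i \<le> N"
  shows "z ^ N * cnj z ^ i = z ^ (N - i)"
proof -
  have "z ^ N = z ^ (N - i) * z ^ i"
    using assms(2) by (simp add: power_add[symmetric])
  moreover have "z ^ i * cnj z ^ i = 1"
    using unit_mult_cnj[OF assms(1)] by (simp add: power_mult_distrib[symmetric])
  ultimately show ?thesis
    by (simp add: mult.assoc)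
qed

text \<open>For \<open>degree p \<le> N\<close> this is \<open>z^N p(1/z)\<close>. As the
  coefficients are real and \<open>cnj z = 1/z\<close> on the circle, it replaces a conjugated
  polynomial by a polynomial, at the price of \<open>z^N\<close>.\<close>

definition rev_poly :: "nat \<Rightarrow> real poly \<Rightarrow> real poly" where
  "rev_poly N p = (\<Sum>i\<le>N. monom (coeff p i) (N - i))"

lemma cpoly_rev_poly:
  assumes "degree p \<le> N" "cmod z = 1"
  shows "cpoly (rev_poly N p) z = z ^ N * cnj (cpoly p z)"
proof -
  have "z ^ N * cnj (cpoly p z) = (\<Sum>i\<le>N. of_real (coeff p i) * (z ^ N * cnj z ^ i))"
    by (simp add: cpoly_eq_sum[OF assms(1)] sum_distrib_left mult_ac)
  also have "\<dots> = (\<Sum>i\<le>N. of_real (coeff p i) * z ^ (N - i))"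
    by (intro sum.cong) (auto simp: cnj_unit_power assms(2))
  finally show ?thesis
    by (simp add: rev_poly_def)
qed

section \<open>Analytic functions on the closed disc\<close>

lemma analytic_max_modulus_disc:
  assumes "f analytic_on cball 0 1" "\<And>z. cmod z = 1 \<Longrightarrow> cmod (f z) \<le> B" "cmod w \<le> 1"
  shows "cmod (f w) \<le> B"
proof -
  have hol: "f holomorphic_on cball 0 1"
    using assms(1) analytic_imp_holomorphic by blast
  show ?thesis
  proof (rule maximum_modulus_frontier[of f "cball 0 1"])
    show "f holomorphic_on interior (cball 0 1)"
      using hol by (rule holomorphic_on_subset) auto
    show "continuous_on (closure (cball 0 1)) f"
      using hol holomorphic_on_imp_continuous_on by auto
  qed (use assms in \<open>auto\<close>)
qed

lemma analytic_on_continuous_circle: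
  "f analytic_on cball 0 1 \<Longrightarrow> continuous_on (sphere 0 1) (f :: complex \<Rightarrow> complex)"
  by (meson analytic_imp_holomorphic analytic_on_subset holomorphic_on_imp_continuous_on sphere_cball)

lemma continuous_on_circle_cnj:
  assumes "continuous_on (sphere 0 1) f"
  shows "continuous_on (sphere 0 1) (\<lambda>z. f (cnj z))"
  by (rule continuous_on_compose2[OF assms]) (auto intro!: continuous_intros)

text \<open>The product of \<open>f - f 0\<close> and \<open>g - cnj (f 0)\<close> is analytic and
  vanishes at 0, so its mean is 0. On the circle it equals the squared modulus of
  \<open>f - f 0\<close>; thus \<open>f\<close> is constant there and, by the maximum principle, in
  the disc.\<close>

lemma analytic_const_if_cnj_analytic:
  assumes "f analytic_on cball 0 1" "g analytic_on cball 0 1"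
    and "\<And>z. cmod z = 1 \<Longrightarrow> g z = cnj (f z)" and "cmod w \<le> 1"
  shows "f w = f 0"
proof -
  have an: "(\<lambda>z. f z - f 0) analytic_on cball 0 1"
    by (intro analytic_intros assms(1))
  have "(\<lambda>z. (f z - f 0) * (g z - cnj (f 0))) analytic_on cball 0 1"
    by (intro analytic_intros assms(1,2))
  then have "circ_avg (\<lambda>z. (f z - f 0) * (g z - cnj (f 0))) = 0"
    by (simp add: circ_avg_analytic)
  moreover have "circ_avg (\<lambda>z. (f z - f 0) * (g z - cnj (f 0))) = circ_avg (\<lambda>z. of_real ((cmod (f z - f 0))\<^sup>2))"
    by (intro circ_avg_cong) (simp only: assms(3) complex_norm_square complex_cnj_diff)
  ultimately have avg0: "circ_avg (\<lambda>z. of_real ((cmod (f z - f 0))\<^sup>2)) = 0"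
    by simp
  have cont: "continuous_on (sphere 0 1) (\<lambda>z. (cmod (f z - f 0))\<^sup>2)"
    by (intro continuous_intros analytic_on_continuous_circle assms(1))
  have "(cmod (f z - f 0))\<^sup>2 = 0" if "cmod z = 1" for z
    by (rule circ_avg_nonneg_eq_0[OF cont _ avg0 that]) simp
  then have "cmod (f w - f 0) \<le> 0"
    by (intro analytic_max_modulus_disc[OF an _ assms(4)]) simp
  then show ?thesis
    by simp
qed

text \<open>The mean of \<open>cnj z ^ j * f z\<close> is the Taylor coefficient of index
  \<open>j\<close>. Coefficient 0 is covered by \<open>f 0 = 0\<close> and the moments supply 1 to
  \<open>N\<close>, hence the order \<open>Suc N\<close>.\<close>

lemma analytic_vanishing_moments:
  assumes "f analytic_on cball 0 1" "f 0 = 0"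
    and "\<And>j. 1 \<le> j \<Longrightarrow> j \<le> N \<Longrightarrow> circ_avg (\<lambda>z. cnj z ^ j * f z) = 0"
  shows "\<exists>h. h analytic_on cball 0 1 \<and> (\<forall>z. f z = z ^ Suc N * h z)"
  using assms(3)
proof (induction N)
  case 0
  obtain g where g: "g analytic_on cball 0 1" "\<And>z. f z = f 0 + (z - 0) * g z"
    using analytic_factor[OF assms(1), of 0] by blast
  have "f z = z ^ Suc 0 * g z" for z
    using g(2)[of z] assms(2) by simp
  then show ?case
    using g(1) by blast
next
  case (Suc N)
  have "\<exists>h. h analytic_on cball 0 1 \<and> (\<forall>z. f z = z ^ Suc N * h z)"
    by (rule Suc.IH) (rule Suc.prems, simp_all)
  then obtain h where h: "h analytic_on cball 0 1" and fh: "\<forall>z. f z = z ^ Suc N * h z"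
    by (elim exE conjE)
  have "circ_avg (\<lambda>z. cnj z ^ Suc N * f z) = circ_avg h"
  proof (rule circ_avg_cong)
    fix z :: complex assume "cmod z = 1"
    then have "cnj z ^ Suc N * z ^ Suc N = 1"
      using unit_mult_cnj[of z] by (simp only: power_mult_distrib[symmetric] mult.commute[of "cnj z"]) simp
    then show "cnj z ^ Suc N * f z = h z"
      by (simp only: fh[rule_format] mult.assoc[symmetric]) simp
  qed
  then have "h 0 = 0"
    using Suc.prems[of "Suc N"] circ_avg_analytic[OF h] by simp
  obtain g where g: "g analytic_on cball 0 1" "\<And>z. h z = h 0 + (z - 0) * g z"
    using analytic_factor[OF h, of 0] by blast
  have "f z = z ^ Suc (Suc N) * g z" for z
    using fh[rule_format, of z] g(2)[of z] \<open>h 0 = 0\<close> by simp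
  then show ?case
    using g(1) by blast
qed

section \<open>Vectors of polynomials and the Hermitian form\<close>

definition cvec :: "real poly ^ 'n \<Rightarrow> complex \<Rightarrow> complex ^ 'n" where
  "cvec f z = (\<chi> l. cpoly (f $ l) z)"

definition herm :: "complex ^ 'n \<Rightarrow> complex ^ 'n \<Rightarrow> complex" where
  "herm a b = (\<Sum>l\<in>UNIV. cnj (a $ l) * b $ l)"

text \<open>Only real scalars are allowed, so that orthogonalisation stays within
  \<open>real poly\<close> and the spectral factor has real coefficients.\<close>

definition lincomb :: "'i set \<Rightarrow> ('i \<Rightarrow> real) \<Rightarrow> ('i \<Rightarrow> real poly ^ 'n) \<Rightarrow> real poly ^ 'n" where
  "lincomb J c f = (\<chi> l. \<Sum>j\<in>J. smult (c j) (f j $ l))"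

lemma cvec_lincomb: "cvec (lincomb J c f) z = (\<Sum>j\<in>J. of_real (c j) *s cvec (f j) z)"
  by (simp add: cvec_def lincomb_def vec_eq_iff)

lemma cvec_cnj: "cvec f (cnj z) $ l = cnj (cvec f z $ l)"
  by (simp add: cvec_def cnj_cpoly)

lemma herm_commute: "cnj (herm a b) = herm b a"
  by (simp add: herm_def mult.commute)

lemma herm_add_right: "herm a (b + c) = herm a b + herm a c"
  by (simp add: herm_def sum.distrib distrib_left)

lemma herm_scale_right: "herm a (c *s b) = c * herm a b"
  by (simp add: herm_def sum_distrib_left mult_ac)

lemma herm_zero_right [simp]: "herm a 0 = 0"
  by (simp add: herm_def)

lemma herm_sum_right: "herm a (\<Sum>i\<in>I. f i) = (\<Sum>i\<in>I. herm a (f i))"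
  by (induction I rule: infinite_finite_induct) (auto simp: herm_add_right)

lemma invertible_if_ker_trivial:
  fixes A :: "'a::field ^ 'n ^ 'n"
  assumes "\<And>x. A *v x = 0 \<Longrightarrow> x = 0"
  shows "invertible A"
  using assms by (simp add: invertible_left_inverse matrix_left_invertible_ker)

lemma invertible_ker:
  fixes A :: "'a::field ^ 'n ^ 'n"
  shows "invertible A \<Longrightarrow> A *v x = 0 \<Longrightarrow> x = 0"
  by (auto simp: invertible_left_inverse matrix_left_invertible_ker)

lemma matrix_inv_right_mult: "invertible A \<Longrightarrow> A ** matrix_inv A = mat 1"
  and matrix_inv_left_mult: "invertible A \<Longrightarrow> matrix_inv A ** A = mat 1"
  for A :: "'a::semiring_1 ^ 'n ^ 'n"
  unfolding invertible_def matrix_inv_def by (metis (mono_tags, lifting) someI_ex)+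

lemma matrix_vector_mult_sum: "A *v (\<Sum>i\<in>I. f i) = (\<Sum>i\<in>I. A *v f i)"
  for A :: "'a::comm_ring_1 ^ 'n ^ 'm"
  by (induction I rule: infinite_finite_induct) (auto simp: matrix_vector_right_distrib)

section \<open>The weight, its inverse and the induced inner product\<close>

text \<open>The weight is presented by polynomial rows: its quadratic form is the sum of the squared
  moduli of the pairings with the \<open>v r\<close>. Nondegeneracy is its positive definiteness on
  the circle, and \<open>N\<close> bounds its degree in \<open>z\<close> and in
  \<open>cnj z\<close>.\<close>

locale spectral_density =
  fixes R :: "'r set" and v :: "'r \<Rightarrow> real poly ^ 'n" and N :: nat
  assumes finite_R: "finite R"
    and rows_nondegenerate: "\<And>z a. cmod z = 1 \<Longrightarrow> a \<noteq> 0 \<Longrightarrow> \<exists>r\<in>R. herm (cvec (v r) z) a \<noteq> 0"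
    and degree_rows: "\<And>r l. r \<in> R \<Longrightarrow> degree (v r $ l) \<le> N"
begin

definition L :: "complex \<Rightarrow> complex ^ 'n ^ 'n" where
  "L z = (\<chi> a b. \<Sum>r\<in>R. cpoly (v r $ a) z * cnj (cpoly (v r $ b) z))"

text \<open>Meant for the unit circle, where \<open>L z\<close> is positive definite and
  \<open>matrix_inv\<close> a genuine inverse.\<close>

definition G :: "complex \<Rightarrow> complex ^ 'n ^ 'n" where
  "G z = matrix_inv (L z)"

definition energy :: "complex \<Rightarrow> complex ^ 'n \<Rightarrow> real" where
  "energy z a = (\<Sum>r\<in>R. (cmod (herm (cvec (v r) z) a))\<^sup>2)"

lemma L_mult: "L z *v b = (\<Sum>r\<in>R. herm (cvec (v r) z) b *s cvec (v r) z)"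
proof -
  have "(L z *v b) $ l = (\<Sum>r\<in>R. herm (cvec (v r) z) b *s cvec (v r) z) $ l" for l
  proof -
    have "(L z *v b) $ l = (\<Sum>m\<in>UNIV. \<Sum>r\<in>R. cpoly (v r $ l) z * cnj (cpoly (v r $ m) z) * b $ m)"
      by (simp add: matrix_vector_mult_def L_def sum_distrib_right)
    also have "\<dots> = (\<Sum>r\<in>R. \<Sum>m\<in>UNIV. cpoly (v r $ l) z * cnj (cpoly (v r $ m) z) * b $ m)"
      by (rule sum.swap)
    also have "\<dots> = (\<Sum>r\<in>R. herm (cvec (v r) z) b *s cvec (v r) z) $ l"
      by (simp add: herm_def cvec_def sum_distrib_left mult_ac)
    finally show ?thesis .
  qed
  then show ?thesis
    by (simp add: vec_eq_iff)
qed

lemma herm_L: "herm a (L z *v b) = (\<Sum>r\<in>R. herm (cvec (v r) z) b * cnj (herm (cvec (v r) z) a))"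
  by (simp add: L_mult herm_sum_right herm_scale_right herm_commute)

lemma herm_L_self: "herm a (L z *v a) = of_real (energy z a)"
  by (simp add: herm_L energy_def complex_norm_square del: of_real_power)

lemma herm_L_swap: "herm a (L z *v b) = herm (L z *v a) b"
proof -
  have "herm (L z *v a) b = cnj (herm b (L z *v a))"
    by (simp only: herm_commute)
  then show ?thesis
    by (simp add: herm_L mult.commute)
qed

lemma energy_nonneg: "energy z a \<ge> 0"
  by (simp add: energy_def sum_nonneg)

lemma energy_eq_0: "cmod z = 1 \<Longrightarrow> energy z a = 0 \<Longrightarrow> a = 0"
  using rows_nondegenerate[of z a] finite_R by (auto simp: energy_def sum_nonneg_eq_0_iff)

lemma invertible_L: "cmod z = 1 \<Longrightarrow> invertible (L z)"
proof (rule invertible_if_ker_trivial)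
  fix x assume "cmod z = 1" "L z *v x = 0"
  then show "x = 0"
    using herm_L_self[of x z] energy_eq_0[of z x] by simp
qed

lemma L_G: "cmod z = 1 \<Longrightarrow> L z ** G z = mat 1"
  unfolding G_def by (intro matrix_inv_right_mult invertible_L)

lemma L_G_mult: "cmod z = 1 \<Longrightarrow> L z *v (G z *v b) = b"
  by (simp add: L_G matrix_vector_mul_assoc)

lemma G_eqI: "cmod z = 1 \<Longrightarrow> L z *v y = b \<Longrightarrow> G z *v b = y"
  using matrix_inv_left_mult[OF invertible_L] by (auto simp: G_def matrix_vector_mul_assoc)

lemma herm_G_swap: "cmod z = 1 \<Longrightarrow> herm a (G z *v b) = herm (G z *v a) b"
  by (metis L_G_mult herm_L_swap)

lemma herm_G_self: "cmod z = 1 \<Longrightarrow> herm a (G z *v a) = of_real (energy z (G z *v a))"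
  by (metis L_G_mult herm_L_self herm_L_swap)

lemma G_cnj:
  assumes "cmod z = 1"
  shows "(G (cnj z) *v cvec f (cnj z)) $ l = cnj ((G z *v cvec f z) $ l)"
proof -
  let ?y = "\<chi> l. cnj ((G z *v cvec f z) $ l)"
  have "(L (cnj z) *v ?y) $ l = cnj ((L z *v (G z *v cvec f z)) $ l)" for l
    by (simp add: matrix_vector_mult_def L_def cnj_cpoly[symmetric])
  then have "L (cnj z) *v ?y = cvec f (cnj z)"
    using assms by (simp add: L_G_mult vec_eq_iff cvec_cnj)
  then have "G (cnj z) *v cvec f (cnj z) = ?y"
    using assms by (intro G_eqI) auto
  then show ?thesis
    by simp
qed

text \<open>On the circle \<open>z ^ N\<close> times \<open>L z\<close> agrees with the polynomial
  matrix \<open>P\<close>, by reversal of the conjugated factors. Cramer's rule for \<open>P\<close>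
  then gives real polynomials, and \<open>det P\<close> has no zero on the circle.\<close>

lemma G_rational:
  "\<exists>p q. \<forall>z. cmod z = 1 \<longrightarrow> cpoly q z \<noteq> 0 \<and> (\<forall>l. (G z *v cvec f z) $ l = cpoly (p l) z / cpoly q z)"
proof -
  define P :: "real poly ^ 'n ^ 'n" where "P = (\<chi> a b. \<Sum>r\<in>R. v r $ a * rev_poly N (v r $ b))"
  define p where "p l = det (\<chi> i j. if j = l then monom 1 N * f $ i else P $ i $ j)" for l
  have det: "cpoly (det A) z = det (map_matrix (\<lambda>p. cpoly p z) A)" for A :: "real poly ^ 'n ^ 'n" and z
    by (rule det_map_matrix_on(2)[where S = UNIV]) auto
  have P: "map_matrix (\<lambda>p. cpoly p z) P $ a $ b = z ^ N * L z $ a $ b" if "cmod z = 1" for z a b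
    using that by (simp add: P_def L_def cpoly_rev_poly degree_rows sum_distrib_left mult_ac cong: sum.cong)
  have mul: "map_matrix (\<lambda>p. cpoly p z) P *v y = z ^ N *s (L z *v y)" if "cmod z = 1" for z y
    using P[OF that] by (simp add: vec_eq_iff matrix_vector_mult_def sum_distrib_left mult_ac)
  have inv: "invertible (map_matrix (\<lambda>p. cpoly p z) P)" if z: "cmod z = 1" for z
  proof (rule invertible_if_ker_trivial)
    fix x assume "map_matrix (\<lambda>p. cpoly p z) P *v x = 0"
    then have "z ^ N *s (L z *v x) = 0"
      by (simp only: mul[OF z])
    moreover have "z \<noteq> 0"
      using z by auto
    ultimately have "L z *v x = 0"
      by (simp add: vec_eq_iff)
    then show "x = 0"
      using invertible_ker[OF invertible_L[OF z]] by blast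
  qed
  show ?thesis
  proof (rule exI[of _ p], rule exI[of _ "det P"], intro allI impI conjI)
    fix z :: complex assume z: "cmod z = 1"
    then show q: "cpoly (det P) z \<noteq> 0"
      using inv by (simp add: det invertible_det_nz)
    fix l
    have "map_matrix (\<lambda>p. cpoly p z) P *v (G z *v cvec f z) = z ^ N *s cvec f z"
      by (simp add: mul z L_G_mult)
    then have "G z *v cvec f z = (\<chi> k. det (\<chi> i j. if j = k then (z ^ N *s cvec f z) $ i
        else map_matrix (\<lambda>p. cpoly p z) P $ i $ j) / det (map_matrix (\<lambda>p. cpoly p z) P))"
      using q by (subst (asm) cramer) (simp_all add: det)
    also have "\<dots> $ l = cpoly (p l) z / cpoly (det P) z"
      unfolding p_def det
      by (simp add: map_matrix_def cvec_def if_distrib[of "\<lambda>p. cpoly p z"] cong: if_cong)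
    finally show "(G z *v cvec f z) $ l = cpoly (p l) z / cpoly (det P) z" .
  qed
qed

lemma continuous_on_cpoly: "continuous_on S (cpoly p)"
  using cpoly_analytic by (meson analytic_imp_holomorphic holomorphic_on_imp_continuous_on)

lemma continuous_on_G: "continuous_on (sphere 0 1) (\<lambda>z. (G z *v cvec f z) $ l)"
proof -
  obtain p q where pq: "\<forall>z. cmod z = 1 \<longrightarrow> cpoly q z \<noteq> 0 \<and> (\<forall>l. (G z *v cvec f z) $ l = cpoly (p l) z / cpoly q z)"
    using G_rational[of f] by (elim exE)
  have "continuous_on (sphere 0 1) (\<lambda>z. cpoly (p l) z / cpoly q z)"
    using pq by (intro continuous_intros continuous_on_cpoly) auto
  then show ?thesis
    by (rule continuous_on_eq) (simp add: pq)
qed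

lemma continuous_on_herm_G: "continuous_on (sphere 0 1) (\<lambda>z. herm (cvec g z) (G z *v cvec f z))"
  unfolding herm_def cvec_def[of g]
  by (auto intro!: continuous_intros continuous_on_G continuous_on_cpoly)

lemma continuous_on_energy:
  fixes y :: "complex \<Rightarrow> complex ^ 'n"
  assumes "\<And>l. continuous_on S (\<lambda>z. y z $ l)"
  shows "continuous_on S (\<lambda>z. energy z (y z))"
  unfolding energy_def herm_def cvec_def
  by (auto intro!: continuous_intros continuous_on_cpoly assms)

definition ip :: "real poly ^ 'n \<Rightarrow> real poly ^ 'n \<Rightarrow> complex" where
  "ip f g = circ_avg (\<lambda>z. herm (cvec g z) (G z *v cvec f z))"

definition ipr :: "real poly ^ 'n \<Rightarrow> real poly ^ 'n \<Rightarrow> real" where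
  "ipr f g = Re (ip f g)"

text \<open>Real coefficients make conjugation of the integrand the same as reflection of
  \<open>z\<close> to \<open>cnj z\<close>, which does not change the mean. Hence the form is real
  and the Gram systems below can be solved over the reals.\<close>

lemma cnj_ip: "cnj (ip f g) = ip f g"
proof -
  have "cnj (ip f g) = circ_avg (\<lambda>z. cnj (herm (cvec g z) (G z *v cvec f z)))"
    by (simp add: ip_def circ_avg_cnj)
  also have "\<dots> = circ_avg (\<lambda>z. herm (cvec g (cnj z)) (G (cnj z) *v cvec f (cnj z)))"
    by (rule circ_avg_cong) (simp add: herm_def G_cnj cvec_cnj)
  also have "\<dots> = ip f g"
    unfolding ip_def by (rule circ_avg_reflect[OF continuous_on_herm_G])
  finally show ?thesis .
qed

lemma ip_eq_ipr: "ip f g = of_real (ipr f g)"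
  using cnj_ip[of f g] by (simp add: ipr_def complex_eq_iff)

lemma ipr_commute: "ipr f g = ipr g f"
proof -
  have "ip g f = circ_avg (\<lambda>z. cnj (herm (cvec g z) (G z *v cvec f z)))"
    unfolding ip_def by (rule circ_avg_cong) (simp add: herm_commute herm_G_swap)
  also have "\<dots> = cnj (ip f g)"
    by (simp add: ip_def circ_avg_cnj)
  finally show ?thesis
    by (simp add: ipr_def)
qed

lemma ipr_lincomb_left: "ipr (lincomb J c f) g = (\<Sum>j\<in>J. c j * ipr (f j) g)" if "finite J"
proof -
  have "ip (lincomb J c f) g = circ_avg (\<lambda>z. \<Sum>j\<in>J. of_real (c j) * herm (cvec g z) (G z *v cvec (f j) z))"
    by (simp add: ip_def cvec_lincomb matrix_vector_mult_sum herm_sum_right vector_scalar_commute herm_scale_right)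
  also have "\<dots> = (\<Sum>j\<in>J. circ_avg (\<lambda>z. of_real (c j) * herm (cvec g z) (G z *v cvec (f j) z)))"
    by (rule circ_avg_sum[OF that]) (intro continuous_intros continuous_on_herm_G)
  also have "\<dots> = (\<Sum>j\<in>J. of_real (c j) * ip (f j) g)"
    by (simp add: circ_avg_mult_left ip_def)
  finally have "complex_of_real (ipr (lincomb J c f) g) = of_real (\<Sum>j\<in>J. c j * ipr (f j) g)"
    by (simp add: ip_eq_ipr)
  then show ?thesis
    by (simp only: of_real_eq_iff)
qed

lemma ipr_lincomb: "ipr (lincomb I c f) (lincomb J d g) = (\<Sum>i\<in>I. \<Sum>j\<in>J. c i * d j * ipr (f i) (g j))"
  if "finite I" "finite J"
proof -
  have "ipr (f i) (lincomb J d g) = (\<Sum>j\<in>J. d j * ipr (f i) (g j))" for i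
    by (subst ipr_commute) (simp add: ipr_lincomb_left that ipr_commute[of "g _"])
  then show ?thesis
    by (simp add: ipr_lincomb_left that sum_distrib_left mult_ac)
qed

lemma ipr_diff_left: "ipr (f - g) h = ipr f h - ipr g h"
proof -
  have "f - g = lincomb {True, False} (\<lambda>b. if b then 1 else - 1) (\<lambda>b. if b then f else g)"
    by (simp add: lincomb_def vec_eq_iff)
  then show ?thesis
    by (simp add: ipr_lincomb_left)
qed

lemma ipr_pos: "f \<noteq> 0 \<Longrightarrow> ipr f f > 0"
proof -
  assume f: "f \<noteq> 0"
  let ?E = "\<lambda>z. energy z (G z *v cvec f z)"
  have cont: "continuous_on (sphere 0 1) ?E"
    by (intro continuous_on_energy continuous_on_G)
  have ip: "ip f f = circ_avg (\<lambda>z. of_real (?E z))"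
    unfolding ip_def by (rule circ_avg_cong) (rule herm_G_self)
  have "ipr f f \<ge> 0"
    unfolding ipr_def ip by (rule circ_avg_nonneg[OF cont]) (rule energy_nonneg)
  moreover have "ipr f f \<noteq> 0"
  proof
    assume "ipr f f = 0"
    then have avg: "circ_avg (\<lambda>z. of_real (?E z)) = 0"
      using ip ip_eq_ipr[of f f] by simp
    have "cvec f z = 0" if z: "cmod z = 1" for z
    proof -
      have "?E z = 0"
        by (rule circ_avg_nonneg_eq_0[OF cont _ avg z]) (rule energy_nonneg)
      then have "G z *v cvec f z = 0"
        by (rule energy_eq_0[OF z])
      then show ?thesis
        using L_G_mult[OF z, of "cvec f z"] by simp
    qed
    then have "f $ l = 0" for l
      by (intro cpoly_circle_eq_0) (simp add: cvec_def vec_eq_iff)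
    then show False
      using f by (simp add: vec_eq_iff)
  qed
  ultimately show ?thesis
    by simp
qed

end

section \<open>Orthonormal polynomials and the spectral factor\<close>

lemma analytic_on_disc_cnj_cnj:
  assumes "f analytic_on cball 0 1"
  shows "(\<lambda>z. cnj (f (cnj z))) analytic_on cball 0 1"
  unfolding analytic_on_def
proof
  fix z :: complex assume "z \<in> cball 0 1"
  then have "cnj z \<in> cball 0 1"
    by simp
  then obtain e where e: "e > 0" "f holomorphic_on ball (cnj z) e"
    using assms unfolding analytic_on_def by blast
  have "cnj w \<in> ball (cnj z) e" if "w \<in> ball z e" for w
    using that by (simp add: dist_norm flip: complex_cnj_diff)
  then have "f holomorphic_on cnj ` ball z e"
    using e(2) by (blast intro: holomorphic_on_subset)
  then have "cnj \<circ> f \<circ> cnj holomorphic_on ball z e"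
    by (rule holomorphic_on_compose_cnj_cnj) simp
  then show "\<exists>e>0. (\<lambda>z. cnj (f (cnj z))) holomorphic_on ball z e"
    using e(1) by (auto simp: o_def)
qed

context spectral_density
begin

definition shift :: "nat \<times> 'n \<Rightarrow> real poly ^ 'n" where
  "shift p = (\<chi> i. if i = snd p then monom 1 (fst p) else 0)"

lemma cvec_shift: "cvec (shift (j, l)) z $ i = (if i = l then z ^ j else 0)"
  by (simp add: cvec_def shift_def)

lemma coeff_lincomb_shift:
  assumes "finite J"
  shows "coeff (lincomb J c shift $ l) j = (if (j, l) \<in> J then c (j, l) else 0)"
proof -
  have "coeff (lincomb J c shift $ l) j = (\<Sum>p\<in>J. if p = (j, l) then c p else 0)"
    by (auto simp: lincomb_def shift_def coeff_sum intro!: sum.cong)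
  then show ?thesis
    using assms by simp
qed

lemma rational_splitting_G:
  "\<exists>F K. \<forall>l. F l analytic_on cball 0 1 \<and> K l analytic_on cball 0 1 \<and> F l 0 = 0 \<and>
    (\<forall>z. cmod z = 1 \<longrightarrow> (G z *v cvec f z) $ l = F l z + K l (cnj z))"
proof -
  obtain p q where pq: "\<forall>z. cmod z = 1 \<longrightarrow> cpoly q z \<noteq> 0 \<and> (\<forall>l. (G z *v cvec f z) $ l = cpoly (p l) z / cpoly q z)"
    using G_rational[of f] by (elim exE)
  have "\<exists>F K. F analytic_on cball 0 1 \<and> K analytic_on cball 0 1 \<and> F 0 = 0 \<and>
      (\<forall>z. cmod z = 1 \<longrightarrow> cpoly (p l) z / cpoly q z = F z + K (cnj z))" for l
  proof -
    have "poly (map_poly of_real q) z \<noteq> (0::complex)" if "cmod z = 1" for z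
      using pq that by (simp add: cpoly_def)
    then show ?thesis
    proof (rule rational_splitting[of "map_poly of_real q" "map_poly of_real (p l)"])
      fix F K assume "F analytic_on cball 0 1" "K analytic_on cball 0 1" "F 0 = 0"
        "\<And>z. cmod z = 1 \<Longrightarrow> poly (map_poly of_real (p l)) z / poly (map_poly of_real q) z = F z + K (cnj z)"
      then show ?thesis
        by (intro exI[of _ F] exI[of _ K]) (simp add: cpoly_def)
    qed
  qed
  then obtain F K where "\<forall>l. F l analytic_on cball 0 1 \<and> K l analytic_on cball 0 1 \<and> F l 0 = 0 \<and>
      (\<forall>z. cmod z = 1 \<longrightarrow> cpoly (p l) z / cpoly q z = F l z + K l (cnj z))"
    by metis
  with pq show ?thesis
    by (intro exI[of _ F] exI[of _ K]) simp
qed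

text \<open>Orthogonality to the shifts makes the analytic part \<open>F\<close> of \<open>G f\<close> vanish to order \<open>N\<close> at 0.
  As \<open>f = L F + L K\<close> with \<open>f\<close> and \<open>L\<close> of degree at most \<open>N\<close>, the energy of \<open>F\<close> then has mean 0.\<close>

lemma G_coanalytic:
  assumes deg: "\<And>l. degree (f $ l) \<le> N"
    and orth: "\<And>j l. 1 \<le> j \<Longrightarrow> j \<le> N \<Longrightarrow> ipr f (shift (j, l)) = 0"
  shows "\<exists>K. \<forall>l. K l analytic_on cball 0 1 \<and> (\<forall>z. cmod z = 1 \<longrightarrow> (G z *v cvec f z) $ l = K l (cnj z))"
proof -
  obtain F K where "\<forall>l. F l analytic_on cball 0 1 \<and> K l analytic_on cball 0 1 \<and> F l 0 = 0 \<and>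
    (\<forall>z. cmod z = 1 \<longrightarrow> (G z *v cvec f z) $ l = F l z + K l (cnj z))"
    using rational_splitting_G[of f] by (elim exE)
  then have F: "\<And>l. F l analytic_on cball 0 1" and K: "\<And>l. K l analytic_on cball 0 1"
    and F0: "\<And>l. F l 0 = 0"
    and FK: "\<And>z l. cmod z = 1 \<Longrightarrow> (G z *v cvec f z) $ l = F l z + K l (cnj z)"
    by simp_all
  have contF: "continuous_on (sphere 0 1) (F l)" and contK: "continuous_on (sphere 0 1) (\<lambda>z. K l (cnj z))" for l
    by (intro analytic_on_continuous_circle F) (intro continuous_on_circle_cnj analytic_on_continuous_circle K)
  have moment: "circ_avg (\<lambda>z. cnj z ^ j * F l z) = 0" if j: "1 \<le> j" "j \<le> N" for j l
  proof -
    \<comment> \<open>As \<open>j\<close> is at least 1, the coanalytic part contributes the value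
      of \<open>z ^ j * K l z\<close> at 0, which is 0. Orthogonality is thus a statement about
      \<open>F\<close> alone.\<close>
    have an: "(\<lambda>z. z ^ j * K l z) analytic_on cball 0 1"
      by (intro analytic_intros K)
    have "0 = ip f (shift (j, l))"
      using orth[OF j] by (simp add: ip_eq_ipr)
    also have "\<dots> = circ_avg (\<lambda>z. cnj z ^ j * F l z + cnj z ^ j * K l (cnj z))"
      unfolding ip_def
      by (rule circ_avg_cong) (simp add: herm_def cvec_shift FK distrib_left sum.distrib if_distrib[of cnj] if_distrib[of "\<lambda>x. x * _"] cong: if_cong)
    also have "\<dots> = circ_avg (\<lambda>z. cnj z ^ j * F l z) + circ_avg (\<lambda>z. cnj z ^ j * K l (cnj z))"
      by (intro circ_avg_add continuous_intros contF contK)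
    also have "circ_avg (\<lambda>z. cnj z ^ j * K l (cnj z)) = circ_avg (\<lambda>z. z ^ j * K l z)"
      by (rule circ_avg_reflect) (intro analytic_on_continuous_circle an)
    also have "\<dots> = 0"
      using j by (simp add: circ_avg_analytic[OF an])
    finally show ?thesis
      by simp
  qed
  have "\<exists>h. h analytic_on cball 0 1 \<and> (\<forall>z. F l z = z ^ Suc N * h z)" for l
    by (rule analytic_vanishing_moments[OF F F0 moment])
  then obtain h where h: "\<forall>l. h l analytic_on cball 0 1 \<and> (\<forall>z. F l z = z ^ Suc N * h l z)"
    by metis
  define y where "y z = (\<chi> l. F l z)" for z
  define k where "k z = (\<chi> l. K l (cnj z))" for z
  define K' where "K' l z = cnj (K l (cnj z))" for l z
  have K': "K' l analytic_on cball 0 1" for l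
    unfolding K'_def by (rule analytic_on_disc_cnj_cnj[OF K])
  \<comment> \<open>\<open>\<Psi>\<close> continues the conjugate of the energy analytically. The
    factor \<open>z ^ Suc N\<close> of \<open>F\<close> absorbs the conjugates of \<open>f\<close>
    and of the rows, all of degree at most \<open>N\<close>, and leaves one spare \<open>z\<close>;
    so \<open>\<Psi> 0 = 0\<close> and the mean energy is 0.\<close>
  define \<Psi> where "\<Psi> z = z * ((\<Sum>l\<in>UNIV. h l z * cpoly (rev_poly N (f $ l)) z) -
      (\<Sum>r\<in>R. (\<Sum>l\<in>UNIV. h l z * cpoly (rev_poly N (v r $ l)) z) * (\<Sum>l\<in>UNIV. cpoly (v r $ l) z * K' l z)))" for z
  have \<Psi>: "\<Psi> analytic_on cball 0 1"
    unfolding \<Psi>_def[abs_def] using h by (auto intro!: analytic_intros cpoly_analytic K')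
  have hy: "cnj (herm (y z) (cvec g z)) = z * (\<Sum>l\<in>UNIV. h l z * cpoly (rev_poly N (g $ l)) z)"
    if z: "cmod z = 1" and g: "\<And>l. degree (g $ l) \<le> N" for z g
    by (simp add: herm_def y_def h cvec_def cpoly_rev_poly[OF g z] sum_distrib_left mult_ac)
  have en: "of_real (energy z (y z)) = cnj (\<Psi> z)" if z: "cmod z = 1" for z
  proof -
    have "cvec f z = L z *v (G z *v cvec f z)"
      by (simp add: L_G_mult z)
    also have "G z *v cvec f z = y z + k z"
      by (simp add: vec_eq_iff FK z y_def k_def)
    finally have "herm (y z) (L z *v y z) = herm (y z) (cvec f z) - herm (y z) (L z *v k z)"
      by (simp add: matrix_vector_right_distrib herm_add_right)
    then have "of_real (energy z (y z)) = cnj (cnj (herm (y z) (cvec f z)) - cnj (herm (y z) (L z *v k z)))"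
      by (simp add: herm_L_self)
    also have "cnj (herm (y z) (L z *v k z)) = 
        (\<Sum>r\<in>R. cnj (herm (y z) (cvec (v r) z)) * (\<Sum>l\<in>UNIV. cpoly (v r $ l) z * K' l z))"
      by (simp add: herm_L herm_commute) (simp add: herm_def cvec_def k_def K'_def mult_ac)
    also have "cnj (herm (y z) (cvec f z)) - \<dots> = \<Psi> z"
      by (simp add: hy z deg degree_rows \<Psi>_def right_diff_distrib
        sum_distrib_left[where A = R] mult.assoc cong: sum.cong)
    finally show ?thesis .
  qed
  have "circ_avg (\<lambda>z. of_real (energy z (y z))) = circ_avg (\<lambda>z. cnj (\<Psi> z))"
    by (rule circ_avg_cong) (rule en)
  also have "\<dots> = 0"
    by (simp add: circ_avg_cnj circ_avg_analytic[OF \<Psi>]) (simp add: \<Psi>_def)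
  finally have avg: "circ_avg (\<lambda>z. of_real (energy z (y z))) = 0" .
  have cont: "continuous_on (sphere 0 1) (\<lambda>z. energy z (y z))"
    by (rule continuous_on_energy) (simp add: y_def contF)
  have "y z = 0" if z: "cmod z = 1" for z
  proof -
    have "energy z (y z) = 0"
      by (rule circ_avg_nonneg_eq_0[OF cont _ avg z]) (rule energy_nonneg)
    then show ?thesis
      by (rule energy_eq_0[OF z])
  qed
  then have "F l z = 0" if "cmod z = 1" for z l
    using that by (simp add: y_def vec_eq_iff)
  then show ?thesis
    using K FK by (intro exI[of _ K]) simp
qed

text \<open>Among the vectors of degree at most \<open>N\<close>, those orthogonal to the shifts of
  degree 1 to \<open>N\<close> form a space whose dimension is the size of \<open>'n\<close>. It is
  spanned by the constants \<open>e_i\<close> corrected by their projections on the shifts; the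
  \<open>y i\<close> are an orthonormal basis of it.\<close>

lemma orthonormal_polynomials:
  "\<exists>y :: 'n \<Rightarrow> real poly ^ 'n. (\<forall>i l. degree (y i $ l) \<le> N) \<and>
    (\<forall>i j l. 1 \<le> j \<longrightarrow> j \<le> N \<longrightarrow> ipr (y i) (shift (j, l)) = 0) \<and>
    (\<forall>i k. ipr (y i) (y k) = (if i = k then 1 else 0))"
proof -
  define J :: "(nat \<times> 'n) set" where "J = {1..N} \<times> UNIV"
  have fin: "finite J"
    by (simp add: J_def)
  have "(\<Sum>p\<in>J. \<Sum>q\<in>J. c p * c q * ipr (shift p) (shift q)) > 0" if c: "\<exists>p\<in>J. c p \<noteq> 0" for c
  proof -
    obtain j l where "(j, l) \<in> J" "c (j, l) \<noteq> 0"
      using c by auto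
    then have "coeff (lincomb J c shift $ l) j \<noteq> 0"
      by (simp add: coeff_lincomb_shift fin)
    then have "lincomb J c shift \<noteq> 0"
      by auto
    then show ?thesis
      using ipr_pos by (simp add: ipr_lincomb[OF fin fin, symmetric])
  qed
  then have "\<exists>c. \<forall>q\<in>J. (\<Sum>p\<in>J. c p * ipr (shift p) (shift q)) = ipr (shift (0, i)) (shift q)" for i
    by (rule gram_solve[OF fin])
  then obtain c where c: "\<And>i q. q \<in> J \<Longrightarrow> (\<Sum>p\<in>J. c i p * ipr (shift p) (shift q)) = ipr (shift (0, i)) (shift q)"
    by metis
  define x where "x i = shift (0, i) - lincomb J (c i) shift" for i
  have x_orth: "ipr (x i) (shift q) = 0" if "q \<in> J" for i q
    by (simp add: x_def ipr_diff_left ipr_lincomb_left fin c that)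
  have x_coeff: "coeff (x i $ l) j = (if j = 0 \<and> l = i then 1 else if 1 \<le> j \<and> j \<le> N then - c i (j, l) else 0)" for i l j
    by (auto simp: x_def coeff_lincomb_shift fin J_def shift_def)
  \<comment> \<open>Since \<open>J\<close> starts at degree 1, the correction leaves constant terms
    alone: \<open>X u\<close> has constant term \<open>u\<close>, so \<open>X\<close> is injective
    and \<open>\<beta>\<close> is positive definite.\<close>
  define X where "X u = lincomb UNIV (($) u) x" for u :: "real ^ 'n"
  have X_coeff: "coeff (X u $ l) j = (\<Sum>i\<in>UNIV. u $ i * coeff (x i $ l) j)" for u l j
    by (simp add: X_def lincomb_def coeff_sum)
  have X0: "coeff (X u $ l) 0 = u $ l" for u l
    by (simp add: X_coeff x_coeff if_distrib[of "\<lambda>x. _ * x"] cong: if_cong)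
  define \<beta> where "\<beta> u w = ipr (X u) (X w)" for u w
  have "bilinear \<beta>"
    unfolding bilinear_def linear_iff \<beta>_def X_def
    by (simp add: ipr_lincomb sum.distrib sum_distrib_left distrib_left distrib_right mult_ac)
  moreover have "\<beta> u w = \<beta> w u" for u w
    unfolding \<beta>_def by (rule ipr_commute)
  moreover have "\<beta> u u > 0" if "u \<noteq> 0" for u
  proof -
    have "X u \<noteq> 0"
    proof
      assume "X u = 0"
      then have "u = 0"
        using X0[of u] by (simp add: vec_eq_iff)
      with that show False
        by simp
    qed
    then show ?thesis
      unfolding \<beta>_def by (rule ipr_pos)
  qed
  ultimately have "\<exists>s :: 'n \<Rightarrow> real ^ 'n. \<forall>i j. \<beta> (s i) (s j) = (if i = j then 1 else 0)"
    by (rule bilinear_orthonormal_family)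
  then obtain s :: "'n \<Rightarrow> real ^ 'n" where s: "\<forall>i j. \<beta> (s i) (s j) = (if i = j then 1 else 0)"
    by (elim exE)
  have deg: "degree (X (s i) $ l) \<le> N" for i l
    by (rule degree_le) (simp add: X_coeff x_coeff)
  have orth: "ipr (X (s i)) (shift (j, l)) = 0" if "1 \<le> j" "j \<le> N" for i j l
    using that by (simp add: X_def ipr_lincomb_left x_orth J_def)
  show ?thesis
    using deg orth s unfolding \<beta>_def by (intro exI[of _ "\<lambda>i. X (s i)"]) blast
qed

text \<open>Orthonormality is an integral condition; constancy of the Gram matrix
  \<open>\<Theta>\<close> makes it pointwise. In the disc, \<open>\<Theta> = 1\<close> exhibits the
  matrix of the \<open>K j l\<close> as an inverse of \<open>Y\<close>. On the circle it reads
  \<open>XS ** GX = mat 1\<close>, and reversing the order of these square factors gives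
  \<open>X ** XS = L z\<close>.\<close>

lemma spectral_factor:
  "\<exists>Y :: real poly ^ 'n ^ 'n. (\<forall>z. cmod z \<le> 1 \<longrightarrow> invertible (map_matrix (\<lambda>p. cpoly p z) Y)) \<and>
    (\<forall>z a. cmod z = 1 \<longrightarrow> (norm (map_matrix (\<lambda>p. cpoly p z) Y *v a))\<^sup>2 =
      (\<Sum>r\<in>R. (cmod (\<Sum>l\<in>UNIV. cpoly (v r $ l) z * a $ l))\<^sup>2))"
proof -
  obtain y :: "'n \<Rightarrow> real poly ^ 'n" where deg: "\<And>i l. degree (y i $ l) \<le> N"
    and orth: "\<And>i j l. 1 \<le> j \<Longrightarrow> j \<le> N \<Longrightarrow> ipr (y i) (shift (j, l)) = 0"
    and orthonormal: "\<And>i k. ipr (y i) (y k) = (if i = k then 1 else 0)"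
    using orthonormal_polynomials by (elim exE conjE) blast
  have "\<exists>K. \<forall>l. K l analytic_on cball 0 1 \<and> (\<forall>z. cmod z = 1 \<longrightarrow> (G z *v cvec (y i) z) $ l = K l (cnj z))" for i
    by (rule G_coanalytic[OF deg orth])
  then obtain K where K: "\<And>i l. K i l analytic_on cball 0 1"
    and GK: "\<And>i l z. cmod z = 1 \<Longrightarrow> (G z *v cvec (y i) z) $ l = K i l (cnj z)"
    by metis
  define \<Theta> where "\<Theta> i j z = (\<Sum>l\<in>UNIV. cpoly (y i $ l) z * K j l z)" for i j z
  have \<Theta>_an: "\<Theta> i j analytic_on cball 0 1" for i j
    unfolding \<Theta>_def[abs_def] by (auto intro!: analytic_intros cpoly_analytic K)
  have \<Theta>: "herm (cvec (y i) z) (G z *v cvec (y j) z) = \<Theta> i j (cnj z)" if "cmod z = 1" for i j z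
    by (simp add: herm_def GK that) (simp add: \<Theta>_def cvec_def cnj_cpoly)
  have \<Theta>_herm: "\<Theta> i j z = cnj (\<Theta> j i z)" if "cmod z = 1" for i j z
    using \<Theta>[of "cnj z"] that by (metis complex_cnj_cnj complex_mod_cnj herm_commute herm_G_swap)
  have \<Theta>_eq: "\<Theta> i j z = (if i = j then 1 else 0)" if "cmod z \<le> 1" for i j z
  proof -
    have "\<Theta> i j z = \<Theta> i j 0"
      by (rule analytic_const_if_cnj_analytic[OF \<Theta>_an \<Theta>_an \<Theta>_herm that])
    also have "\<dots> = circ_avg (\<lambda>z. \<Theta> i j (cnj z))"
      by (simp add: circ_avg_reflect analytic_on_continuous_circle \<Theta>_an circ_avg_analytic)
    also have "\<dots> = ip (y j) (y i)"
      unfolding ip_def by (rule circ_avg_cong) (simp add: \<Theta>)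
    finally show ?thesis
      by (simp add: ip_eq_ipr orthonormal)
  qed
  define Y :: "real poly ^ 'n ^ 'n" where "Y = (\<chi> i. y i)"
  show ?thesis
  proof (rule exI[of _ Y], intro conjI allI impI)
    fix z :: complex assume "cmod z \<le> 1"
    then have "map_matrix (\<lambda>p. cpoly p z) Y ** (\<chi> l j. K j l z) = mat 1"
      using \<Theta>_eq by (simp add: matrix_matrix_mult_def vec_eq_iff mat_def Y_def \<Theta>_def)
    then show "invertible (map_matrix (\<lambda>p. cpoly p z) Y)"
      by (auto simp: invertible_right_inverse)
  next
    fix z :: complex and a :: "complex ^ 'n" assume z: "cmod z = 1"
    \<comment> \<open>The claim pairs the rows with \<open>a\<close> without conjugation, whereas
      \<open>herm\<close> conjugates them; passing to \<open>b\<close> changes the pairing only by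
      an overall conjugate.\<close>
    define b where "b = (\<chi> l. cnj (a $ l))"
    define X XS GX :: "complex ^ 'n ^ 'n"
      where "X = (\<chi> l i. cvec (y i) z $ l)" and "XS = (\<chi> i l. cnj (cvec (y i) z $ l))"
        and "GX = (\<chi> l i. (G z *v cvec (y i) z) $ l)"
    have "XS ** GX = mat 1"
      using \<Theta>[OF z] \<Theta>_eq[of "cnj z"] z
      by (simp add: XS_def GX_def matrix_matrix_mult_def vec_eq_iff mat_def herm_def)
    then have "GX ** XS = mat 1"
      using matrix_left_right_inverse by blast
    moreover have "L z ** GX = X"
      using L_G_mult[OF z] by (simp add: GX_def X_def matrix_matrix_mult_def matrix_vector_mult_def[of "L z"] vec_eq_iff)
    ultimately have LX: "X ** XS = L z"
      by (metis matrix_mul_assoc matrix_mul_rid)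
    have Xb: "(XS *v b) $ i = cnj ((map_matrix (\<lambda>p. cpoly p z) Y *v a) $ i)" for i
      by (simp add: XS_def b_def Y_def matrix_vector_mult_def cvec_def)
    have "complex_of_real ((norm (map_matrix (\<lambda>p. cpoly p z) Y *v a))\<^sup>2) = (\<Sum>i\<in>UNIV. cnj ((XS *v b) $ i) * (XS *v b) $ i)"
      by (simp add: Xb norm_vec_def L2_set_def sum_nonneg complex_norm_square del: of_real_power)
    also have "\<dots> = herm b (X *v (XS *v b))"
    proof -
      have "(\<Sum>i\<in>UNIV. cnj ((XS *v b) $ i) * w $ i) = herm b (X *v w)" for w
      proof -
        have "(\<Sum>i\<in>UNIV. cnj ((XS *v b) $ i) * w $ i) = (\<Sum>i\<in>UNIV. \<Sum>l\<in>UNIV. cvec (y i) z $ l * cnj (b $ l) * w $ i)"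
          by (simp add: XS_def matrix_vector_mult_def sum_distrib_right)
        also have "\<dots> = (\<Sum>l\<in>UNIV. \<Sum>i\<in>UNIV. cvec (y i) z $ l * cnj (b $ l) * w $ i)"
          by (rule sum.swap)
        also have "\<dots> = herm b (X *v w)"
          by (simp add: herm_def X_def matrix_vector_mult_def sum_distrib_left mult_ac)
        finally show ?thesis .
      qed
      then show ?thesis .
    qed
    also have "\<dots> = of_real (energy z b)"
      by (simp only: matrix_vector_mul_assoc LX herm_L_self)
    finally have "(norm (map_matrix (\<lambda>p. cpoly p z) Y *v a))\<^sup>2 = energy z b"
      by (simp only: of_real_eq_iff)
    also have "\<dots> = (\<Sum>r\<in>R. (cmod (\<Sum>l\<in>UNIV. cpoly (v r $ l) z * a $ l))\<^sup>2)"
    proof -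
      have "herm (cvec (v r) z) b = cnj (\<Sum>l\<in>UNIV. cpoly (v r $ l) z * a $ l)" for r
        by (simp add: herm_def cvec_def b_def)
      then show ?thesis
        by (simp only: energy_def complex_mod_cnj)
    qed
    finally show "(norm (map_matrix (\<lambda>p. cpoly p z) Y *v a))\<^sup>2 =
      (\<Sum>r\<in>R. (cmod (\<Sum>l\<in>UNIV. cpoly (v r $ l) z * a $ l))\<^sup>2)" .
  qed
qed

end

section \<open>The ring of rational functions without poles in the closed disc\<close>

lemma rat_eval_Fract_cpoly:
  "cpoly q z \<noteq> 0 \<Longrightarrow> rat_eval (Fraction_Field.Fract p q) z = cpoly p z / cpoly q z"
  unfolding cpoly_def by (rule rat_eval_Fract)

text \<open>The denominator in lowest terms divides every other denominator, so any representation
  whose denominator has no zero in the closed disc will do. The ring operations then follow from the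
  usual formulas for fractions.\<close>

lemma ratH_iff_Fract:
  "f \<in> ratH \<longleftrightarrow> (\<exists>p q. f = Fraction_Field.Fract p q \<and> (\<forall>z. cmod z \<le> 1 \<longrightarrow> cpoly q z \<noteq> 0))"
proof
  assume "f \<in> ratH"
  moreover have "f = Fraction_Field.Fract (fst (quot_of_fract f)) (snd (quot_of_fract f))"
    by (metis quot_to_fract_quot_of_fract quot_to_fract_def case_prod_beta)
  ultimately show "\<exists>p q. f = Fraction_Field.Fract p q \<and> (\<forall>z. cmod z \<le> 1 \<longrightarrow> cpoly q z \<noteq> 0)"
    unfolding ratH_iff cpoly_def by blast
next
  assume "\<exists>p q. f = Fraction_Field.Fract p q \<and> (\<forall>z. cmod z \<le> 1 \<longrightarrow> cpoly q z \<noteq> 0)"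
  then obtain p q where f: "f = Fraction_Field.Fract p q" and q: "\<forall>z. cmod z \<le> 1 \<longrightarrow> cpoly q z \<noteq> 0"
    by blast
  have q0: "q \<noteq> 0"
    using q[rule_format, of 0] by auto
  obtain d where d: "q = snd (normalize_quot (p, q)) * d"
    using normalize_quotE[OF q0, of p] by metis
  have "quot_of_fract f = normalize_quot (p, q)"
    unfolding f by (metis q0 quot_of_fract_quot_to_fract quot_to_fract_def case_prod_conv snd_conv)
  then have "cpoly q z = cpoly (snd (quot_of_fract f)) z * cpoly d z" for z
    using d by (metis cpoly_mult)
  then show "f \<in> ratH"
    using q unfolding ratH_iff cpoly_def[symmetric] by (metis mult_zero_left)
qed

lemma ratH_cases:
  assumes "f \<in> ratH"
  obtains p q where "f = Fraction_Field.Fract p q" "\<And>z. cmod z \<le> 1 \<Longrightarrow> cpoly q z \<noteq> 0" "q \<noteq> 0"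
proof -
  obtain p q where "f = Fraction_Field.Fract p q" and q: "\<forall>z. cmod z \<le> 1 \<longrightarrow> cpoly q z \<noteq> 0"
    using assms ratH_iff_Fract by blast
  moreover have "q \<noteq> 0"
    using q[rule_format, of 0] by auto
  ultimately show ?thesis
    using that by blast
qed

lemma ratH_Fract: "(\<And>z. cmod z \<le> 1 \<Longrightarrow> cpoly q z \<noteq> 0) \<Longrightarrow> Fraction_Field.Fract p q \<in> ratH"
  unfolding ratH_iff_Fract by blast

lemma ratH_Fract_1: "Fraction_Field.Fract p 1 \<in> ratH"
  by (rule ratH_Fract) simp

lemma ratH_1: "1 \<in> ratH" and ratH_0: "0 \<in> ratH"
  unfolding One_fract_def Zero_fract_def by (rule ratH_Fract_1)+

lemma rat_eval_1: "rat_eval 1 z = 1" and rat_eval_0: "rat_eval 0 z = 0"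
  unfolding One_fract_def Zero_fract_def by (simp_all add: rat_eval_Fract_cpoly)

lemma ratH_add: "f \<in> ratH \<Longrightarrow> g \<in> ratH \<Longrightarrow> f + g \<in> ratH"
  and rat_eval_add: "f \<in> ratH \<Longrightarrow> g \<in> ratH \<Longrightarrow> cmod z \<le> 1 \<Longrightarrow> rat_eval (f + g) z = rat_eval f z + rat_eval g z"
  by (auto elim!: ratH_cases simp: rat_eval_Fract_cpoly add_frac_eq intro!: ratH_Fract)

lemma ratH_mult: "f \<in> ratH \<Longrightarrow> g \<in> ratH \<Longrightarrow> f * g \<in> ratH"
  and rat_eval_mult: "f \<in> ratH \<Longrightarrow> g \<in> ratH \<Longrightarrow> cmod z \<le> 1 \<Longrightarrow> rat_eval (f * g) z = rat_eval f z * rat_eval g z"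
  by (auto elim!: ratH_cases simp: rat_eval_Fract_cpoly intro!: ratH_Fract)

lemma ratH_uminus: "f \<in> ratH \<Longrightarrow> - f \<in> ratH"
  and rat_eval_uminus: "f \<in> ratH \<Longrightarrow> cmod z \<le> 1 \<Longrightarrow> rat_eval (- f) z = - rat_eval f z"
  by (auto elim!: ratH_cases simp: rat_eval_Fract_cpoly intro!: ratH_Fract)

lemma ratH_diff: "f \<in> ratH \<Longrightarrow> g \<in> ratH \<Longrightarrow> f - g \<in> ratH"
  using ratH_add[of f "- g"] ratH_uminus[of g] by simp

lemma rat_eval_diff: "f \<in> ratH \<Longrightarrow> g \<in> ratH \<Longrightarrow> cmod z \<le> 1 \<Longrightarrow> rat_eval (f - g) z = rat_eval f z - rat_eval g z"
  using rat_eval_add[of f "- g" z] ratH_uminus[of g] rat_eval_uminus[of g z] by simp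

lemma ratH_inverse:
  assumes "f \<in> ratH" "\<And>z. cmod z \<le> 1 \<Longrightarrow> rat_eval f z \<noteq> 0"
  shows "inverse f \<in> ratH"
proof -
  obtain p q where pq: "f = Fraction_Field.Fract p q" "\<And>z. cmod z \<le> 1 \<Longrightarrow> cpoly q z \<noteq> 0" "q \<noteq> 0"
    using ratH_cases[OF assms(1)] by metis
  have "cpoly p z \<noteq> 0" if "cmod z \<le> 1" for z
    using assms(2)[OF that] pq(2)[OF that] by (auto simp: pq(1) rat_eval_Fract_cpoly)
  then show ?thesis
    unfolding pq(1) inverse_fract by (rule ratH_Fract)
qed

lemma ratH_sum: "(\<And>i. i \<in> I \<Longrightarrow> f i \<in> ratH) \<Longrightarrow> sum f I \<in> ratH"
  by (induction I rule: infinite_finite_induct) (auto simp: ratH_0 ratH_add)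

lemma rat_eval_sum:
  "(\<And>i. i \<in> I \<Longrightarrow> f i \<in> ratH) \<Longrightarrow> cmod z \<le> 1 \<Longrightarrow> rat_eval (sum f I) z = (\<Sum>i\<in>I. rat_eval (f i) z)"
  by (induction I rule: infinite_finite_induct) (auto simp: rat_eval_0 rat_eval_add ratH_sum)

lemma rat_eval_analytic: "f \<in> ratH \<Longrightarrow> rat_eval f analytic_on cball 0 1"
  by (simp add: ratH_def)

lemma continuous_on_rat_eval: "f \<in> ratH \<Longrightarrow> continuous_on (cball 0 1) (rat_eval f)"
  using rat_eval_analytic analytic_imp_holomorphic holomorphic_on_imp_continuous_on by blast

section \<open>Matrices over this ring\<close>

lemma mat_eval_nth [simp]: "mat_eval A z $ i $ j = rat_eval (A $ i $ j) z"
  by (simp add: mat_eval_def)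

lemma ratH_mat_nth: "A \<in> ratH_mat \<Longrightarrow> A $ i $ j \<in> ratH"
  by (simp add: ratH_mat_def)

lemma ratH_mat_closed:
  assumes "A \<in> ratH_mat" "B \<in> ratH_mat"
  shows ratH_mat_mult: "A ** B \<in> ratH_mat"
    and ratH_mat_add: "A + B \<in> ratH_mat"
    and ratH_mat_diff: "A - B \<in> ratH_mat"
  using assms by (auto simp: ratH_mat_def matrix_matrix_mult_def intro!: ratH_sum ratH_mult ratH_add ratH_diff)

lemma ratH_mat_1: "mat 1 \<in> ratH_mat"
  by (simp add: ratH_mat_def mat_def ratH_0 ratH_1)

lemma mat_eval_1 [simp]: "mat_eval (mat 1) z = mat 1"
  by (simp add: vec_eq_iff mat_def rat_eval_1 rat_eval_0)

lemma mat_eval_hom: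
  assumes "A \<in> ratH_mat" "B \<in> ratH_mat" "cmod z \<le> 1"
  shows mat_eval_mult: "mat_eval (A ** B) z = mat_eval A z ** mat_eval B z"
    and mat_eval_add: "mat_eval (A + B) z = mat_eval A z + mat_eval B z"
    and mat_eval_diff: "mat_eval (A - B) z = mat_eval A z - mat_eval B z"
  using assms by (simp_all add: vec_eq_iff matrix_matrix_mult_def rat_eval_sum rat_eval_mult rat_eval_add
      rat_eval_diff ratH_mat_nth ratH_mult)

lemma det_ratH:
  assumes "A \<in> ratH_mat"
  shows "det A \<in> ratH"
  by (rule det_map_matrix_on(1)[where h = "\<lambda>f. rat_eval f 0"])
    (use assms in \<open>auto simp: ratH_1 ratH_add ratH_mult ratH_uminus rat_eval_1 rat_eval_add rat_eval_mult ratH_mat_nth\<close>)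

lemma rat_eval_det:
  assumes "A \<in> ratH_mat" "cmod z \<le> 1"
  shows "rat_eval (det A) z = det (mat_eval A z)"
  unfolding mat_eval_def
  by (rule det_map_matrix_on(2)[where S = ratH])
    (use assms in \<open>auto simp: ratH_1 ratH_add ratH_mult ratH_uminus rat_eval_1 rat_eval_add rat_eval_mult ratH_mat_nth\<close>)

lemma matrix_inv_eqI:
  fixes A B :: "'a::field ^ 'n ^ 'n"
  assumes "A ** B = mat 1"
  shows "matrix_inv A = B"
proof -
  have "invertible A"
    using assms invertible_right_inverse by blast
  then have "matrix_inv A ** (A ** B) = B"
    by (simp add: matrix_mul_assoc matrix_inv_left_mult)
  then show ?thesis
    by (simp add: assms)
qed

lemma invertible_if_mat_eval:
  assumes "A \<in> ratH_mat" "cmod z \<le> 1" "invertible (mat_eval A z)"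
  shows "invertible A"
  using assms rat_eval_det[of A z] by (auto simp: invertible_det_nz rat_eval_0)

text \<open>Cramer's rule, column by column: the entries of the inverse are determinants over the
  ring divided by \<open>det A\<close>, which has no zero in the closed disc and is therefore a
  unit.\<close>

lemma matrix_inv_ratH:
  assumes A: "A \<in> ratH_mat" and inv: "\<And>z. cmod z \<le> 1 \<Longrightarrow> invertible (mat_eval A z)"
  shows "matrix_inv A \<in> ratH_mat"
proof -
  have "invertible A"
    using A inv[of 0] by (intro invertible_if_mat_eval[of A 0]) auto
  then have det: "det A \<noteq> 0"
    by (simp add: invertible_det_nz)
  have idet: "inverse (det A) \<in> ratH"
    using inv by (intro ratH_inverse det_ratH A) (simp add: rat_eval_det A invertible_det_nz)
  have "matrix_inv A $ k $ j \<in> ratH" for k j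
  proof -
    have "A *v column j (matrix_inv A) = column j (A ** matrix_inv A)"
      by (simp add: column_def matrix_matrix_mult_def matrix_vector_mult_def)
    also have "\<dots> = column j (mat 1)"
      by (simp only: matrix_inv_right_mult[OF \<open>invertible A\<close>])
    finally have "A *v column j (matrix_inv A) = column j (mat 1)" .
    then have col: "column j (matrix_inv A) = (\<chi> k. det (\<chi> i l. if l = k then column j (mat 1) $ i else A $ i $ l) / det A)"
      by (rule cramer[OF det, THEN iffD1])
    have "matrix_inv A $ k $ j = column j (matrix_inv A) $ k"
      by (simp add: column_def)
    also have "\<dots> = det (\<chi> i l. if l = k then column j (mat 1) $ i else A $ i $ l) * inverse (det A)"
      by (simp only: col vec_lambda_beta divide_inverse)
    also have "\<dots> \<in> ratH"
      by (intro ratH_mult idet det_ratH)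
        (auto simp: ratH_mat_def column_def mat_def ratH_0 ratH_1 ratH_mat_nth[OF A])
    finally show ?thesis .
  qed
  then show ?thesis
    by (simp add: ratH_mat_def)
qed

lemma mat_eval_matrix_inv:
  assumes "A \<in> ratH_mat" "matrix_inv A \<in> ratH_mat" "invertible A" "cmod z \<le> 1"
  shows "mat_eval A z ** mat_eval (matrix_inv A) z = mat 1"
    and "mat_eval (matrix_inv A) z ** mat_eval A z = mat 1"
  using assms by (simp_all add: mat_eval_mult[symmetric] matrix_inv_right_mult matrix_inv_left_mult)

section \<open>The norm \<open>Hinf_norm\<close>\<close>

lemma norm_matrix_vector_mult_le:
  fixes M :: "complex ^ 'n ^ 'm"
  shows "norm (M *v x) \<le> (\<Sum>i\<in>UNIV. \<Sum>j\<in>UNIV. cmod (M $ i $ j)) * norm x"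
proof -
  have "norm (M *v x) \<le> (\<Sum>i\<in>UNIV. cmod ((M *v x) $ i))"
    by (simp add: norm_vec_def L2_set_le_sum)
  also have "\<dots> \<le> (\<Sum>i\<in>UNIV. \<Sum>j\<in>UNIV. cmod (M $ i $ j) * norm x)"
  proof (rule sum_mono)
    fix i
    have "cmod ((M *v x) $ i) \<le> (\<Sum>j\<in>UNIV. cmod (M $ i $ j * x $ j))"
      unfolding matrix_vector_mult_def by (simp add: norm_sum)
    also have "\<dots> \<le> (\<Sum>j\<in>UNIV. cmod (M $ i $ j) * norm x)"
      by (intro sum_mono) (auto simp: norm_mult intro!: mult_left_mono Finite_Cartesian_Product.norm_nth_le)
    finally show "cmod ((M *v x) $ i) \<le> (\<Sum>j\<in>UNIV. cmod (M $ i $ j) * norm x)" .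
  qed
  finally show ?thesis
    by (simp add: sum_distrib_right)
qed

lemma bounded_linear_matrix_vector_mult:
  fixes M :: "complex ^ 'n ^ 'm"
  shows "bounded_linear (\<lambda>x. M *v x)"
proof (rule bounded_linear_intro)
  show "M *v (x + y) = M *v x + M *v y" for x y
    by (rule matrix_vector_right_distrib)
  show "M *v (r *\<^sub>R x) = r *\<^sub>R (M *v x)" for r x
    by (simp add: vec_eq_iff matrix_vector_mult_def scaleR_sum_right)
  show "norm (M *v x) \<le> norm x * (\<Sum>i\<in>UNIV. \<Sum>j\<in>UNIV. cmod (M $ i $ j))" for x
    using norm_matrix_vector_mult_le[of M x] by (simp only: mult.commute)
qed

lemma continuous_on_mat_eval_mult:
  assumes "Q \<in> ratH_mat" "continuous_on S f" "continuous_on S g" "f ` S \<subseteq> cball 0 1"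
  shows "continuous_on S (\<lambda>x. mat_eval Q (f x) *v g x)"
proof -
  have "continuous_on S (\<lambda>x. rat_eval (Q $ i $ j) (f x))" for i j
    by (rule continuous_on_compose2[OF continuous_on_rat_eval]) (use assms in \<open>auto simp: ratH_mat_nth\<close>)
  then show ?thesis
    unfolding matrix_vector_mult_def by (auto intro!: continuous_intros assms)
qed

text \<open>The supremum runs over the open disc; continuity carries the bound to the boundary. The
  sum of the moduli of the entries shows that the family is bounded above, without which the real
  supremum says nothing.\<close>

lemma norm_mat_eval_le_Hinf_norm:
  assumes Q: "Q \<in> ratH_mat" and "cmod z \<le> 1"
  shows "norm (mat_eval Q z *v x) \<le> Hinf_norm Q * norm x"
proof -
  let ?S = "\<lambda>z. \<Sum>i\<in>UNIV. \<Sum>j\<in>UNIV. cmod (mat_eval Q z $ i $ j)"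
  have "continuous_on (cball 0 1) ?S"
    by (auto intro!: continuous_intros continuous_on_rat_eval ratH_mat_nth Q)
  then have "compact (?S ` cball 0 1)"
    by (intro compact_continuous_image) auto
  then have "bdd_above (?S ` cball 0 1)"
    by (intro bounded_imp_bdd_above compact_imp_bounded)
  then obtain B where B: "\<forall>y\<in>?S ` cball 0 1. y \<le> B"
    unfolding bdd_above_def by blast
  have onorm_le: "onorm (\<lambda>v. mat_eval Q z *v v) \<le> ?S z" for z
    by (rule onorm_le) (rule norm_matrix_vector_mult_le)
  have "onorm (\<lambda>v. mat_eval Q z *v v) \<le> B" if "z \<in> ball 0 1" for z
  proof -
    have "?S z \<le> B"
      using that by (intro B[rule_format] imageI) auto
    with onorm_le[of z] show ?thesis
      by linarith
  qed
  then have bdd: "bdd_above ((\<lambda>z. onorm (\<lambda>v. mat_eval Q z *v v)) ` ball 0 1)"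
    by (intro bdd_aboveI2)
  have ball: "norm (mat_eval Q z *v x) \<le> Hinf_norm Q * norm x" if "z \<in> ball 0 1" for z
  proof -
    have "norm (mat_eval Q z *v x) \<le> onorm (\<lambda>v. mat_eval Q z *v v) * norm x"
      by (rule onorm[OF bounded_linear_matrix_vector_mult])
    also have "\<dots> \<le> Hinf_norm Q * norm x"
      unfolding Hinf_norm_def using bdd that by (intro mult_right_mono cSUP_upper) auto
    finally show ?thesis .
  qed
  have cont: "continuous_on (closure (ball 0 1)) (\<lambda>z. norm (mat_eval Q z *v x))"
    by (intro continuous_intros continuous_on_mat_eval_mult Q) auto
  show ?thesis
    by (rule continuous_le_on_closure[OF cont]) (use ball assms(2) in auto)
qed

lemma cmod_herm_le: "cmod (herm a b) \<le> norm a * norm b"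
proof -
  have "cmod (herm a b) \<le> (\<Sum>l\<in>UNIV. \<bar>cmod (a $ l)\<bar> * \<bar>cmod (b $ l)\<bar>)"
    unfolding herm_def by (rule sum_norm_le) (simp add: norm_mult)
  also have "\<dots> \<le> norm a * norm b"
    unfolding norm_vec_def by (rule L2_set_mult_ineq)
  finally show ?thesis .
qed

lemma herm_self: "herm a a = of_real ((norm a)\<^sup>2)"
  by (simp add: herm_def norm_vec_def L2_set_def sum_nonneg complex_norm_square mult.commute del: of_real_power)

text \<open>Strictness at each point of the circle becomes a uniform bound
  \<open>\<rho> < 1\<close>, by compactness of the pairs of a circle point and a unit vector. The
  maximum principle needs a scalar function, so the value at \<open>w\<close> is tested against
  itself: \<open>u\<close> is frozen while \<open>z\<close> varies.\<close>

lemma Hinf_norm_less_1: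
  assumes Q: "Q \<in> ratH_mat" and less: "\<And>z x. cmod z = 1 \<Longrightarrow> x \<noteq> 0 \<Longrightarrow> norm (mat_eval Q z *v x) < norm x"
  shows "Hinf_norm (Q :: real poly fract ^ 'n ^ 'n) < 1"
proof -
  let ?K = "sphere (0::complex) 1 \<times> sphere (0 :: complex ^ 'n) 1"
  let ?f = "\<lambda>p. norm (mat_eval Q (fst p) *v snd p)"
  have "compact ?K"
    by (intro compact_Times compact_sphere)
  moreover have "?K \<noteq> {}"
  proof -
    have "(1, axis undefined 1) \<in> ?K"
      by simp
    then show ?thesis
      by (simp only: ex_in_conv[symmetric]) (rule exI)
  qed
  moreover have "continuous_on ?K ?f"
    by (intro continuous_intros continuous_on_mat_eval_mult Q) auto
  ultimately have "\<exists>p\<in>?K. \<forall>q\<in>?K. ?f q \<le> ?f p"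
    by (rule continuous_attains_sup)
  then obtain p where p: "p \<in> ?K" "\<forall>q\<in>?K. ?f q \<le> ?f p"
    by (elim bexE)
  define \<rho> where "\<rho> = ?f p"
  have \<rho>: "\<rho> < 1"
  proof -
    have "cmod (fst p) = 1" "norm (snd p) = 1"
      using p(1) by (auto simp: mem_Times_iff)
    moreover from this have "snd p \<noteq> 0"
      by auto
    ultimately show ?thesis
      using less[of "fst p" "snd p"] by (simp add: \<rho>_def)
  qed
  have \<rho>0: "\<rho> \<ge> 0"
    by (simp add: \<rho>_def)
  have circle: "norm (mat_eval Q z *v x) \<le> \<rho> * norm x" if "cmod z = 1" for z x
  proof (cases "x = 0")
    case False
    define x1 where "x1 = x /\<^sub>R norm x"
    have "(z, x1) \<in> ?K"
      using False that by (simp add: x1_def)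
    then have "norm (mat_eval Q z *v x1) \<le> \<rho>"
      using p(2) by (force simp: \<rho>_def)
    moreover have "mat_eval Q z *v x1 = (mat_eval Q z *v x) /\<^sub>R norm x"
      unfolding x1_def by (intro linear_scale bounded_linear.linear bounded_linear_matrix_vector_mult)
    ultimately show ?thesis
      using False by (simp add: field_simps)
  qed simp
  have disc: "norm (mat_eval Q w *v x) \<le> \<rho> * norm x" if w: "cmod w \<le> 1" for w x
  proof -
    define u where "u = mat_eval Q w *v x"
    have "(\<lambda>z. herm u (mat_eval Q z *v x)) analytic_on cball 0 1"
      unfolding herm_def matrix_vector_mult_def
      by (auto intro!: analytic_intros rat_eval_analytic ratH_mat_nth Q)
    moreover have "cmod (herm u (mat_eval Q z *v x)) \<le> norm u * (\<rho> * norm x)" if "cmod z = 1" for z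
      using cmod_herm_le[of u "mat_eval Q z *v x"] mult_left_mono[OF circle[OF that, of x], of "norm u"] by simp
    ultimately have "cmod (herm u (mat_eval Q w *v x)) \<le> norm u * (\<rho> * norm x)"
      using w by (rule analytic_max_modulus_disc)
    then have "norm u * norm u \<le> norm u * (\<rho> * norm x)"
      by (simp add: u_def[symmetric] herm_self power2_eq_square norm_mult)
    then show ?thesis
      using \<rho>0 by (cases "u = 0") (auto simp: u_def[symmetric] mult_le_cancel_left)
  qed
  have "Hinf_norm Q \<le> \<rho>"
    unfolding Hinf_norm_def by (rule cSUP_least) (auto intro!: onorm_le disc)
  then show ?thesis
    using \<rho> by simp
qed

section \<open>Cayley transforms and the inclusion from right to left\<close>

lemma matrix_add_rdistrib: "(A + B) ** C = A ** C + B ** C" for A B :: "'a::semiring_1 ^ 'n ^ 'm"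
  by (simp add: vec_eq_iff matrix_matrix_mult_def distrib_right sum.distrib)

lemma matrix_diff_rdistrib: "(A - B) ** C = A ** C - B ** C" for A B :: "'a::ring_1 ^ 'n ^ 'm"
  by (simp add: vec_eq_iff matrix_matrix_mult_def left_diff_distrib sum_subtractf)

lemma matrix_diff_ldistrib: "C ** (A - B) = C ** A - C ** B" for A B :: "'a::ring_1 ^ 'n ^ 'm"
  by (simp add: vec_eq_iff matrix_matrix_mult_def right_diff_distrib sum_subtractf)

lemma norm_mat_eval_less:
  assumes "Q \<in> ratH_mat" "Hinf_norm Q < 1" "cmod z \<le> 1" "x \<noteq> 0"
  shows "norm (mat_eval Q z *v x) < norm x"
proof -
  have "norm (mat_eval Q z *v x) \<le> Hinf_norm Q * norm x"
    using assms by (intro norm_mat_eval_le_Hinf_norm)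
  also have "\<dots> < norm x"
    using assms by simp
  finally show ?thesis .
qed

lemma invertible_1_minus_contraction:
  fixes Q :: "complex ^ 'n ^ 'n"
  assumes "\<And>x. x \<noteq> 0 \<Longrightarrow> norm (Q *v x) < norm x"
  shows "invertible (mat 1 - Q)"
proof (rule invertible_if_ker_trivial)
  fix x assume "(mat 1 - Q) *v x = 0"
  then have "Q *v x = x"
    by (simp add: matrix_vector_mult_diff_rdistrib)
  then show "x = 0"
    using assms[of x] by fastforce
qed

lemma Hinf_contraction:
  assumes "Q \<in> ratH_mat" "Hinf_norm Q < 1"
  shows invertible_mat_eval_1_minus: "cmod z \<le> 1 \<Longrightarrow> invertible (mat_eval (mat 1 - Q) z)"
    and invertible_1_minus: "invertible (mat 1 - Q)"
proof -
  show "invertible (mat_eval (mat 1 - Q) z)" if "cmod z \<le> 1" for z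
    using norm_mat_eval_less[OF assms that]
    by (simp add: mat_eval_diff ratH_mat_1 assms(1) that invertible_1_minus_contraction)
  from this[of 0] show "invertible (mat 1 - Q)"
    by (intro invertible_if_mat_eval[of _ 0] ratH_mat_diff ratH_mat_1 assms) auto
qed

lemma cayley_ratH:
  assumes "Q \<in> ratH_mat" "Hinf_norm Q < 1"
  shows "cayley Q \<in> ratH_mat"
  unfolding cayley_def
  by (intro ratH_mat_mult ratH_mat_add ratH_mat_1 matrix_inv_ratH ratH_mat_diff
      invertible_mat_eval_1_minus assms)

lemma cayley_mult:
  assumes "Q \<in> ratH_mat" "Hinf_norm Q < 1"
  shows "cayley Q ** (mat 1 - Q) = mat 1 + Q"
  unfolding cayley_def
  by (simp add: matrix_mul_assoc[symmetric] matrix_inv_left_mult invertible_1_minus[OF assms])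

lemma mat_eval_cayley_mult:
  assumes "Q \<in> ratH_mat" "Hinf_norm Q < 1" "cmod z \<le> 1"
  shows "mat_eval (cayley Q) z ** (mat 1 - mat_eval Q z) = mat 1 + mat_eval Q z"
  using arg_cong[OF cayley_mult[OF assms(1,2)], of "\<lambda>A. mat_eval A z"] assms
  by (simp add: mat_eval_mult mat_eval_diff mat_eval_add cayley_ratH ratH_mat_1 ratH_mat_diff)

text \<open>Both Cayley factors have positive definite real part:
  \<open>\<langle>(1 + Q) a, (1 - Q) a\<rangle> = |a|\<^sup>2 - |Q a|\<^sup>2\<close> for the real inner product.
  If their product maps \<open>w\<close> to \<open>r w\<close> with \<open>r \<le> 0\<close>, comparing these quantities for the
  two factors gives opposite signs.\<close>

lemma eigenvalue_cayley_product:
  fixes C1 C2 Q1 Q2 :: "complex ^ 'n ^ 'n"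
  assumes C: "C1 ** (mat 1 - Q1) = mat 1 + Q1" "C2 ** (mat 1 - Q2) = mat 1 + Q2"
    and Q1: "\<And>x. x \<noteq> 0 \<Longrightarrow> norm (Q1 *v x) < norm x"
    and Q2: "\<And>x. x \<noteq> 0 \<Longrightarrow> norm (Q2 *v x) < norm x"
    and w: "w \<noteq> 0" "C1 *v (C2 *v w) = \<mu> *s w"
  shows "\<mu> \<notin> \<real>\<^sub>\<le>\<^sub>0"
proof
  assume "\<mu> \<in> \<real>\<^sub>\<le>\<^sub>0"
  then obtain r where r: "\<mu> = of_real r" "r \<le> 0"
    by (auto elim: nonpos_Reals_cases)
  have ex: "\<exists>a. C *v y = a + Q *v a \<and> y = a - Q *v a"
    if "C ** (mat 1 - Q) = mat 1 + Q" "\<And>x. x \<noteq> 0 \<Longrightarrow> norm (Q *v x) < norm x"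
    for C Q :: "complex ^ 'n ^ 'n" and y
  proof -
    let ?a = "matrix_inv (mat 1 - Q) *v y"
    have inv: "invertible (mat 1 - Q)"
      using that(2) by (rule invertible_1_minus_contraction)
    have y: "(mat 1 - Q) *v ?a = y"
      using inv by (simp add: matrix_vector_mul_assoc matrix_inv_right_mult)
    have "C *v y = C *v ((mat 1 - Q) *v ?a)"
      by (simp only: y)
    also have "\<dots> = (mat 1 + Q) *v ?a"
      by (simp only: matrix_vector_mul_assoc[of C] that(1))
    finally have "C *v y = (mat 1 + Q) *v ?a" .
    with y show ?thesis
      by (intro exI[of _ ?a])
        (simp add: matrix_vector_mult_diff_rdistrib matrix_vector_mult_add_rdistrib)
  qed
  obtain a where a: "C2 *v w = a + Q2 *v a" "w = a - Q2 *v a"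
    using ex[OF C(2) Q2] by blast
  obtain b where b: "C1 *v (C2 *v w) = b + Q1 *v b" "C2 *v w = b - Q1 *v b"
    using ex[OF C(1) Q1] by blast
  have inner: "inner (x + q) (x - q) = (norm x)\<^sup>2 - (norm q)\<^sup>2" for x q :: "complex ^ 'n"
    by (simp add: inner_diff_right inner_add_left inner_commute[of q x] power2_norm_eq_inner)
  have "a \<noteq> 0"
    using w(1) a(2) by auto
  then have "(norm (Q2 *v a))\<^sup>2 < (norm a)\<^sup>2"
    by (intro power_strict_mono Q2) auto
  then have pos: "inner (C2 *v w) w > 0"
    by (simp only: a(1)) (subst a(2), simp add: inner)
  have "b \<noteq> 0"
    using pos b(2) by auto
  then have "(norm (Q1 *v b))\<^sup>2 < (norm b)\<^sup>2"
    by (intro power_strict_mono Q1) auto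
  then have "inner (\<mu> *s w) (C2 *v w) > 0"
    unfolding w(2)[symmetric] by (simp only: b(1)) (subst b(2), simp add: inner)
  moreover have "\<mu> *s w = r *\<^sub>R w"
    by (simp add: vec_eq_iff) (simp add: r scaleR_conv_of_real)
  ultimately have "r * inner (C2 *v w) w > 0"
    by (simp add: inner_commute)
  then show False
    using pos r(2) by (simp add: zero_less_mult_iff)
qed

lemma cayley_product_in_A_cut:
  assumes U: "U \<in> GL_ratH" and Q1: "Q1 \<in> ratH_mat" "Hinf_norm Q1 < 1"
    and Q2: "Q2 \<in> ratH_mat" "Hinf_norm Q2 < 1"
  shows "matrix_inv U ** cayley Q1 ** cayley Q2 ** U \<in> A_cut"
proof -
  let ?A = "matrix_inv U ** cayley Q1 ** cayley Q2 ** U"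
  have U': "U \<in> ratH_mat" "matrix_inv U \<in> ratH_mat" "invertible U"
    using U by (auto simp: GL_ratH_def)
  have C: "cayley Q1 \<in> ratH_mat" "cayley Q2 \<in> ratH_mat"
    using Q1 Q2 by (simp_all add: cayley_ratH)
  have A: "?A \<in> ratH_mat"
    by (intro ratH_mat_mult U' C)
  have "\<mu> \<notin> \<real>\<^sub>\<le>\<^sub>0" if z: "cmod z \<le> 1" and \<mu>: "\<mu> \<in> spectrum (mat_eval ?A z)" for z \<mu>
  proof -
    obtain v where v: "v \<noteq> 0" "mat_eval ?A z *v v = \<mu> *s v"
      using \<mu> by (auto simp: spectrum_def)
    define w where "w = mat_eval U z *v v"
    have "mat_eval (matrix_inv U) z *v w = v"
      by (simp add: w_def matrix_vector_mul_assoc mat_eval_matrix_inv U' z)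
    then have "w \<noteq> 0"
      using v(1) by auto
    have "mat_eval ?A z = mat_eval (matrix_inv U) z ** mat_eval (cayley Q1) z ** mat_eval (cayley Q2) z ** mat_eval U z"
      by (simp add: mat_eval_mult U' C z ratH_mat_mult)
    then have "mat_eval U z ** mat_eval ?A z = mat_eval (cayley Q1) z ** mat_eval (cayley Q2) z ** mat_eval U z"
      by (simp add: matrix_mul_assoc mat_eval_matrix_inv U' z)
    then have "mat_eval (cayley Q1) z *v (mat_eval (cayley Q2) z *v w) = mat_eval U z *v (mat_eval ?A z *v v)"
      by (simp add: w_def matrix_vector_mul_assoc matrix_mul_assoc)
    also have "\<dots> = \<mu> *s w"
      by (simp add: v(2) w_def vector_scalar_commute)
    finally show ?thesis
      by (intro eigenvalue_cayley_product[OF mat_eval_cayley_mult[OF Q1 z] mat_eval_cayley_mult[OF Q2 z] _ _ \<open>w \<noteq> 0\<close>]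
          norm_mat_eval_less Q1 Q2 z)
  qed
  with A show ?thesis
    unfolding A_cut_def by blast
qed

section \<open>Polynomials in a matrix and approximate square roots\<close>

definition poly_act :: "complex poly \<Rightarrow> complex ^ 'n ^ 'n \<Rightarrow> complex ^ 'n \<Rightarrow> complex ^ 'n" where
  "poly_act p X v = (\<Sum>i\<le>degree p. coeff p i *s ((\<lambda>u. X *v u) ^^ i) v)"

lemma poly_act_eq:
  assumes "degree p \<le> N"
  shows "poly_act p X v = (\<Sum>i\<le>N. coeff p i *s ((\<lambda>u. X *v u) ^^ i) v)"
  unfolding poly_act_def
  by (rule sum.mono_neutral_left) (use assms in \<open>auto simp: coeff_eq_0\<close>)

lemma poly_act_0 [simp]: "poly_act 0 X v = 0"
  by (simp add: poly_act_def)

lemma poly_act_pCons: "poly_act (pCons a p) X v = a *s v + X *v poly_act p X v"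
proof -
  have "poly_act (pCons a p) X v = (\<Sum>i\<le>Suc (degree p). coeff (pCons a p) i *s ((\<lambda>u. X *v u) ^^ i) v)"
    by (rule poly_act_eq) (rule degree_pCons_le)
  also have "\<dots> = a *s v + (\<Sum>i\<le>degree p. coeff p i *s (X *v ((\<lambda>u. X *v u) ^^ i) v))"
    by (subst sum.atMost_Suc_shift) simp
  also have "\<dots> = a *s v + X *v poly_act p X v"
    by (simp add: poly_act_def matrix_vector_mult_sum vector_scalar_commute)
  finally show ?thesis .
qed

lemma poly_act_add: "poly_act (p + q) X v = poly_act p X v + poly_act q X v"
proof -
  let ?N = "max (degree p) (degree q)"
  have "degree (p + q) \<le> ?N"
    by (rule degree_add_le) auto
  then show ?thesis
    by (simp add: poly_act_eq[where N = ?N] sum.distrib vec.scale_left_distrib)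
qed

lemma poly_act_smult: "poly_act (smult c p) X v = c *s poly_act p X v"
  by (simp add: poly_act_eq[where N = "degree p"] degree_smult_le vec.scale_sum_right)

lemma poly_act_diff: "poly_act (p - q) X v = poly_act p X v - poly_act q X v"
proof -
  have "poly_act (p - q) X v = poly_act (p + smult (- 1) q) X v"
    by simp
  then show ?thesis
    by (simp only: poly_act_add poly_act_smult) simp
qed

text \<open>The half of the spectral mapping theorem that is used. Split off a root
  \<open>\<mu>\<close> of \<open>p\<close>: either the cofactor already annihilates
  \<open>v\<close>, or it maps \<open>v\<close> to an eigenvector for \<open>\<mu>\<close>.\<close>

lemma eigenvalue_from_annihilator:
  assumes "p \<noteq> 0" "poly_act p X v = 0" "v \<noteq> 0"
  shows "\<exists>\<mu>\<in>spectrum X. poly p \<mu> = 0"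
  using assms
proof (induction "degree p" arbitrary: p)
  case 0
  then obtain c where p: "p = [:c:]"
    by (metis degree_eq_zeroE)
  then have "c *s v = 0"
    using 0 by (simp add: poly_act_pCons)
  with 0 p show ?case
    by simp
next
  case (Suc d)
  then have "\<not> constant (poly p)"
    by (simp add: constant_degree)
  then obtain \<mu> where root: "poly p \<mu> = 0"
    using fundamental_theorem_of_algebra by blast
  then obtain q where p: "p = [:- \<mu>, 1:] * q"
    by (auto simp: poly_eq_0_iff_dvd dvd_def)
  have q0: "q \<noteq> 0"
    using Suc.prems(1) p by auto
  have deg: "d = degree q"
    using Suc.hyps(2) unfolding p by (subst (asm) degree_mult_eq) (use q0 in auto)
  show ?case
  proof (cases "poly_act q X v = 0")
    case True
    then have "\<exists>\<mu>\<in>spectrum X. poly q \<mu> = 0"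
      using Suc.hyps(1)[OF deg q0] Suc.prems(3) by blast
    then show ?thesis
      by (auto simp: p)
  next
    case False
    have "poly_act p X v = X *v poly_act q X v - \<mu> *s poly_act q X v"
      by (simp add: p poly_act_add poly_act_pCons poly_act_smult poly_act_diff)
    then have "X *v poly_act q X v = \<mu> *s poly_act q X v"
      using Suc.prems(2) by simp
    with False have "\<mu> \<in> spectrum X"
      unfolding spectrum_def by blast
    with root show ?thesis
      by blast
  qed
qed

text \<open>Even and odd part of the binomial expansion of \<open>(1 + \<surd>A)\<^sup>m = E + \<surd>A O\<close>, so that no square
  root is needed to write them down.\<close>

primrec binom_mat :: "'a::comm_ring_1 ^ 'n ^ 'n \<Rightarrow> nat \<Rightarrow> ('a ^ 'n ^ 'n) \<times> ('a ^ 'n ^ 'n)" where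
  "binom_mat A 0 = (mat 1, 0)"
| "binom_mat A (Suc m) = (fst (binom_mat A m) + A ** snd (binom_mat A m), fst (binom_mat A m) + snd (binom_mat A m))"

primrec binom_poly :: "nat \<Rightarrow> complex poly \<times> complex poly" where
  "binom_poly 0 = (1, 0)"
| "binom_poly (Suc m) = (fst (binom_poly m) + pCons 0 (snd (binom_poly m)), fst (binom_poly m) + snd (binom_poly m))"

lemma binom_mat_mult_vec:
  "fst (binom_mat X m) *v v = poly_act (fst (binom_poly m)) X v \<and>
   snd (binom_mat X m) *v v = poly_act (snd (binom_poly m)) X v"
proof (induction m)
  case 0
  show ?case
    using poly_act_pCons[of 1 0 X v] by (simp add: one_pCons)
next
  case (Suc m)
  then show ?case
    by (simp add: matrix_vector_mult_add_rdistrib matrix_vector_mul_assoc[symmetric] poly_act_add poly_act_pCons)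
qed

lemma binom_poly_eq:
  assumes "s\<^sup>2 = \<mu>"
  shows "poly (fst (binom_poly m)) \<mu> + s * poly (snd (binom_poly m)) \<mu> = (1 + s) ^ m"
proof (induction m)
  case (Suc m)
  have "poly (fst (binom_poly (Suc m))) \<mu> + s * poly (snd (binom_poly (Suc m))) \<mu> =
      (1 + s) * (poly (fst (binom_poly m)) \<mu> + s * poly (snd (binom_poly m)) \<mu>)"
    by (simp add: assms[symmetric] algebra_simps power2_eq_square)
  then show ?case
    by (simp only: Suc.IH power_Suc)
qed simp

text \<open>Polarisation: the squares differ by \<open>4 * Re (a * cnj b)\<close>. This is the
  scalar Cayley correspondence without division: \<open>a / b\<close> in the right half plane puts
  \<open>(a - b) / (a + b)\<close> in the unit disc.\<close>

lemma cmod_diff_less_cmod_add: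
  assumes "Re (a * cnj b) > 0"
  shows "cmod (a - b) < cmod (a + b)"
proof (rule power2_less_imp_less)
  show "(cmod (a - b))\<^sup>2 < (cmod (a + b))\<^sup>2"
    unfolding cmod_power2 using assms by (simp add: power2_eq_square algebra_simps)
qed simp

text \<open>Cleared of the denominator: \<open>s (P + M) / (P - M)\<close> stays in the right half
  plane if \<open>s\<close> lies in the sector given by \<open>c\<close> and \<open>M / P\<close> is
  small. The error \<open>w\<close> is purely imaginary, twice the imaginary part of
  \<open>P cnj M\<close>. The bound \<open>c / 4\<close> is a convenient choice: it gives
  \<open>\<rho>^2 \<le> 1/16\<close> and \<open>2 \<rho> < c / 2\<close>, well below
  \<open>c (1 - \<rho>^2)\<close>.\<close>

lemma Re_perturbed_pos:
  fixes s P M :: complex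
  assumes c: "0 < c" "c \<le> 1" "c * cmod s \<le> Re s" and "s \<noteq> 0" "P \<noteq> 0"
    and \<rho>: "0 \<le> \<rho>" "\<rho> < c / 4" "cmod M \<le> \<rho> * cmod P"
  shows "Re (s * ((P + M) * cnj (P - M))) > 0"
proof -
  define w where "w = P * cnj M - M * cnj P"
  define D where "D = (cmod P)\<^sup>2 - (cmod M)\<^sup>2"
  have N: "(P + M) * cnj (P - M) = of_real D - w"
    unfolding D_def w_def of_real_diff complex_norm_square by (simp add: algebra_simps)
  have eq: "Re (s * ((P + M) * cnj (P - M))) = D * Re s - Re (s * w)"
    unfolding N by (simp add: algebra_simps)
  have "cmod M * cmod P \<le> \<rho> * (cmod P)\<^sup>2"
    using mult_right_mono[OF \<rho>(3), of "cmod P"] by (simp add: power2_eq_square mult_ac)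
  moreover have "cmod w \<le> 2 * (cmod M * cmod P)"
    unfolding w_def using norm_triangle_ineq4[of "P * cnj M" "M * cnj P"] by (simp add: norm_mult mult_ac)
  ultimately have w: "cmod w \<le> 2 * \<rho> * (cmod P)\<^sup>2"
    by linarith
  have "(cmod M)\<^sup>2 \<le> (\<rho> * cmod P)\<^sup>2"
    using \<rho>(3) by (intro power_mono) auto
  then have D: "D \<ge> (1 - \<rho>\<^sup>2) * (cmod P)\<^sup>2"
    by (simp add: D_def power_mult_distrib algebra_simps)
  have \<rho>2: "\<rho>\<^sup>2 \<le> 1 / 16"
    using power_mono[of \<rho> "1/4" 2] \<rho> c by (simp add: power2_eq_square)
  have "2 * \<rho> < c * (1 - \<rho>\<^sup>2)"
  proof -
    have "c * (15 / 16) \<le> c * (1 - \<rho>\<^sup>2)"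
      using \<rho>2 c by (intro mult_left_mono) auto
    then show ?thesis
      using \<rho>(2) c(1) by linarith
  qed
  then have "(2 * \<rho>) * ((cmod P)\<^sup>2 * cmod s) < (c * (1 - \<rho>\<^sup>2)) * ((cmod P)\<^sup>2 * cmod s)"
    using assms(4,5) by (intro mult_strict_right_mono) auto
  moreover have "Re (s * w) \<le> cmod s * (2 * \<rho> * (cmod P)\<^sup>2)"
    using complex_Re_le_cmod[of "s * w"] mult_left_mono[OF w, of "cmod s"] by (simp add: norm_mult)
  moreover have "((1 - \<rho>\<^sup>2) * (cmod P)\<^sup>2) * (c * cmod s) \<le> D * Re s"
    using D c \<rho>2 by (intro mult_mono) (auto intro: order_trans[of _ "(1 - \<rho>\<^sup>2) * (cmod P)\<^sup>2"])
  ultimately show ?thesis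
    unfolding eq by (simp add: mult_ac)
qed

lemma Re_csqrt_pos:
  assumes "z \<notin> \<real>\<^sub>\<le>\<^sub>0"
  shows "Re (csqrt z) > 0"
proof (rule ccontr)
  assume "\<not> Re (csqrt z) > 0"
  then have "Re (csqrt z) = 0"
    using csqrt_principal[of z] by auto
  then have "(csqrt z)\<^sup>2 = of_real (- (Im (csqrt z))\<^sup>2)"
    by (simp add: complex_eq_iff power2_eq_square)
  then have "z = of_real (- (Im (csqrt z))\<^sup>2)"
    by simp
  then have "z \<in> \<real>\<^sub>\<le>\<^sub>0"
    by (metis neg_le_0_iff_le nonpos_Reals_of_real_iff zero_le_power2)
  with assms show False
    by blast
qed

text \<open>The two signs of the root give \<open>2 e = P + M\<close> and
  \<open>2 s d = P - M\<close>. So \<open>e / d = s (P + M) / (P - M)\<close>, and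
  \<open>\<mu> d / e\<close> is the same with \<open>- M\<close> for \<open>M\<close>; one
  perturbation bound covers both.\<close>

lemma binom_poly_separation:
  assumes c: "0 < c" "c \<le> 1" "c * cmod (csqrt \<mu>) \<le> Re (csqrt \<mu>)" and \<mu>: "\<mu> \<notin> \<real>\<^sub>\<le>\<^sub>0"
    and q: "0 \<le> q" "cmod (1 - csqrt \<mu>) \<le> q * cmod (1 + csqrt \<mu>)" "q ^ m < c / 4"
  defines "e \<equiv> poly (fst (binom_poly m)) \<mu>" and "d \<equiv> poly (snd (binom_poly m)) \<mu>"
  shows "cmod (e - d) < cmod (e + d)" "cmod (\<mu> * d - e) < cmod (\<mu> * d + e)"
proof -
  define s where "s = csqrt \<mu>"
  define P M where "P = (1 + s) ^ m" and "M = (1 - s) ^ m"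
  have s: "s\<^sup>2 = \<mu>" "Re s > 0" "s \<noteq> 0"
    using Re_csqrt_pos[OF \<mu>] by (auto simp: s_def)
  have "1 + s \<noteq> 0"
    using s(2) by (auto simp: complex_eq_iff)
  then have P0: "P \<noteq> 0"
    by (simp add: P_def)
  have "cmod M \<le> (q * cmod (1 + s)) ^ m"
    unfolding M_def norm_power using q(2) by (intro power_mono) (auto simp: s_def)
  then have M: "cmod M \<le> q ^ m * cmod P"
    by (simp add: P_def norm_power power_mult_distrib)
  have pm: "e + s * d = P" "e - s * d = M"
    using binom_poly_eq[of s \<mu> m] binom_poly_eq[of "- s" \<mu> m] s(1)
    by (simp_all add: P_def M_def e_def d_def)
  then have PM: "P + M = 2 * e" "P - M = 2 * (s * d)"
    by auto
  note pert = Re_perturbed_pos[OF c(1,2) c(3)[folded s_def] s(3) P0 zero_le_power[OF q(1)] q(3)]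
  have Re_scale: "Re (of_real r * x) = r * Re x" for r x
    by simp
  have "Re (s * ((P + M) * cnj (P - M))) > 0"
    by (rule pert) (rule M)
  also have "s * ((P + M) * cnj (P - M)) = of_real (4 * (cmod s)\<^sup>2) * (e * cnj d)"
    unfolding PM of_real_mult complex_norm_square by simp
  finally have "4 * (cmod s)\<^sup>2 * Re (e * cnj d) > 0"
    by (simp only: Re_scale)
  then show "cmod (e - d) < cmod (e + d)"
    using s(3) by (intro cmod_diff_less_cmod_add) (simp add: zero_less_mult_iff)
  have "Re (s * ((P + (- M)) * cnj (P - (- M)))) > 0"
    by (rule pert) (simp add: M)
  also have "s * ((P + (- M)) * cnj (P - (- M))) = of_real 4 * (\<mu> * d * cnj e)"
    using PM s(1) by (simp add: power2_eq_square)
  finally show "cmod (\<mu> * d - e) < cmod (\<mu> * d + e)"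
    by (intro cmod_diff_less_cmod_add) (simp only: Re_scale zero_less_mult_iff, simp)
qed

lemma continuous_on_herm [continuous_intros]:
  "continuous_on S f \<Longrightarrow> continuous_on S g \<Longrightarrow> continuous_on S (\<lambda>x. herm (f x) (g x))"
  unfolding herm_def by (intro continuous_intros)

text \<open>Instead of continuity of eigenvalues in \<open>z\<close>, compactness is applied to the
  set \<open>C\<close> of pairs of a point and a unit eigenvector, where the eigenvalue is the
  continuous Rayleigh quotient \<open>ev\<close>. On \<open>C\<close> the root \<open>s\<close>
  stays in a closed sector and \<open>(1 - s) / (1 + s)\<close> in a smaller disc, so one
  \<open>m\<close> serves all points.\<close>

lemma A_cut_binom_separation:
  fixes A :: "real poly fract ^ 'n ^ 'n"
  assumes "A \<in> A_cut"
  obtains m where "m > 0" "\<And>z \<mu>. cmod z \<le> 1 \<Longrightarrow> \<mu> \<in> spectrum (mat_eval A z) \<Longrightarrow>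
      cmod (poly (fst (binom_poly m)) \<mu> - poly (snd (binom_poly m)) \<mu>)
        < cmod (poly (fst (binom_poly m)) \<mu> + poly (snd (binom_poly m)) \<mu>) \<and>
      cmod (\<mu> * poly (snd (binom_poly m)) \<mu> - poly (fst (binom_poly m)) \<mu>)
        < cmod (\<mu> * poly (snd (binom_poly m)) \<mu> + poly (fst (binom_poly m)) \<mu>)"
proof -
  have A: "A \<in> ratH_mat" and cut: "\<And>z \<mu>. cmod z \<le> 1 \<Longrightarrow> \<mu> \<in> spectrum (mat_eval A z) \<Longrightarrow> \<mu> \<notin> \<real>\<^sub>\<le>\<^sub>0"
    using assms by (auto simp: A_cut_def)
  define K where "K = cball (0::complex) 1 \<times> sphere (0 :: complex ^ 'n) 1"
  define Ax where "Ax p = mat_eval A (fst p) *v snd p" for p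
  define ev where "ev p = herm (snd p) (Ax p)" for p
  define C where "C = K \<inter> {p \<in> K. Ax p - (\<chi> i. ev p * snd p $ i) = 0}"
  have "compact K"
    unfolding K_def by (intro compact_Times compact_cball compact_sphere)
  have contAx: "continuous_on K Ax"
    unfolding Ax_def by (intro continuous_on_mat_eval_mult continuous_intros A) (auto simp: K_def)
  then have contev: "continuous_on K ev"
    unfolding ev_def by (intro continuous_intros)
  have "closed {p \<in> K. Ax p - (\<chi> i. ev p * snd p $ i) = 0}"
    by (intro continuous_closed_preimage_constant continuous_intros contAx contev compact_imp_closed \<open>compact K\<close>)
  then have "compact C"
    unfolding C_def using \<open>compact K\<close> by (intro compact_Int_closed)
  have Cev: "ev p \<notin> \<real>\<^sub>\<le>\<^sub>0" if "p \<in> C" for p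
  proof (rule cut[of "fst p"])
    show "cmod (fst p) \<le> 1"
      using that by (auto simp: C_def K_def)
    have "snd p \<noteq> 0"
      using that by (auto simp: C_def K_def)
    moreover have "mat_eval A (fst p) *v snd p = ev p *s snd p"
      using that by (auto simp: C_def Ax_def vec_eq_iff)
    ultimately show "ev p \<in> spectrum (mat_eval A (fst p))"
      unfolding spectrum_def by blast
  qed
  have evC: "\<exists>p\<in>C. ev p = \<mu>" if z: "cmod z \<le> 1" and \<mu>: "\<mu> \<in> spectrum (mat_eval A z)" for z \<mu>
  proof -
    obtain v where v: "v \<noteq> 0" "mat_eval A z *v v = \<mu> *s v"
      using \<mu> by (auto simp: spectrum_def)
    define x where "x = of_real (1 / norm v) *s v"
    have "x = v /\<^sub>R norm v"
      by (simp add: x_def vec_eq_iff) (simp add: scaleR_conv_of_real divide_inverse)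
    then have nx: "norm x = 1"
      using v(1) by simp
    have Axx: "Ax (z, x) = \<mu> *s x"
      by (simp add: Ax_def x_def vector_scalar_commute v(2) vector_smult_assoc mult.commute)
    then have ev: "ev (z, x) = \<mu>"
      by (simp add: ev_def herm_scale_right herm_self nx)
    have "(z, x) \<in> C"
      using z nx by (simp add: C_def K_def Axx ev vec_eq_iff)
    with ev show ?thesis
      by blast
  qed
  show ?thesis
  proof (cases "C = {}")
    case True
    then show ?thesis
      using evC by (intro that[of 1]) auto
  next
    case False
    define s where "s p = csqrt (ev p)" for p
    have conts: "continuous_on C s"
      unfolding s_def
      by (rule continuous_on_compose2[OF continuous_on_csqrt continuous_on_subset[OF contev]])
        (use Cev in \<open>auto simp: C_def\<close>)
    have Re_s: "Re (s p) > 0" if "p \<in> C" for p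
      unfolding s_def by (intro Re_csqrt_pos Cev that)
    have s0: "s p \<noteq> 0" "1 + s p \<noteq> 0" if "p \<in> C" for p
      using Re_s[OF that] by (auto simp: complex_eq_iff)
    have "continuous_on C (\<lambda>p. Re (s p) / cmod (s p))"
      by (intro continuous_intros conts) (use s0 in auto)
    then obtain p1 where p1: "p1 \<in> C" "\<forall>p\<in>C. Re (s p1) / cmod (s p1) \<le> Re (s p) / cmod (s p)"
      using continuous_attains_inf[OF \<open>compact C\<close> False] by blast
    have "continuous_on C (\<lambda>p. cmod (1 - s p) / cmod (1 + s p))"
      by (intro continuous_intros conts) (use s0 in auto)
    then obtain p2 where p2: "p2 \<in> C" "\<forall>p\<in>C. cmod (1 - s p) / cmod (1 + s p) \<le> cmod (1 - s p2) / cmod (1 + s p2)"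
      using continuous_attains_sup[OF \<open>compact C\<close> False] by blast
    define c where "c = Re (s p1) / cmod (s p1)"
    define q where "q = cmod (1 - s p2) / cmod (1 + s p2)"
    have c: "0 < c" "c \<le> 1"
      using Re_s[OF p1(1)] s0[OF p1(1)] complex_Re_le_cmod[of "s p1"] by (auto simp: c_def)
    have "cmod (1 - s p2) < cmod (1 + s p2)"
      by (rule cmod_diff_less_cmod_add) (simp add: Re_s p2(1))
    then have q: "0 \<le> q" "q < 1"
      using s0(2)[OF p2(1)] by (auto simp: q_def)
    obtain m where m: "q ^ m < c / 4"
      using real_arch_pow_inv[of "c / 4" q] c q by auto
    show ?thesis
    proof (rule that[of m])
      \<comment> \<open>\<open>q ^ 0 = 1\<close> is not below \<open>c / 4\<close>. Positivity of
        \<open>m\<close> will make \<open>(1 - s) ^ m\<close> vanish at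
        \<open>s = 1\<close>.\<close>
      show "m > 0"
        using m c by (cases m) auto
      fix z \<mu> assume "cmod z \<le> 1" "\<mu> \<in> spectrum (mat_eval A z)"
      then obtain p where p: "p \<in> C" "ev p = \<mu>"
        using evC by blast
      have \<mu>: "\<mu> \<notin> \<real>\<^sub>\<le>\<^sub>0"
        using Cev[OF p(1)] p(2) by simp
      have "c \<le> Re (s p) / cmod (s p)" "cmod (1 - s p) / cmod (1 + s p) \<le> q"
        using p1(2) p2(2) p(1) by (auto simp: c_def q_def)
      then have "c * cmod (csqrt \<mu>) \<le> Re (csqrt \<mu>)" "cmod (1 - csqrt \<mu>) \<le> q * cmod (1 + csqrt \<mu>)"
        using s0[OF p(1)] by (auto simp: s_def p(2) field_simps)
      then show "cmod (poly (fst (binom_poly m)) \<mu> - poly (snd (binom_poly m)) \<mu>)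
          < cmod (poly (fst (binom_poly m)) \<mu> + poly (snd (binom_poly m)) \<mu>) \<and>
        cmod (\<mu> * poly (snd (binom_poly m)) \<mu> - poly (fst (binom_poly m)) \<mu>)
          < cmod (\<mu> * poly (snd (binom_poly m)) \<mu> + poly (fst (binom_poly m)) \<mu>)"
        using binom_poly_separation[OF c _ \<mu> q(1) _ m] by blast
    qed
  qed
qed

section \<open>Powers of a matrix with spectrum in the unit disc\<close>

primrec mat_power :: "'a::semiring_1 ^ 'n ^ 'n \<Rightarrow> nat \<Rightarrow> 'a ^ 'n ^ 'n" where
  "mat_power M 0 = mat 1"
| "mat_power M (Suc k) = M ** mat_power M k"

lemma mat_power_add: "mat_power M (j + k) = mat_power M j ** mat_power M k"
  by (induction j) (auto simp: matrix_mul_assoc)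

lemma mat_power_mult: "mat_power M (j * k) = mat_power (mat_power M j) k"
  by (induction k) (auto simp: mat_power_add)

lemma mat_power_Suc_right: "mat_power M (Suc k) = mat_power M k ** M"
  using mat_power_add[of M k 1] by simp

text \<open>A submultiplicative bound for the operator norm, visibly continuous in the entries. At
  the identity it equals the dimension, which is why exponent 0 is excluded below.\<close>

definition entry_sum :: "complex ^ 'n ^ 'm \<Rightarrow> real" where
  "entry_sum M = (\<Sum>i\<in>UNIV. \<Sum>j\<in>UNIV. cmod (M $ i $ j))"

lemma entry_sum_nonneg: "entry_sum M \<ge> 0"
  by (simp add: entry_sum_def sum_nonneg)

lemma norm_mult_vec_le_entry_sum: "norm (M *v x) \<le> entry_sum M * norm x"
  unfolding entry_sum_def by (rule norm_matrix_vector_mult_le)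

lemma entry_sum_mult: "entry_sum (M ** N) \<le> entry_sum M * entry_sum N"
  for M :: "complex ^ 'n ^ 'm" and N :: "complex ^ 'k ^ 'n"
proof -
  have "entry_sum (M ** N) \<le> (\<Sum>i\<in>UNIV. \<Sum>j\<in>UNIV. \<Sum>k\<in>UNIV. cmod (M $ i $ k) * cmod (N $ k $ j))"
    unfolding entry_sum_def matrix_matrix_mult_def
    by (intro sum_mono) (simp add: sum_norm_le norm_mult)
  also have "\<dots> = (\<Sum>i\<in>UNIV. \<Sum>k\<in>UNIV. cmod (M $ i $ k) * (\<Sum>j\<in>UNIV. cmod (N $ k $ j)))"
    unfolding sum_distrib_left by (intro sum.cong refl sum.swap)
  also have "\<dots> \<le> (\<Sum>i\<in>UNIV. \<Sum>k\<in>UNIV. cmod (M $ i $ k) * entry_sum N)"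
  proof (intro sum_mono mult_left_mono)
    show "(\<Sum>j\<in>UNIV. cmod (N $ k $ j)) \<le> entry_sum N" for k
      unfolding entry_sum_def by (rule member_le_sum) (auto intro: sum_nonneg)
  qed auto
  also have "\<dots> = entry_sum M * entry_sum N"
    by (simp add: entry_sum_def[of M] sum_distrib_right)
  finally show ?thesis .
qed

lemma entry_sum_mat_power_less_1:
  assumes "entry_sum M < 1" "0 < k"
  shows "entry_sum (mat_power M k) < 1"
  using assms(2)
proof (induction k)
  case (Suc k)
  show ?case
  proof (cases "k = 0")
    case False
    have "entry_sum (mat_power M (Suc k)) \<le> entry_sum M * entry_sum (mat_power M k)"
      by (simp add: entry_sum_mult)
    also have "\<dots> \<le> entry_sum M * 1"
      using Suc.IH False by (intro mult_left_mono) (auto simp: entry_sum_nonneg)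
    finally show ?thesis
      using assms(1) by simp
  qed (use assms(1) in simp)
qed simp

lemma analytic_on_det:
  assumes "\<And>a b. (\<lambda>w. M w $ a $ b) analytic_on S"
  shows "(\<lambda>w. det (M w)) analytic_on S"
  unfolding det_def by (intro analytic_intros assms)

text \<open>By compactness \<open>f\<close> is holomorphic on a ball of radius greater than 1, so
  its power series converges at 1, where its terms are the coefficients.\<close>

lemma analytic_on_cball_coeffs_tendsto_0:
  assumes "f analytic_on cball 0 1"
  shows "(\<lambda>n. fps_nth (fps_expansion f 0) n) \<longlonglongrightarrow> 0"
proof -
  obtain T where T: "open T" "cball 0 1 \<subseteq> T" "f holomorphic_on T"
    using assms unfolding analytic_on_holomorphic by blast
  obtain e where e: "e > 0" "(\<Union>x\<in>cball 0 1. ball x e) \<subseteq> T"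
    using compact_subset_open_imp_ball_epsilon_subset[OF compact_cball T(1,2)] by blast
  have scale: "\<bar>inverse r - 1\<bar> * r = r - 1" if "r > 1" for r :: real
    using that by (simp add: abs_if field_simps)
  have "ball 0 (1 + e) \<subseteq> T"
  proof
    fix w :: complex assume w: "w \<in> ball 0 (1 + e)"
    show "w \<in> T"
    proof (cases "cmod w \<le> 1")
      case False
      then have "w \<in> ball (w /\<^sub>R cmod w) e"
      proof -
        have "w /\<^sub>R cmod w - w = (inverse (cmod w) - 1) *\<^sub>R w"
          by (simp add: algebra_simps)
        then have "norm (w /\<^sub>R cmod w - w) = \<bar>inverse (cmod w) - 1\<bar> * cmod w"
          by (simp only: norm_scaleR)
        also have "\<dots> = cmod w - 1"
          using scale[of "cmod w"] False by simp
        finally show ?thesis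
          using w by (simp add: dist_norm)
      qed
      moreover have "w \<noteq> 0"
        using False by auto
      then have "w /\<^sub>R cmod w \<in> cball 0 1"
        by simp
      ultimately show ?thesis
        using e(2) by blast
    qed (use T in auto)
  qed
  then have "f holomorphic_on ball 0 (1 + e)"
    using T(3) holomorphic_on_subset by blast
  then have "(\<lambda>n. (deriv ^^ n) f 0 / fact n * (1 - 0) ^ n) sums f 1"
    by (rule holomorphic_power_series) (use e in simp)
  then have "summable (\<lambda>n. (deriv ^^ n) f 0 / fact n)"
    by (simp add: sums_iff)
  then have "(\<lambda>n. (deriv ^^ n) f 0 / fact n) \<longlonglongrightarrow> 0"
    by (rule summable_LIMSEQ_zero)
  then show ?thesis
    by (simp add: fps_expansion_def)
qed

text \<open>The entries of \<open>(1 - w X)\<^sup>-\<^sup>1 v\<close> are analytic in \<open>w\<close> on the closed disc, and their Taylor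
  coefficients are the entries of \<open>X\<^sup>k v\<close>.\<close>

lemma mat_power_tendsto_0:
  fixes X :: "complex ^ 'n ^ 'n"
  assumes spec: "\<And>\<mu>. \<mu> \<in> spectrum X \<Longrightarrow> cmod \<mu> < 1"
  shows "(\<lambda>k. (mat_power X k *v v) $ i) \<longlonglongrightarrow> 0"
proof -
  \<comment> \<open>\<open>B w\<close> is \<open>1 - w X\<close>, and \<open>f v w\<close> is
    Cramer's expression for coordinate \<open>i\<close> of the solution \<open>y\<close> of
    \<open>B w *v y = v\<close>. A kernel vector of \<open>B w\<close> would make
    \<open>1 / w\<close>, of modulus at least 1, an eigenvalue of \<open>X\<close>.\<close>
  define B where "B w = (\<chi> a b. (if a = b then 1 else 0) - w * X $ a $ b)" for w
  define f where "f v w = det (\<chi> a b. if b = i then v $ a else B w $ a $ b) / det (B w)" for v w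
  have Bx: "B w *v x = x - w *s (X *v x)" for w x
    by (simp add: vec_eq_iff B_def matrix_vector_mult_def left_diff_distrib sum_subtractf
        sum_distrib_left mult.assoc if_distrib[of "\<lambda>x. x * _"] cong: if_cong)
  have inv: "invertible (B w)" if w: "cmod w \<le> 1" for w
  proof (rule invertible_if_ker_trivial, rule ccontr)
    fix x assume x: "B w *v x = 0" "x \<noteq> 0"
    then have wX: "w *s (X *v x) = x"
      by (simp add: Bx)
    then have "w \<noteq> 0"
      using x(2) by auto
    then have "X *v x = (1 / w) *s x"
      by (subst wX[symmetric]) (simp add: vector_smult_assoc)
    then have "1 / w \<in> spectrum X"
      using x(2) unfolding spectrum_def by blast
    then have "cmod (1 / w) < 1"
      by (rule spec)
    then show False
      using w \<open>w \<noteq> 0\<close> by (simp add: norm_divide field_simps)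
  qed
  have f_eq: "f v w = y $ i" if "cmod w \<le> 1" "B w *v y = v" for v w y
    using that inv[of w] by (subst (asm) cramer) (auto simp: f_def invertible_det_nz)
  have an: "f v analytic_on cball 0 1" for v
    unfolding f_def
  proof (intro analytic_intros analytic_on_det)
    show "(\<lambda>w. B w $ a $ b) analytic_on cball 0 1" for a b
      unfolding B_def by (auto intro!: analytic_intros)
    then show "(\<lambda>w. (\<chi> a b. if b = i then v $ a else B w $ a $ b) $ a $ b) analytic_on cball 0 1" for a b
      by (cases "b = i") (auto intro!: analytic_intros)
    show "det (B w) \<noteq> 0" if "w \<in> cball 0 1" for w
      using inv[of w] that by (simp add: invertible_det_nz)
  qed
  define F where "F v = fps_expansion (f v) 0" for v
  have F: "f v has_fps_expansion F v" for v
    unfolding F_def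
    by (rule analytic_at_imp_has_fps_expansion_0) (rule analytic_on_subset[OF an], simp)
  \<comment> \<open>Resolvent recursion: the solution for \<open>v\<close> is \<open>v\<close> plus
    \<open>w\<close> times the solution for \<open>X *v v\<close>. On Taylor series this is a shift,
    so coefficient \<open>k\<close> for \<open>v\<close> is coefficient 0 for
    \<open>X^k v\<close>.\<close>
  have feq: "f v w = v $ i + w * f (X *v v) w" if w: "cmod w \<le> 1" for v w
  proof -
    define y where "y = matrix_inv (B w) *v (X *v v)"
    have y: "B w *v y = X *v v"
      using inv[OF w] by (simp add: y_def matrix_vector_mul_assoc matrix_mul_assoc matrix_inv_right_mult)
    have "B w *v (v + w *s y) = v"
      by (simp add: matrix_vector_right_distrib vector_scalar_commute y) (simp add: Bx)
    from f_eq[OF w this] f_eq[OF w y] show ?thesis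
      by simp
  qed
  have F_eq: "F v = fps_const (v $ i) + fps_X * F (X *v v)" for v
  proof (rule fps_expansion_unique_complex[OF F])
    have "(\<lambda>w. v $ i + w * f (X *v v) w) has_fps_expansion fps_const (v $ i) + fps_X * F (X *v v)"
      by (intro fps_expansion_intros F)
    moreover have "eventually (\<lambda>w. w \<in> ball 0 1) (nhds (0::complex))"
      by (rule eventually_nhds_in_open) simp_all
    then have "eventually (\<lambda>w. v $ i + w * f (X *v v) w = f v w) (nhds 0)"
    proof (rule eventually_mono)
      fix w :: complex assume "w \<in> ball 0 1"
      then show "v $ i + w * f (X *v v) w = f v w"
        using feq[of w v] by simp
    qed
    ultimately show "f v has_fps_expansion fps_const (v $ i) + fps_X * F (X *v v)"
      using has_fps_expansion_cong[of "\<lambda>w. v $ i + w * f (X *v v) w" "f v", OF _ refl] by blast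
  qed
  have "fps_nth (F v) k = (mat_power X k *v v) $ i" for k
  proof (induction k arbitrary: v)
    case 0
    show ?case
      by (subst F_eq) simp
  next
    case (Suc k)
    show ?case
      by (subst F_eq) (simp add: Suc.IH mat_power_Suc_right matrix_vector_mul_assoc del: mat_power.simps)
  qed
  then show ?thesis
    using analytic_on_cball_coeffs_tendsto_0[OF an, of v] by (simp add: F_def)
qed

lemma entry_sum_power_less_1:
  fixes X :: "complex ^ 'n ^ 'n"
  assumes spec: "\<And>\<mu>. \<mu> \<in> spectrum X \<Longrightarrow> cmod \<mu> < 1"
  shows "\<exists>k>0. entry_sum (mat_power X k) < 1"
proof -
  have "mat_power X k $ i $ j = (mat_power X k *v axis j 1) $ i" for i j k
    by (simp add: matrix_vector_mult_def axis_def if_distrib[of "\<lambda>x. _ * x"] cong: if_cong)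
  then have entry: "(\<lambda>k. mat_power X k $ i $ j) \<longlonglongrightarrow> 0" for i j
    using mat_power_tendsto_0[OF spec] by simp
  have "(\<lambda>k. entry_sum (mat_power X k)) \<longlonglongrightarrow> (\<Sum>i\<in>(UNIV::'n set). \<Sum>j\<in>(UNIV::'n set). cmod 0)"
    unfolding entry_sum_def by (rule tendsto_sum, rule tendsto_sum, rule tendsto_norm, rule entry)
  then have "eventually (\<lambda>k. entry_sum (mat_power X k) < 1) sequentially"
    by (intro order_tendstoD(2)) auto
  then have "eventually (\<lambda>k. 0 < k \<and> entry_sum (mat_power X k) < 1) sequentially"
    using eventually_gt_at_top[of 0] by eventually_elim auto
  then show ?thesis
    using eventually_happens[of _ sequentially] by auto
qed

lemma continuous_on_mat_power:
  fixes W :: "'z::topological_space \<Rightarrow> complex ^ 'n ^ 'n"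
  assumes "\<And>i j. continuous_on S (\<lambda>z. W z $ i $ j)"
  shows "continuous_on S (\<lambda>z. mat_power (W z) k $ i $ j)"
proof (induction k arbitrary: i j)
  case 0
  show ?case
    by (simp add: mat_def)
next
  case (Suc k)
  show ?case
    by (simp add: matrix_matrix_mult_def) (intro continuous_on_sum continuous_on_mult assms Suc.IH)
qed

text \<open>Each point has its own exponent, valid in a neighbourhood; finitely many suffice, and
  their product is a common multiple. Allowing all multiples \<open>K * j\<close> makes it possible
  to find one exponent for two families.\<close>

lemma uniform_power_less_1:
  fixes W :: "'z::topological_space \<Rightarrow> complex ^ 'n ^ 'n"
  assumes cont: "\<And>i j. continuous_on S (\<lambda>z. W z $ i $ j)" and S: "compact S"
    and spec: "\<And>z \<mu>. z \<in> S \<Longrightarrow> \<mu> \<in> spectrum (W z) \<Longrightarrow> cmod \<mu> < 1"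
  shows "\<exists>K>0. \<forall>z\<in>S. \<forall>j>0. entry_sum (mat_power (W z) (K * j)) < 1"
proof -
  have "continuous_on S (\<lambda>z. entry_sum (mat_power (W z) k))" for k
    unfolding entry_sum_def by (intro continuous_on_sum continuous_on_norm continuous_on_mat_power cont)
  then have "\<exists>U. open U \<and> U \<inter> S = (\<lambda>z. entry_sum (mat_power (W z) k)) -` {..<1} \<inter> S" for k
    unfolding continuous_on_open_invariant by (meson open_lessThan)
  then obtain U where U: "\<And>k. open (U k)" "\<And>k. U k \<inter> S = (\<lambda>z. entry_sum (mat_power (W z) k)) -` {..<1} \<inter> S"
    by metis
  have cover: "S \<subseteq> (\<Union>k\<in>{0<..}. U k)"
  proof
    fix z assume z: "z \<in> S"
    have "\<exists>k>0. entry_sum (mat_power (W z) k) < 1"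
      by (rule entry_sum_power_less_1) (rule spec[OF z])
    then obtain k where "k > 0" "entry_sum (mat_power (W z) k) < 1"
      by blast
    then show "z \<in> (\<Union>k\<in>{0<..}. U k)"
      using U(2)[of k] z by auto
  qed
  have "\<exists>D\<subseteq>{0<..}. finite D \<and> S \<subseteq> (\<Union>k\<in>D. U k)"
    by (rule compactE_image[OF S _ cover]) (use U(1) in auto)
  then obtain D where D: "D \<subseteq> {0<..}" "finite D" "S \<subseteq> (\<Union>k\<in>D. U k)"
    by blast
  show ?thesis
  proof (rule exI[of _ "\<Prod>D"], intro conjI ballI allI impI)
    show K0: "\<Prod>D > 0"
      using D(1) by (intro prod_pos) auto
    fix z and j :: nat assume z: "z \<in> S" and j: "j > 0"
    then obtain k where k: "k \<in> D" "z \<in> U k"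
      using D(3) by blast
    then have less: "entry_sum (mat_power (W z) k) < 1"
      using U(2)[of k] z by auto
    have "k dvd \<Prod>D * j"
      using k(1) D(2) by (intro dvd_mult2 dvd_prodI[of D _ "\<lambda>x. x", simplified])
    then obtain l where l: "\<Prod>D * j = k * l"
      by (elim dvdE)
    then have "l > 0"
      using K0 j by (metis mult_0_right nat_0_less_mult_iff)
    then show "entry_sum (mat_power (W z) (\<Prod>D * j)) < 1"
      unfolding l mat_power_mult by (rule entry_sum_mat_power_less_1[OF less])
  qed
qed

section \<open>Spectral factors over the ring\<close>

lemma ratH_common_denominator:
  assumes "finite S" "S \<subseteq> ratH"
  shows "\<exists>d num. (\<forall>z. cmod z \<le> 1 \<longrightarrow> cpoly d z \<noteq> 0) \<and>
    (\<forall>f\<in>S. \<forall>z. cmod z \<le> 1 \<longrightarrow> cpoly (num f) z = cpoly d z * rat_eval f z)"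
  using assms
proof (induction S)
  case empty
  show ?case
    by (rule exI[of _ 1]) simp
next
  case (insert f S)
  then obtain d num where d: "\<forall>z. cmod z \<le> 1 \<longrightarrow> cpoly d z \<noteq> 0"
    "\<forall>g\<in>S. \<forall>z. cmod z \<le> 1 \<longrightarrow> cpoly (num g) z = cpoly d z * rat_eval g z"
    by auto
  have "f \<in> ratH"
    using insert.prems by simp
  then obtain p q where f: "f = Fraction_Field.Fract p q" and q: "\<forall>z. cmod z \<le> 1 \<longrightarrow> cpoly q z \<noteq> 0"
    unfolding ratH_iff_Fract by (elim exE conjE)
  define num' where "num' g = (if g = f then p * d else num g * q)" for g
  show ?case
  proof (rule exI[of _ "d * q"], rule exI[of _ num'], intro conjI ballI allI impI)
    show "cpoly (d * q) z \<noteq> 0" if "cmod z \<le> 1" for z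
      using d(1) q that by simp
    show "cpoly (num' g) z = cpoly (d * q) z * rat_eval g z" if "g \<in> insert f S" "cmod z \<le> 1" for g z
    proof (cases "g = f")
      case True
      then show ?thesis
        using q that(2) by (simp add: num'_def f rat_eval_Fract_cpoly)
    next
      case False
      then show ?thesis
        using d(2) that by (simp add: num'_def)
    qed
  qed
qed

text \<open>Telescoping: replacing \<open>a\<close> by \<open>X a\<close> in the sum exchanges the terms with \<open>j = 0\<close>
  for the smaller ones with \<open>j = K\<close>.\<close>

lemma commuting_powers_contraction:
  fixes X Z :: "complex ^ 'n ^ 'n"
  assumes comm: "X ** Z = Z ** X" and K: "entry_sum (mat_power X K) < 1" and "0 < K" and a: "a \<noteq> 0"
  shows "(\<Sum>j<K. \<Sum>k<K. (norm (mat_power X j *v (mat_power Z k *v (X *v a))))\<^sup>2) <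
    (\<Sum>j<K. \<Sum>k<K. (norm (mat_power X j *v (mat_power Z k *v a)))\<^sup>2)"
proof -
  define n where "n j k = (norm (mat_power X j *v (mat_power Z k *v a)))\<^sup>2" for j k
  have "X ** mat_power Z k = mat_power Z k ** X" for k
    by (induction k) (auto simp: matrix_mul_assoc comm, metis comm matrix_mul_assoc)
  then have "mat_power X j *v (mat_power Z k *v (X *v a)) = mat_power X (Suc j) *v (mat_power Z k *v a)" for j k
    by (metis mat_power_Suc_right matrix_vector_mul_assoc)
  then have "(\<Sum>j<K. \<Sum>k<K. (norm (mat_power X j *v (mat_power Z k *v (X *v a))))\<^sup>2) - (\<Sum>j<K. \<Sum>k<K. n j k)
      = (\<Sum>k<K. \<Sum>j<K. n (Suc j) k - n j k)"
    unfolding sum_subtractf[symmetric] n_def by (subst sum.swap) simp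
  also have "\<dots> = (\<Sum>k<K. n K k - n 0 k)"
    by (intro sum.cong refl) (rule sum_lessThan_telescope)
  also have "\<dots> < 0"
  proof -
    have le: "norm (mat_power X K *v x) \<le> norm x" for x
      using norm_mult_vec_le_entry_sum[of "mat_power X K" x] K
        mult_right_mono[of "entry_sum (mat_power X K)" 1 "norm x"] by simp
    have "norm (mat_power X K *v a) \<le> entry_sum (mat_power X K) * norm a"
      by (rule norm_mult_vec_le_entry_sum)
    also have "\<dots> < norm a"
      using K a by simp
    finally have "n K 0 - n 0 0 < 0"
      by (simp add: n_def power_strict_mono)
    moreover have "n K k - n 0 k \<le> 0" for k
      using le by (simp add: n_def power_mono)
    ultimately have "(\<Sum>k<K. n K k - n 0 k) < (\<Sum>k<K. 0)"
      using \<open>0 < K\<close> by (intro sum_strict_mono_ex1) auto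
    then show ?thesis
      by simp
  qed
  finally show ?thesis
    by (simp add: n_def)
qed

lemma power2_norm_vec: "(norm (x :: complex ^ 'n))\<^sup>2 = (\<Sum>i\<in>UNIV. (cmod (x $ i))\<^sup>2)"
  by (simp add: norm_vec_def L2_set_def sum_nonneg)

lemma mat_power_ratH: "W \<in> ratH_mat \<Longrightarrow> mat_power W k \<in> ratH_mat"
  by (induction k) (auto simp: ratH_mat_1 ratH_mat_mult)

lemma mat_eval_mat_power:
  "W \<in> ratH_mat \<Longrightarrow> cmod z \<le> 1 \<Longrightarrow> mat_eval (mat_power W k) z = mat_power (mat_eval W z) k"
  by (induction k) (auto simp: mat_eval_mult mat_power_ratH)

text \<open>Multiplied by a common denominator, the rows of all \<open>M k\<close> become the
  polynomial rows of a spectral density; the member \<open>mat 1\<close> makes it nondegenerate. The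
  denominator contributes the positive scalar \<open>d z\<close>, which cancels when norms at the
  same \<open>z\<close> are compared.\<close>

lemma spectral_factor_of_ratH_family:
  fixes M :: "'k \<Rightarrow> real poly fract ^ 'n ^ 'n"
  assumes I: "finite I" and M: "\<And>k. k \<in> I \<Longrightarrow> M k \<in> ratH_mat" and one: "k0 \<in> I" "M k0 = mat 1"
  shows "\<exists>Y d. Y \<in> ratH_mat \<and> (\<forall>z. cmod z \<le> 1 \<longrightarrow> invertible (mat_eval Y z)) \<and>
    (\<forall>z a. cmod z = 1 \<longrightarrow> d z > 0 \<and> (norm (mat_eval Y z *v a))\<^sup>2 = d z * (\<Sum>k\<in>I. (norm (mat_eval (M k) z *v a))\<^sup>2))"
proof -
  define S where "S = (\<lambda>(k, i, l). M k $ i $ l) ` (I \<times> UNIV \<times> UNIV)"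
  have "finite S" "S \<subseteq> ratH"
    using I M by (auto simp: S_def ratH_mat_nth)
  from ratH_common_denominator[OF this] obtain d num
    where d: "\<forall>z. cmod z \<le> 1 \<longrightarrow> cpoly d z \<noteq> 0"
      and num: "\<forall>f\<in>S. \<forall>z. cmod z \<le> 1 \<longrightarrow> cpoly (num f) z = cpoly d z * rat_eval f z"
    by (elim exE conjE)
  define v where "v r = (\<chi> l. num (M (fst r) $ snd r $ l))" for r :: "'k \<times> 'n"
  define R where "R = I \<times> (UNIV :: 'n set)"
  have v: "cpoly (v (k, i) $ l) z = cpoly d z * mat_eval (M k) z $ i $ l" if "k \<in> I" "cmod z \<le> 1" for k i l z
  proof -
    have "M k $ i $ l \<in> S"
      unfolding S_def using that(1) by (intro image_eqI[of _ _ "(k, i, l)"]) auto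
    then show ?thesis
      using num that(2) by (simp add: v_def)
  qed
  have "finite ((\<lambda>(r, l). degree (v r $ l)) ` (R \<times> UNIV))"
    using I by (simp add: R_def)
  then obtain N where N: "\<forall>x\<in>(\<lambda>(r, l). degree (v r $ l)) ` (R \<times> UNIV). x \<le> N"
    using finite_nat_set_iff_bounded_le by blast
  have "spectral_density R v N"
  proof
    show "finite R"
      using I by (simp add: R_def)
    show "degree (v r $ l) \<le> N" if "r \<in> R" for r l
      using N that by force
    show "\<exists>r\<in>R. herm (cvec (v r) z) a \<noteq> 0" if z: "cmod z = 1" and a: "a \<noteq> 0" for z a
    proof -
      obtain i where i: "a $ i \<noteq> 0"
        using a by (auto simp: vec_eq_iff)
      have "herm (cvec (v (k0, i)) z) a = (\<Sum>l\<in>UNIV. cnj (cpoly d z * (if i = l then 1 else 0)) * a $ l)"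
        unfolding herm_def using one z by (intro sum.cong) (simp_all add: cvec_def v mat_def rat_eval_0 rat_eval_1)
      also have "\<dots> = cnj (cpoly d z) * a $ i"
        by (simp add: if_distrib[of cnj] if_distrib[of "\<lambda>x. _ * x"] if_distrib[of "\<lambda>x. x * _"] cong: if_cong)
      finally have "herm (cvec (v (k0, i)) z) a \<noteq> 0"
        using i d z by simp
      moreover have "(k0, i) \<in> R"
        using one by (simp add: R_def)
      ultimately show ?thesis
        by blast
    qed
  qed
  from spectral_density.spectral_factor[OF this] obtain Y :: "real poly ^ 'n ^ 'n"
    where inv: "\<forall>z. cmod z \<le> 1 \<longrightarrow> invertible (map_matrix (\<lambda>p. cpoly p z) Y)"
      and Y: "\<forall>z a. cmod z = 1 \<longrightarrow> (norm (map_matrix (\<lambda>p. cpoly p z) Y *v a))\<^sup>2 =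
        (\<Sum>r\<in>R. (cmod (\<Sum>l\<in>UNIV. cpoly (v r $ l) z * a $ l))\<^sup>2)"
    by (elim exE conjE)
  define Y' where "Y' = map_matrix (\<lambda>p. Fraction_Field.Fract p 1) Y"
  have Y': "mat_eval Y' z = map_matrix (\<lambda>p. cpoly p z) Y" for z
    by (simp add: vec_eq_iff Y'_def rat_eval_Fract_cpoly)
  have norm_eq: "(norm (mat_eval Y' z *v a))\<^sup>2 = (cmod (cpoly d z))\<^sup>2 * (\<Sum>k\<in>I. (norm (mat_eval (M k) z *v a))\<^sup>2)"
    if z: "cmod z = 1" for z a
  proof -
    have "(\<Sum>l\<in>UNIV. cpoly (v (k, i) $ l) z * a $ l) = cpoly d z * (mat_eval (M k) z *v a) $ i" if "k \<in> I" for k i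
      using that z by (simp add: v matrix_vector_mult_def sum_distrib_left mult.assoc)
    then have "(\<Sum>k\<in>I. \<Sum>i\<in>UNIV. (cmod (\<Sum>l\<in>UNIV. cpoly (v (k, i) $ l) z * a $ l))\<^sup>2) =
        (cmod (cpoly d z))\<^sup>2 * (\<Sum>k\<in>I. (norm (mat_eval (M k) z *v a))\<^sup>2)"
      by (simp add: norm_mult power_mult_distrib power2_norm_vec sum_distrib_left cong: sum.cong)
    then show ?thesis
      using Y z by (simp add: Y' R_def sum.cartesian_product')
  qed
  show ?thesis
  proof (rule exI[of _ Y'], rule exI[of _ "\<lambda>z. (cmod (cpoly d z))\<^sup>2"], intro conjI allI impI)
    show "Y' \<in> ratH_mat"
      by (simp add: ratH_mat_def Y'_def ratH_Fract_1)
    show "invertible (mat_eval Y' z)" if "cmod z \<le> 1" for z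
      using inv that by (simp add: Y')
    show "(cmod (cpoly d z))\<^sup>2 > 0" if "cmod z = 1" for z
      using d that by simp
  qed (rule norm_eq)
qed

section \<open>The approximants over the ring and simultaneous contraction\<close>

lemma binom_mat_ratH:
  assumes "A \<in> ratH_mat"
  shows "fst (binom_mat A m) \<in> ratH_mat" "snd (binom_mat A m) \<in> ratH_mat"
proof (induction m)
  case 0
  show "fst (binom_mat A 0) \<in> ratH_mat" "snd (binom_mat A 0) \<in> ratH_mat"
    by (simp_all add: ratH_mat_1) (simp add: ratH_mat_def ratH_0)
next
  case (Suc m)
  then show "fst (binom_mat A (Suc m)) \<in> ratH_mat" "snd (binom_mat A (Suc m)) \<in> ratH_mat"
    by (simp_all add: ratH_mat_add ratH_mat_mult assms)
qed

lemma mat_eval_binom_mat: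
  assumes "A \<in> ratH_mat" "cmod z \<le> 1"
  shows "mat_eval (fst (binom_mat A m)) z = fst (binom_mat (mat_eval A z) m) \<and>
    mat_eval (snd (binom_mat A m)) z = snd (binom_mat (mat_eval A z) m)"
proof (induction m)
  case 0
  show ?case
    by (simp add: vec_eq_iff rat_eval_0)
next
  case (Suc m)
  then show ?case
    using assms by (simp add: mat_eval_add mat_eval_mult ratH_mat_mult binom_mat_ratH)
qed

lemma binom_mat_commute:
  assumes "M ** A = A ** M"
  shows "M ** fst (binom_mat A m) = fst (binom_mat A m) ** M \<and> M ** snd (binom_mat A m) = snd (binom_mat A m) ** M"
proof (induction m)
  case (Suc m)
  have "M ** (A ** snd (binom_mat A m)) = A ** snd (binom_mat A m) ** M"
    using Suc assms by (metis matrix_mul_assoc)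
  with Suc show ?case
    by (simp add: matrix_add_ldistrib matrix_add_rdistrib)
qed simp

lemma matrix_inv_commute:
  fixes M N :: "'a::field ^ 'n ^ 'n"
  assumes "M ** N = N ** M" "invertible N"
  shows "M ** matrix_inv N = matrix_inv N ** M"
proof -
  have "matrix_inv N ** (M ** N) ** matrix_inv N = matrix_inv N ** (N ** M) ** matrix_inv N"
    by (simp only: assms(1))
  moreover have "matrix_inv N ** (M ** N) ** matrix_inv N = matrix_inv N ** M ** (N ** matrix_inv N)"
    by (simp only: matrix_mul_assoc)
  moreover have "matrix_inv N ** (N ** M) ** matrix_inv N = (matrix_inv N ** N) ** M ** matrix_inv N"
    by (simp only: matrix_mul_assoc)
  ultimately show ?thesis
    by (simp add: matrix_inv_left_mult matrix_inv_right_mult assms(2))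
qed

text \<open>An eigenvalue \<open>\<nu>\<close> of the quotient makes \<open>p - \<nu> q\<close>
  annihilate a nonzero vector, so \<open>p\<close> equals \<open>\<nu> q\<close> at some eigenvalue
  \<open>\<mu>\<close> of \<open>X\<close>. The values at 1 guarantee that
  \<open>p - \<nu> q\<close> is not the zero polynomial when \<open>\<nu>\<close> is
  nonzero.\<close>

lemma spectrum_quotient:
  fixes X T S :: "complex ^ 'n ^ 'n"
  assumes T: "\<And>x. T *v x = poly_act p X x" and S: "\<And>x. S *v x = poly_act q X x"
    and less: "\<And>\<mu>. \<mu> \<in> spectrum X \<Longrightarrow> cmod (poly p \<mu>) < cmod (poly q \<mu>)"
    and pq: "poly p 1 = 0" "poly q 1 \<noteq> 0"
  shows "invertible S" and "\<nu> \<in> spectrum (T ** matrix_inv S) \<Longrightarrow> cmod \<nu> < 1"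
proof -
  show inv: "invertible S"
  proof (rule invertible_if_ker_trivial, rule ccontr)
    fix x assume "S *v x = 0" "x \<noteq> 0"
    moreover have "q \<noteq> 0"
      using pq(2) by auto
    ultimately obtain \<mu> where "\<mu> \<in> spectrum X" "poly q \<mu> = 0"
      using eigenvalue_from_annihilator[of q X x] by (auto simp: S)
    then show False
      using less[of \<mu>] by simp
  qed
  assume "\<nu> \<in> spectrum (T ** matrix_inv S)"
  then obtain v where v: "v \<noteq> 0" "(T ** matrix_inv S) *v v = \<nu> *s v"
    by (auto simp: spectrum_def)
  define u where "u = matrix_inv S *v v"
  have Su: "S *v u = v"
    by (simp add: u_def matrix_vector_mul_assoc matrix_inv_right_mult inv)
  then have "u \<noteq> 0"
    using v(1) by auto
  have "T *v u = \<nu> *s (S *v u)"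
    using v(2) Su by (simp add: u_def matrix_vector_mul_assoc)
  then have "poly_act (p - smult \<nu> q) X u = 0"
    by (simp add: poly_act_diff poly_act_smult T S)
  show "cmod \<nu> < 1"
  proof (cases "\<nu> = 0")
    case False
    then have "poly (p - smult \<nu> q) 1 \<noteq> 0"
      using pq by simp
    then have "p - smult \<nu> q \<noteq> 0"
      by auto
    then obtain \<mu> where "\<mu> \<in> spectrum X" "poly (p - smult \<nu> q) \<mu> = 0"
      using eigenvalue_from_annihilator[OF _ \<open>poly_act (p - smult \<nu> q) X u = 0\<close> \<open>u \<noteq> 0\<close>] by blast
    then have "cmod \<nu> * cmod (poly q \<mu>) < 1 * cmod (poly q \<mu>)"
      using less[of \<mu>] by (simp add: norm_mult)
    then show ?thesis
      by (rule mult_right_less_imp_less) simp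
  qed simp
qed

lemma matrix_double_eq_iff: "M + M = N + N \<longleftrightarrow> M = (N :: real poly fract ^ 'n ^ 'n)"
proof -
  have "rat_eval (1 + 1) 0 = 2"
    by (subst rat_eval_add) (auto simp: ratH_1 rat_eval_1)
  then have "(1 + 1 :: real poly fract) \<noteq> 0"
    by (metis rat_eval_0 zero_neq_numeral)
  moreover have "x + x = y + y \<longleftrightarrow> (1 + 1) * x = (1 + 1) * y" for x y :: "real poly fract"
    by (simp add: distrib_right)
  ultimately show ?thesis
    by (simp add: vec_eq_iff del: one_add_one)
qed

text \<open>Formally \<open>cayley Q\<close> is \<open>Y (S + T) (S - T)^-1 Y^-1\<close>. The
  equation is kept multiplied out, which avoids inverting \<open>S - T\<close>.\<close>

lemma cayley_conjugate_quotient: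
  fixes Q Y S T :: "real poly fract ^ 'n ^ 'n"
  assumes Q: "Q \<in> ratH_mat" "Hinf_norm Q < 1"
    and inv: "invertible Y" "invertible S"
    and Q_def: "Q = Y ** (T ** matrix_inv S) ** matrix_inv Y"
  shows "cayley Q ** Y ** (S - T) = Y ** (S + T)"
proof -
  have "Q ** Y ** S = Y ** T ** (matrix_inv S ** (matrix_inv Y ** Y) ** S)"
    by (simp only: Q_def matrix_mul_assoc)
  then have QYS: "Q ** Y ** S = Y ** T"
    by (simp add: matrix_inv_left_mult inv)
  have "cayley Q ** (mat 1 - Q) ** Y ** S = (mat 1 + Q) ** Y ** S"
    by (simp only: cayley_mult[OF Q])
  then show ?thesis
    by (simp add: matrix_mul_assoc[symmetric] matrix_diff_rdistrib matrix_add_rdistrib matrix_diff_ldistrib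
        matrix_add_ldistrib QYS[unfolded matrix_mul_assoc[symmetric]])
qed

lemma mat_power_commute:
  assumes "X ** Z = Z ** X"
  shows "mat_power X j ** mat_power Z k = mat_power Z k ** mat_power X j"
proof -
  have "X ** mat_power Z k = mat_power Z k ** X"
    by (induction k) (auto simp: matrix_mul_assoc assms, metis assms matrix_mul_assoc)
  then show ?thesis
    by (induction j) (auto simp: matrix_mul_assoc, metis matrix_mul_assoc)
qed

lemma Hinf_norm_conjugate_less_1:
  fixes W Y :: "real poly fract ^ 'n ^ 'n"
  assumes W: "W \<in> ratH_mat" and Y: "Y \<in> ratH_mat" "matrix_inv Y \<in> ratH_mat" "invertible Y"
    and less: "\<And>z a. cmod z = 1 \<Longrightarrow> a \<noteq> 0 \<Longrightarrow>
      norm (mat_eval Y z *v (mat_eval W z *v a)) < norm (mat_eval Y z *v a)"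
  shows "Hinf_norm (Y ** W ** matrix_inv Y) < 1"
proof (rule Hinf_norm_less_1)
  show "Y ** W ** matrix_inv Y \<in> ratH_mat"
    by (intro ratH_mat_mult W Y)
  fix z :: complex and x :: "complex ^ 'n" assume z: "cmod z = 1" and x: "x \<noteq> 0"
  then have z1: "cmod z \<le> 1"
    by simp
  define a where "a = mat_eval (matrix_inv Y) z *v x"
  have Ya: "mat_eval Y z *v a = x"
    by (simp add: a_def matrix_vector_mul_assoc mat_eval_matrix_inv Y z1)
  then have "a \<noteq> 0"
    using x by auto
  have "mat_eval (Y ** W ** matrix_inv Y) z *v x = mat_eval Y z *v (mat_eval W z *v a)"
    by (simp add: mat_eval_mult W Y z1 ratH_mat_mult a_def matrix_vector_mul_assoc matrix_mul_assoc)
  with less[OF z \<open>a \<noteq> 0\<close>] show "norm (mat_eval (Y ** W ** matrix_inv Y) z *v x) < norm x"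
    by (simp add: Ya)
qed

text \<open>The weight \<open>\<Sum>\<^sub>j\<^sub>k |W1\<^sup>j W2\<^sup>k a|\<^sup>2\<close> makes both matrices contractions on the circle; its spectral
  factor \<open>Y\<close> turns the weighted norm into the Euclidean one.\<close>

lemma simultaneous_contraction:
  fixes W1 W2 :: "real poly fract ^ 'n ^ 'n"
  assumes W: "W1 \<in> ratH_mat" "W2 \<in> ratH_mat" and comm: "W1 ** W2 = W2 ** W1"
    and spec1: "\<And>z \<mu>. cmod z = 1 \<Longrightarrow> \<mu> \<in> spectrum (mat_eval W1 z) \<Longrightarrow> cmod \<mu> < 1"
    and spec2: "\<And>z \<mu>. cmod z = 1 \<Longrightarrow> \<mu> \<in> spectrum (mat_eval W2 z) \<Longrightarrow> cmod \<mu> < 1"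
  shows "\<exists>Y \<in> GL_ratH. Hinf_norm (Y ** W1 ** matrix_inv Y) < 1 \<and> Hinf_norm (Y ** W2 ** matrix_inv Y) < 1"
proof -
  have power: "\<exists>K>0. \<forall>z\<in>sphere 0 1. \<forall>j>0. entry_sum (mat_power (mat_eval W z) (K * j)) < 1"
    if W: "W \<in> ratH_mat" and spec: "\<And>z \<mu>. cmod z = 1 \<Longrightarrow> \<mu> \<in> spectrum (mat_eval W z) \<Longrightarrow> cmod \<mu> < 1"
    for W :: "real poly fract ^ 'n ^ 'n"
  proof (rule uniform_power_less_1)
    show "continuous_on (sphere 0 1) (\<lambda>z. mat_eval W z $ i $ j)" for i j
      using W by (simp add: analytic_on_continuous_circle rat_eval_analytic ratH_mat_nth)
    show "cmod \<mu> < 1" if "z \<in> sphere 0 1" "\<mu> \<in> spectrum (mat_eval W z)" for z \<mu>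
      using spec[of z \<mu>] that by simp
  qed simp
  have ex1: "\<exists>K>0. \<forall>z\<in>sphere 0 1. \<forall>j>0. entry_sum (mat_power (mat_eval W1 z) (K * j)) < 1"
    by (rule power[OF W(1)]) (rule spec1)
  have ex2: "\<exists>K>0. \<forall>z\<in>sphere 0 1. \<forall>j>0. entry_sum (mat_power (mat_eval W2 z) (K * j)) < 1"
    by (rule power[OF W(2)]) (rule spec2)
  obtain K1 where K1: "K1 > 0" "\<forall>z\<in>sphere 0 1. \<forall>j>0. entry_sum (mat_power (mat_eval W1 z) (K1 * j)) < 1"
    using ex1 by blast
  obtain K2 where K2: "K2 > 0" "\<forall>z\<in>sphere 0 1. \<forall>j>0. entry_sum (mat_power (mat_eval W2 z) (K2 * j)) < 1"
    using ex2 by blast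
  define K where "K = K1 * K2"
  have K: "0 < K"
    using K1(1) K2(1) by (simp add: K_def)
  have small: "entry_sum (mat_power (mat_eval W1 z) K) < 1" "entry_sum (mat_power (mat_eval W2 z) K) < 1"
    if "cmod z = 1" for z
    using K1 K2 that by (simp_all add: K_def) (simp add: mult.commute)
  define I where "I = {..<K} \<times> {..<K}"
  define M where "M = (\<lambda>(j, k). mat_power W1 j ** mat_power W2 k)"
  have "\<exists>Y d. Y \<in> ratH_mat \<and> (\<forall>z. cmod z \<le> 1 \<longrightarrow> invertible (mat_eval Y z)) \<and>
    (\<forall>z a. cmod z = 1 \<longrightarrow> d z > 0 \<and> (norm (mat_eval Y z *v a))\<^sup>2 = d z * (\<Sum>k\<in>I. (norm (mat_eval (M k) z *v a))\<^sup>2))"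
  proof (rule spectral_factor_of_ratH_family)
    show "finite I" "(0, 0) \<in> I" "M (0, 0) = mat 1"
      using K by (simp_all add: I_def M_def)
    show "M k \<in> ratH_mat" for k
      using W by (simp add: M_def mat_power_ratH ratH_mat_mult split: prod.split)
  qed
  then obtain Y d where Y: "Y \<in> ratH_mat" and inv: "\<forall>z. cmod z \<le> 1 \<longrightarrow> invertible (mat_eval Y z)"
    and norm_Y: "\<forall>z a. cmod z = 1 \<longrightarrow> d z > 0 \<and> (norm (mat_eval Y z *v a))\<^sup>2 = d z * (\<Sum>k\<in>I. (norm (mat_eval (M k) z *v a))\<^sup>2)"
    by (elim exE conjE)
  have Y_inv: "matrix_inv Y \<in> ratH_mat" "invertible Y"
    using inv by (auto intro!: matrix_inv_ratH Y invertible_if_mat_eval[of Y 0])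
  have less: "norm (mat_eval Y z *v b) < norm (mat_eval Y z *v a)"
    if z: "cmod z = 1" and "(\<Sum>j<K. \<Sum>k<K. (norm (mat_power (mat_eval W1 z) j *v (mat_power (mat_eval W2 z) k *v b)))\<^sup>2)
      < (\<Sum>j<K. \<Sum>k<K. (norm (mat_power (mat_eval W1 z) j *v (mat_power (mat_eval W2 z) k *v a)))\<^sup>2)" for z a b
  proof -
    have "mat_eval (M (j, k)) z *v a = mat_power (mat_eval W1 z) j *v (mat_power (mat_eval W2 z) k *v a)" for j k a
      using W z by (simp add: M_def mat_eval_mult mat_eval_mat_power mat_power_ratH matrix_vector_mul_assoc)
    then have "(norm (mat_eval Y z *v a))\<^sup>2 =
      d z * (\<Sum>j<K. \<Sum>k<K. (norm (mat_power (mat_eval W1 z) j *v (mat_power (mat_eval W2 z) k *v a)))\<^sup>2)" for a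
      using norm_Y z by (simp add: I_def sum.cartesian_product')
    moreover have "d z > 0"
      using norm_Y z by blast
    ultimately have "(norm (mat_eval Y z *v b))\<^sup>2 < (norm (mat_eval Y z *v a))\<^sup>2"
      using that(2) by (simp add: mult_strict_left_mono)
    then show ?thesis
      by (rule power2_less_imp_less) simp
  qed
  have commz: "mat_eval W1 z ** mat_eval W2 z = mat_eval W2 z ** mat_eval W1 z" if "cmod z = 1" for z
    using comm W that by (simp add: mat_eval_mult[symmetric])
  have less1: "norm (mat_eval Y z *v (mat_eval W1 z *v a)) < norm (mat_eval Y z *v a)"
    if z: "cmod z = 1" and "a \<noteq> 0" for z a
    by (rule less[OF z], rule commuting_powers_contraction) (use commz small K that in auto)
  \<comment> \<open>The weight is symmetric in the two matrices because their powers commute;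
    exchanging their roles gives the second contraction.\<close>
  have less2: "norm (mat_eval Y z *v (mat_eval W2 z *v a)) < norm (mat_eval Y z *v a)"
    if z: "cmod z = 1" and a: "a \<noteq> 0" for z a
  proof (rule less[OF z])
    let ?X = "mat_eval W1 z" and ?Z = "mat_eval W2 z"
    have "(\<Sum>j<K. \<Sum>k<K. (norm (mat_power ?X j *v (mat_power ?Z k *v b)))\<^sup>2) =
        (\<Sum>j<K. \<Sum>k<K. (norm (mat_power ?Z j *v (mat_power ?X k *v b)))\<^sup>2)" for b
      by (subst sum.swap) (simp add: matrix_vector_mul_assoc mat_power_commute[OF commz[OF z]])
    moreover have "(\<Sum>j<K. \<Sum>k<K. (norm (mat_power ?Z j *v (mat_power ?X k *v (?Z *v a))))\<^sup>2)
        < (\<Sum>j<K. \<Sum>k<K. (norm (mat_power ?Z j *v (mat_power ?X k *v a)))\<^sup>2)"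
      by (rule commuting_powers_contraction) (use commz small K z a in auto)
    ultimately show "(\<Sum>j<K. \<Sum>k<K. (norm (mat_power ?X j *v (mat_power ?Z k *v (?Z *v a))))\<^sup>2)
        < (\<Sum>j<K. \<Sum>k<K. (norm (mat_power ?X j *v (mat_power ?Z k *v a)))\<^sup>2)"
      by (simp only:)
  qed
  show ?thesis
  proof (intro bexI conjI)
    show "Y \<in> GL_ratH"
      by (simp add: GL_ratH_def Y Y_inv)
    show "Hinf_norm (Y ** W1 ** matrix_inv Y) < 1"
      by (intro Hinf_norm_conjugate_less_1 W Y Y_inv less1)
    show "Hinf_norm (Y ** W2 ** matrix_inv Y) < 1"
      by (intro Hinf_norm_conjugate_less_1 W Y Y_inv less2)
  qed
qed

section \<open>The factorisation and the characterisation\<close>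

lemma A_cut_cayley_product:
  fixes A :: "real poly fract ^ 'n ^ 'n"
  assumes A_cut: "A \<in> A_cut"
  obtains U Q1 Q2 where "A = matrix_inv U ** cayley Q1 ** cayley Q2 ** U" "U \<in> GL_ratH"
    "Q1 \<in> ratH_mat" "Q2 \<in> ratH_mat" "Hinf_norm Q1 < 1" "Hinf_norm Q2 < 1"
proof -
  have A: "A \<in> ratH_mat"
    using A_cut by (simp add: A_cut_def)
  obtain m where m: "m > 0" and sep: "\<And>z \<mu>. cmod z \<le> 1 \<Longrightarrow> \<mu> \<in> spectrum (mat_eval A z) \<Longrightarrow>
      cmod (poly (fst (binom_poly m)) \<mu> - poly (snd (binom_poly m)) \<mu>)
        < cmod (poly (fst (binom_poly m)) \<mu> + poly (snd (binom_poly m)) \<mu>) \<and>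
      cmod (\<mu> * poly (snd (binom_poly m)) \<mu> - poly (fst (binom_poly m)) \<mu>)
        < cmod (\<mu> * poly (snd (binom_poly m)) \<mu> + poly (fst (binom_poly m)) \<mu>)"
    using A_cut_binom_separation[OF A_cut] by blast
  define e d where "e = fst (binom_poly m)" and "d = snd (binom_poly m)"
  note sep = sep[folded e_def d_def]
  \<comment> \<open>At \<open>\<mu> = 1\<close> the roots are 1 and -1, so the values are
    \<open>(1 + 1)^m\<close> and \<open>(1 - 1)^m\<close>; the latter is 0 because
    \<open>m > 0\<close>.\<close>
  have ed: "poly e 1 + poly d 1 = 2 ^ m" "poly e 1 - poly d 1 = 0"
    using binom_poly_eq[of 1 1 m] binom_poly_eq[of "- 1" 1 m] m by (simp_all add: e_def d_def)
  define E D where "E = fst (binom_mat A m)" and "D = snd (binom_mat A m)"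
  have ED: "E \<in> ratH_mat" "D \<in> ratH_mat"
    unfolding E_def D_def by (rule binom_mat_ratH[OF A])+
  have evalED: "mat_eval E z *v x = poly_act e (mat_eval A z) x" "mat_eval D z *v x = poly_act d (mat_eval A z) x"
    if "cmod z \<le> 1" for z x
    using that by (simp_all add: E_def D_def e_def d_def mat_eval_binom_mat[OF A] binom_mat_mult_vec)
  \<comment> \<open>The inverse Cayley transform of \<open>x\<close> is
    \<open>(x - 1) / (x + 1)\<close>. For \<open>x = E / D\<close> and \<open>x = A D / E\<close> it
    is \<open>T1 / S1\<close> and \<open>T2 / S2\<close>; here \<open>D\<close> is the odd part
    \<open>O\<close>.\<close>
  define T1 S1 T2 S2 where "T1 = E - D" and "S1 = E + D" and "T2 = A ** D - E" and "S2 = A ** D + E"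
  have TS: "T1 \<in> ratH_mat" "S1 \<in> ratH_mat" "T2 \<in> ratH_mat" "S2 \<in> ratH_mat"
    unfolding T1_def S1_def T2_def S2_def by (intro ratH_mat_add ratH_mat_diff ratH_mat_mult A ED)+
  have evalTS: "mat_eval T1 z *v x = poly_act (e - d) (mat_eval A z) x"
      "mat_eval S1 z *v x = poly_act (e + d) (mat_eval A z) x"
      "mat_eval T2 z *v x = poly_act (pCons 0 d - e) (mat_eval A z) x"
      "mat_eval S2 z *v x = poly_act (pCons 0 d + e) (mat_eval A z) x"
    if "cmod z \<le> 1" for z x
    using that by (simp_all add: T1_def S1_def T2_def S2_def mat_eval_add mat_eval_diff mat_eval_mult A ED ratH_mat_mult
        matrix_vector_mult_add_rdistrib matrix_vector_mult_diff_rdistrib evalED poly_act_add poly_act_diff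
        poly_act_pCons matrix_vector_mul_assoc[symmetric])
  have quot1: "invertible (mat_eval S1 z)"
      "\<nu> \<in> spectrum (mat_eval T1 z ** matrix_inv (mat_eval S1 z)) \<Longrightarrow> cmod \<nu> < 1" if z: "cmod z \<le> 1" for z \<nu>
    by (rule spectrum_quotient[OF evalTS(1,2)[OF z]], use sep[OF z] ed in simp_all)+
  have quot2: "invertible (mat_eval S2 z)"
      "\<nu> \<in> spectrum (mat_eval T2 z ** matrix_inv (mat_eval S2 z)) \<Longrightarrow> cmod \<nu> < 1" if z: "cmod z \<le> 1" for z \<nu>
    by (rule spectrum_quotient[OF evalTS(3,4)[OF z]], use sep[OF z] ed in \<open>simp_all add: add.commute\<close>)+
  have invS: "invertible S1" "invertible S2" "matrix_inv S1 \<in> ratH_mat" "matrix_inv S2 \<in> ratH_mat"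
    using quot1(1) quot2(1) by (auto intro!: invertible_if_mat_eval[of _ 0] matrix_inv_ratH TS)
  define W1 W2 where "W1 = T1 ** matrix_inv S1" and "W2 = T2 ** matrix_inv S2"
  have W: "W1 \<in> ratH_mat" "W2 \<in> ratH_mat"
    unfolding W1_def W2_def by (intro ratH_mat_mult TS invS)+
  have evalW: "mat_eval W1 z = mat_eval T1 z ** matrix_inv (mat_eval S1 z)"
      "mat_eval W2 z = mat_eval T2 z ** matrix_inv (mat_eval S2 z)" if "cmod z \<le> 1" for z
    using that matrix_inv_eqI[OF mat_eval_matrix_inv(1)[OF TS(2) invS(3) invS(1) that]]
      matrix_inv_eqI[OF mat_eval_matrix_inv(1)[OF TS(4) invS(4) invS(2) that]]
    by (simp_all add: W1_def W2_def mat_eval_mult TS invS)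
  have comm: "A ** E = E ** A" "A ** D = D ** A" "D ** E = E ** D"
    using binom_mat_commute[of A A m] binom_mat_commute[of D A m] by (simp_all add: E_def D_def)
  have AD: "E ** (A ** D) = A ** D ** E" "D ** (A ** D) = A ** D ** D"
    by (metis comm matrix_mul_assoc)+
  have commTS: "T1 ** T2 = T2 ** T1" "T1 ** S2 = S2 ** T1" "S1 ** T2 = T2 ** S1" "S1 ** S2 = S2 ** S1"
    by (simp_all add: T1_def T2_def S1_def S2_def matrix_add_ldistrib matrix_add_rdistrib matrix_diff_ldistrib
        matrix_diff_rdistrib AD comm(3))
  have commW: "W1 ** W2 = W2 ** W1"
  proof -
    have a: "T1 ** W2 = W2 ** T1" "S1 ** W2 = W2 ** S1"
      unfolding W2_def using commTS matrix_inv_commute[OF commTS(2) invS(2)] matrix_inv_commute[OF commTS(4) invS(2)]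
      by (metis matrix_mul_assoc)+
    then have "W2 ** matrix_inv S1 = matrix_inv S1 ** W2"
      by (intro matrix_inv_commute invS) simp
    with a(1) show ?thesis
      unfolding W1_def by (metis matrix_mul_assoc)
  qed
  have "\<exists>U\<in>GL_ratH. Hinf_norm (U ** W1 ** matrix_inv U) < 1 \<and> Hinf_norm (U ** W2 ** matrix_inv U) < 1"
  proof (rule simultaneous_contraction[OF W commW])
    fix z \<mu> assume z: "cmod z = 1"
    show "cmod \<mu> < 1" if "\<mu> \<in> spectrum (mat_eval W1 z)"
      using quot1(2)[of z \<mu>] that z by (simp add: evalW)
    show "cmod \<mu> < 1" if "\<mu> \<in> spectrum (mat_eval W2 z)"
      using quot2(2)[of z \<mu>] that z by (simp add: evalW)
  qed
  then obtain U where U: "U \<in> GL_ratH" "Hinf_norm (U ** W1 ** matrix_inv U) < 1" "Hinf_norm (U ** W2 ** matrix_inv U) < 1"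
    by blast
  have U': "U \<in> ratH_mat" "matrix_inv U \<in> ratH_mat" "invertible U"
    using U(1) by (auto simp: GL_ratH_def)
  define Q1 Q2 where "Q1 = U ** W1 ** matrix_inv U" and "Q2 = U ** W2 ** matrix_inv U"
  have Q: "Q1 \<in> ratH_mat" "Q2 \<in> ratH_mat"
    unfolding Q1_def Q2_def by (intro ratH_mat_mult U' W)+
  have less: "Hinf_norm Q1 < 1" "Hinf_norm Q2 < 1"
    using U by (simp_all add: Q1_def Q2_def)
  have ST: "S1 - T1 = D + D" "S1 + T1 = E + E" "S2 - T2 = E + E" "S2 + T2 = A ** D + A ** D"
    by (simp_all add: S1_def T1_def S2_def T2_def)
  have "cayley Q1 ** U ** (S1 - T1) = U ** (S1 + T1)"
    by (rule cayley_conjugate_quotient[OF Q(1) less(1) U'(3) invS(1)]) (simp add: Q1_def W1_def)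
  then have "cayley Q1 ** U ** D + cayley Q1 ** U ** D = U ** E + U ** E"
    by (simp only: ST matrix_add_ldistrib)
  then have C1: "cayley Q1 ** U ** D = U ** E"
    by (simp only: matrix_double_eq_iff)
  have "cayley Q2 ** U ** (S2 - T2) = U ** (S2 + T2)"
    by (rule cayley_conjugate_quotient[OF Q(2) less(2) U'(3) invS(2)]) (simp add: Q2_def W2_def)
  then have "cayley Q2 ** U ** E + cayley Q2 ** U ** E = U ** (A ** D) + U ** (A ** D)"
    by (simp only: ST matrix_add_ldistrib)
  then have C2: "cayley Q2 ** U ** E = U ** (A ** D)"
    by (simp only: matrix_double_eq_iff)
  \<comment> \<open>If \<open>e\<close> vanished at an eigenvalue, the first separation inequality
    would compare the modulus of \<open>d\<close> with itself.\<close>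
  have "invertible (mat_eval E 0)"
  proof (rule invertible_if_ker_trivial, rule ccontr)
    fix x assume x: "mat_eval E 0 *v x = 0" "x \<noteq> 0"
    have "e \<noteq> 0"
      using ed by auto
    then obtain \<mu> where "\<mu> \<in> spectrum (mat_eval A 0)" "poly e \<mu> = 0"
      using eigenvalue_from_annihilator[of e "mat_eval A 0" x] x evalED(1)[of 0 x] by auto
    then show False
      using sep[of 0 \<mu>] by simp
  qed
  then have invE: "invertible E"
    by (intro invertible_if_mat_eval[of E 0] ED) auto
  \<comment> \<open>The two equations telescope: conjugated by \<open>U\<close>, the Cayley factors
    act as \<open>E / D\<close> and \<open>A D / E\<close>, and \<open>D\<close> is passed across by
    commutation. Only \<open>E\<close> has to be cancelled at the end.\<close>
  have "cayley Q1 ** cayley Q2 ** U ** E = cayley Q1 ** U ** D ** A"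
    using C2 comm(2) by (metis matrix_mul_assoc)
  also have "\<dots> = U ** A ** E"
    using C1 comm(1) by (metis matrix_mul_assoc)
  finally have "cayley Q1 ** cayley Q2 ** U ** (E ** matrix_inv E) = U ** A ** (E ** matrix_inv E)"
    by (simp only: matrix_mul_assoc)
  then have UA: "cayley Q1 ** cayley Q2 ** U = U ** A"
    by (simp add: matrix_inv_right_mult invE)
  have "matrix_inv U ** cayley Q1 ** cayley Q2 ** U = matrix_inv U ** (cayley Q1 ** cayley Q2 ** U)"
    by (simp only: matrix_mul_assoc)
  also have "\<dots> = matrix_inv U ** U ** A"
    by (simp only: UA matrix_mul_assoc)
  also have "\<dots> = A"
    by (simp add: matrix_inv_left_mult U')
  finally show ?thesis
    using that U(1) Q less by metis
qed

theorem theorem3: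
  shows "(A_cut :: (real poly fract ^ 'n::finite ^ 'n) set) =
    {matrix_inv U ** cayley Q1 ** cayley Q2 ** U | U Q1 Q2.
       U \<in> GL_ratH \<and> Q1 \<in> ratH_mat \<and> Q2 \<in> ratH_mat \<and>
       Hinf_norm Q1 < 1 \<and> Hinf_norm Q2 < 1}"
proof (intro set_eqI iffI)
  fix A :: "real poly fract ^ 'n ^ 'n"
  assume "A \<in> A_cut"
  then show "A \<in> {matrix_inv U ** cayley Q1 ** cayley Q2 ** U | U Q1 Q2.
       U \<in> GL_ratH \<and> Q1 \<in> ratH_mat \<and> Q2 \<in> ratH_mat \<and> Hinf_norm Q1 < 1 \<and> Hinf_norm Q2 < 1}"
    by (rule A_cut_cayley_product) blast
next
  fix A :: "real poly fract ^ 'n ^ 'n"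
  assume "A \<in> {matrix_inv U ** cayley Q1 ** cayley Q2 ** U | U Q1 Q2.
       U \<in> GL_ratH \<and> Q1 \<in> ratH_mat \<and> Q2 \<in> ratH_mat \<and> Hinf_norm Q1 < 1 \<and> Hinf_norm Q2 < 1}"
  then show "A \<in> A_cut"
    using cayley_product_in_A_cut by blast
qed

end
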